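(* Suppose that $\theta$ is in the interior of $\Theta$, that $\hat\theta_n$ satisfies $\sqrt n\,|\hat\theta_n-\theta|=O_P(1)$, and that $\lim_{x\to 0}x^{-\zeta}P\{|\varepsilon_0|\le x\}=0$ for some $\zeta>0$. Assume that the distribution of $\varepsilon_0$ has a uniformly continuous density function $f$. In addition, assume that the following three conditions hold: (i) $h_n>0$, $h_n\to0$, $\sqrt n\,h_n^2\to\infty$; (ii) $\sup_{|x|>b}|x|K(x)\to0$ as $b\to\infty$; (iii) $K$ is Lipschitz, that is, there exists a constant $C$ such that $|K(x)-K(y)|\le C|x-y|$ for all $x,y\in\mathbb R$. Then $E|\varepsilon_0|<\infty$ implies that, as $n\to\infty$, $$\sup_{x\in\mathbb R}|\hat f_n(x)-f_n(x)|=o_P(1).$$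
   Context: Model. Let $p,q\ge 1$ be integers and $\theta=(\alpha_0,\alpha_1,\dots,\alpha_p,\beta_1,\dots,\beta_q)$ with $\alpha_0>0$, $\alpha_i\ge 0$, $\beta_j\ge 0$. Let $\{\varepsilon_t\}_{t\in\mathbb Z}$ be i.i.d. random variables with mean $0$ and variance $1$. $\{X_t\}_{t\in\mathbb Z}$ is a GARCH$(p,q)$ sequence: $X_t=\sigma_t\varepsilon_t$, $\sigma_t^2=\alpha_0+\sum_{i=1}^p\alpha_iX_{t-i}^2+\sum_{j=1}^q\beta_j\sigma_{t-j}^2$. Standing assumption: the Bougerol–Picard conditions hold, under which these equations have a unique strictly stationary solution, with $\sigma_t$ a function of $\varepsilon_{t-1},\varepsilon_{t-2},\dots$; $\{X_t\}$ is this solution. Notation. $|\cdot|$ is the maximum norm of vectors. For $\mathbf u=(s_0,\dots,s_p,t_1,\dots,t_q)\in\mathbb R^{p+q+1}$ put $c_0(\mathbf u)=s_0/(1-(t_1+\cdots+t_q))$ and, recursively for $i\ge 1$, $c_i(\mathbf u)=s_i+\sum_{j=1}^{\min(i-1,q)}t_jc_{i-j}(\mathbf u)$ if $i\le p$, and $c_i(\mathbf u)=\sum_{j=1}^{\min(i-1,q)}t_jc_{i-j}(\mathbf u)$ if $i>p$. Fix $0<\underline u<\bar u$, $0<\rho_0<1$ with $q\underline u<\rho_0$, and let $\Theta$ be the set of $\mathbf u$ with $t_1+\cdots+t_q\le\rho_0$ and all coordinates of $\mathbf u$ in $[\underline u,\bar u]$. The conditional variance satisfies $\sigma_t^2=c_0(\theta)+\sum_{i=1}^\infty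 c_i(\theta)X_{t-i}^2$. Residuals. $\hat\theta_n$ is an estimator of $\theta$ based on $X_0,\dots,X_n$. For $1\le t\le n$, $\hat\sigma_t^2=c_0(\hat\theta_n)+\sum_{i=1}^tc_i(\hat\theta_n)X_{t-i}^2$ and $\hat\varepsilon_t=X_t/\hat\sigma_t$. Kernel estimators. $h_n$ is a sequence of positive numbers and $K$ is a probability density function (kernel) on $\mathbb R$ with mean $0$ and variance $1$. For $x\in\mathbb R$, $$\hat f_n(x)=\frac1{nh_n}\sum_{t=1}^nK\left(\frac{x-\hat\varepsilon_t}{h_n}\right),\qquad f_n(x)=\frac1{nh_n}\sum_{t=1}^nK\left(\frac{x-\varepsilon_t}{h_n}\right).$$ *)

theory Defs
  imports "HOL-Probability.Probability" "Jordan_Normal_Form.Matrix"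
begin

section \<open>Parameters\<close>

text \<open>
  A parameter vector \<open>u = (s\<^sub>0,\<dots>,s\<^sub>p,t\<^sub>1,\<dots>,t\<^sub>q)\<close> of \<open>\<real>\<^sup>p\<^sup>+\<^sup>q\<^sup>+\<^sup>1\<close> is an extensional function on \<open>{..p + q}\<close>:
  \<open>s\<^sub>i = u i\<close> for \<open>i \<le> p\<close>, and \<open>t\<^sub>j = u (p + j)\<close> for \<open>1 \<le> j \<le> q\<close>.
\<close>

definition param_space :: "nat \<Rightarrow> nat \<Rightarrow> (nat \<Rightarrow> real) set" where
  "param_space p q = ({..p + q} \<rightarrow>\<^sub>E UNIV)"

definition max_norm :: "nat \<Rightarrow> (nat \<Rightarrow> real) \<Rightarrow> real" where
  "max_norm d v = (MAX i\<in>{..<d}. \<bar>v i\<bar>)"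

definition Theta :: "nat \<Rightarrow> nat \<Rightarrow> real \<Rightarrow> real \<Rightarrow> real \<Rightarrow> (nat \<Rightarrow> real) set" where
  "Theta p q ulow uup rho0 =
     {u \<in> param_space p q.
        (\<Sum>j=1..q. u (p + j)) \<le> rho0 \<and> (\<forall>i\<le>p + q. ulow \<le> u i \<and> u i \<le> uup)}"

definition interior_Theta :: "nat \<Rightarrow> nat \<Rightarrow> real \<Rightarrow> real \<Rightarrow> real \<Rightarrow> (nat \<Rightarrow> real) set" where
  "interior_Theta p q ulow uup rho0 =
     (product_topology (\<lambda>_. euclideanreal) {..p + q}) interior_of (Theta p q ulow uup rho0)"

text \<open>Since \<open>x / 0 = 0\<close>, \<open>c\<^sub>0(u)\<close> is \<open>0\<close> when \<open>t\<^sub>1 + \<dots> + t\<^sub>q = 1\<close>; this does not occur on \<open>\<Theta>\<close>.\<close>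

fun garch_coeff :: "nat \<Rightarrow> nat \<Rightarrow> (nat \<Rightarrow> real) \<Rightarrow> nat \<Rightarrow> real" where
  "garch_coeff p q u i =
     (if i = 0 then u 0 / (1 - (\<Sum>j=1..q. u (p + j)))
      else (if i \<le> p then u i else 0)
           + (\<Sum>j=1..min (i - 1) q. u (p + j) * garch_coeff p q u (i - j)))"

declare garch_coeff.simps [simp del]

section \<open>The Bougerol--Picard conditions\<close>

text \<open>
  With \<open>Y\<^sub>t = (\<sigma>\<^sup>2\<^sub>t\<^sub>+\<^sub>1,\<dots>,\<sigma>\<^sup>2\<^sub>t\<^sub>-\<^sub>q\<^sub>+\<^sub>2, X\<^sup>2\<^sub>t,\<dots>,X\<^sup>2\<^sub>t\<^sub>-\<^sub>p\<^sub>+\<^sub>2)\<close>, a vector of dimension \<open>p + q - 1\<close>, the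
  GARCH equations read \<open>Y\<^sub>t = A\<^sub>t Y\<^sub>t\<^sub>-\<^sub>1 + (\<alpha>\<^sub>0,0,\<dots>,0)\<close>, where \<open>A\<^sub>t\<close> is the following matrix with
  \<open>e = \<epsilon>\<^sub>t\<close>. Its first row is
  \<open>(\<beta>\<^sub>1 + \<alpha>\<^sub>1 \<epsilon>\<^sup>2\<^sub>t, \<beta>\<^sub>2,\<dots>,\<beta>\<^sub>q, \<alpha>\<^sub>2,\<dots>,\<alpha>\<^sub>p)\<close>, row \<open>q\<close> (counting from \<open>0\<close>, absent if \<open>p = 1\<close>) is
  \<open>(\<epsilon>\<^sup>2\<^sub>t, 0,\<dots>,0)\<close>, and all other rows shift the entries by one.
\<close>

definition BP_matrix :: "nat \<Rightarrow> nat \<Rightarrow> (nat \<Rightarrow> real) \<Rightarrow> real \<Rightarrow> real mat" where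
  "BP_matrix p q u e = mat (p + q - 1) (p + q - 1) (\<lambda>(i, j).
     if i = 0 then
       (if j = 0 then u (p + 1) + u 1 * e\<^sup>2
        else if j < q then u (p + (j + 1))
        else u (j - q + 2))
     else if i = q then (if j = 0 then e\<^sup>2 else 0)
     else (if j = i - 1 then 1 else 0))"

definition op_norm :: "real mat \<Rightarrow> real" where
  "op_norm A =
     (SUP v\<in>{v \<in> carrier_vec (dim_col A). max_norm (dim_col A) (vec_index v) \<le> 1}.
        max_norm (dim_row A) (vec_index (A *\<^sub>v v)))"

text \<open>\<open>BP_product p q u e n\<close> is the product \<open>A\<^sub>0 A\<^sub>-\<^sub>1 \<cdots> A\<^sub>-\<^sub>n\<close>.\<close>

fun BP_product :: "nat \<Rightarrow> nat \<Rightarrow> (nat \<Rightarrow> real) \<Rightarrow> (int \<Rightarrow> real) \<Rightarrow> nat \<Rightarrow> real mat" where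
  "BP_product p q u e 0 = BP_matrix p q u (e 0)"
| "BP_product p q u e (Suc n) =
     BP_product p q u e n * BP_matrix p q u (e (- int (Suc n)))"

text \<open>
  Logarithm with \<open>log 0 = -\<infinity>\<close>, and expectation as the difference of the expectations of the
  positive and negative parts (\<open>e2ennreal\<close> sends negative numbers to \<open>0\<close>).
\<close>

definition ext_log :: "real \<Rightarrow> ereal" where
  "ext_log x = (if x \<le> 0 then - \<infinity> else ereal (ln x))"

definition ext_expectation :: "'a measure \<Rightarrow> ('a \<Rightarrow> ereal) \<Rightarrow> ereal" where
  "ext_expectation M Z =
     enn2ereal (\<integral>\<^sup>+ \<omega>. e2ennreal (Z \<omega>) \<partial>M) - enn2ereal (\<integral>\<^sup>+ \<omega>. e2ennreal (- Z \<omega>) \<partial>M)"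

definition top_lyapunov ::
    "nat \<Rightarrow> nat \<Rightarrow> (nat \<Rightarrow> real) \<Rightarrow> 'a measure \<Rightarrow> (int \<Rightarrow> 'a \<Rightarrow> real) \<Rightarrow> ereal" where
  "top_lyapunov p q u M eps =
     (INF n. ereal (1 / real (n + 1)) *
        ext_expectation M (\<lambda>\<omega>. ext_log (op_norm (BP_product p q u (\<lambda>t. eps t \<omega>) n))))"

text \<open>\<open>E log\<^sup>+ \<parallel>A\<^sub>0\<parallel> < \<infinity>\<close> and the top Lyapunov exponent is negative.\<close>

definition bougerol_picard ::
    "nat \<Rightarrow> nat \<Rightarrow> (nat \<Rightarrow> real) \<Rightarrow> 'a measure \<Rightarrow> (int \<Rightarrow> 'a \<Rightarrow> real) \<Rightarrow> bool" where
  "bougerol_picard p q u M eps \<longleftrightarrow>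
     (\<integral>\<^sup>+ \<omega>. e2ennreal (ext_log (op_norm (BP_matrix p q u (eps 0 \<omega>)))) \<partial>M) < \<infinity> \<and>
     top_lyapunov p q u M eps < 0"

section \<open>The GARCH model\<close>

definition iid_standardized :: "'a measure \<Rightarrow> (int \<Rightarrow> 'a \<Rightarrow> real) \<Rightarrow> bool" where
  "iid_standardized M eps \<longleftrightarrow>
     prob_space.indep_vars M (\<lambda>_. borel) eps UNIV \<and>
     (\<forall>t. distr M borel (eps t) = distr M borel (eps 0)) \<and>
     integrable M (eps 0) \<and> integrable M (\<lambda>\<omega>. (eps 0 \<omega>)\<^sup>2) \<and>
     prob_space.expectation M (eps 0) = 0 \<and> prob_space.variance M (eps 0) = 1"

definition strictly_stationary ::
    "'a measure \<Rightarrow> (int \<Rightarrow> 'a \<Rightarrow> 'b::topological_space) \<Rightarrow> bool" where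
  "strictly_stationary M Z \<longleftrightarrow>
     (\<forall>t. Z t \<in> borel_measurable M) \<and>
     (\<forall>J h. finite J \<longrightarrow>
        distr M (PiM J (\<lambda>_. borel)) (\<lambda>\<omega>. \<lambda>t\<in>J. Z (t + h) \<omega>) =
        distr M (PiM J (\<lambda>_. borel)) (\<lambda>\<omega>. \<lambda>t\<in>J. Z t \<omega>))"

definition garch_params :: "nat \<Rightarrow> nat \<Rightarrow> (nat \<Rightarrow> real) \<Rightarrow> bool" where
  "garch_params p q u \<longleftrightarrow>
     u \<in> param_space p q \<and> u 0 > 0 \<and> (\<forall>i\<in>{1..p}. u i \<ge> 0) \<and> (\<forall>j\<in>{1..q}. u (p + j) \<ge> 0)"

definition stationary_garch ::
    "nat \<Rightarrow> nat \<Rightarrow> (nat \<Rightarrow> real) \<Rightarrow> 'a measure \<Rightarrow>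
     (int \<Rightarrow> 'a \<Rightarrow> real) \<Rightarrow> (int \<Rightarrow> 'a \<Rightarrow> real) \<Rightarrow> (int \<Rightarrow> 'a \<Rightarrow> real) \<Rightarrow> bool" where
  "stationary_garch p q u M eps X sig \<longleftrightarrow>
     strictly_stationary M (\<lambda>t \<omega>. (X t \<omega>, sig t \<omega>)) \<and>
     (\<forall>t. AE \<omega> in M.
        0 \<le> sig t \<omega> \<and>
        X t \<omega> = sig t \<omega> * eps t \<omega> \<and>
        (sig t \<omega>)\<^sup>2 = u 0 + (\<Sum>i=1..p. u i * (X (t - int i) \<omega>)\<^sup>2)
                        + (\<Sum>j=1..q. u (p + j) * (sig (t - int j) \<omega>)\<^sup>2))"

section \<open>Residuals and kernel estimators\<close>

text \<open>\<open>est n\<close> is a Borel function of \<open>X\<^sub>0,\<dots>,X\<^sub>n\<close> with values in \<open>\<real>\<^sup>p\<^sup>+\<^sup>q\<^sup>+\<^sup>1\<close>.\<close>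

definition estimator_seq ::
    "nat \<Rightarrow> nat \<Rightarrow> 'a measure \<Rightarrow> (int \<Rightarrow> 'a \<Rightarrow> real) \<Rightarrow> (nat \<Rightarrow> 'a \<Rightarrow> nat \<Rightarrow> real) \<Rightarrow> bool" where
  "estimator_seq p q M X est \<longleftrightarrow>
     (\<forall>n. \<exists>g \<in> PiM {0..int n} (\<lambda>_. borel) \<rightarrow>\<^sub>M PiM {..p + q} (\<lambda>_. borel).
        \<forall>\<omega>\<in>space M. est n \<omega> = g (\<lambda>t\<in>{0..int n}. X t \<omega>))"

text \<open>
  \<open>\<sigma>\<^sub>t\<close> computed from the parameter \<open>u\<close> and the observations \<open>x\<^sub>0,\<dots>,x\<^sub>t\<^sub>-\<^sub>1\<close>. The radicand is
  positive for \<open>u \<in> \<Theta>\<close>; otherwise the convention \<open>sqrt (- y) = - sqrt y\<close> applies.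
\<close>

definition vol_hat :: "nat \<Rightarrow> nat \<Rightarrow> (nat \<Rightarrow> real) \<Rightarrow> (int \<Rightarrow> real) \<Rightarrow> nat \<Rightarrow> real" where
  "vol_hat p q u x t =
     sqrt (garch_coeff p q u 0 + (\<Sum>i=1..t. garch_coeff p q u i * (x (int t - int i))\<^sup>2))"

definition residual :: "nat \<Rightarrow> nat \<Rightarrow> (nat \<Rightarrow> real) \<Rightarrow> (int \<Rightarrow> real) \<Rightarrow> nat \<Rightarrow> real" where
  "residual p q u x t = x (int t) / vol_hat p q u x t"

definition kernel_estimator ::
    "(real \<Rightarrow> real) \<Rightarrow> real \<Rightarrow> nat \<Rightarrow> (nat \<Rightarrow> real) \<Rightarrow> real \<Rightarrow> real" where
  "kernel_estimator K h n y x = 1 / (real n * h) * (\<Sum>t=1..n. K ((x - y t) / h))"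

definition standardized_kernel :: "(real \<Rightarrow> real) \<Rightarrow> bool" where
  "standardized_kernel K \<longleftrightarrow>
     (\<forall>x. 0 \<le> K x) \<and>
     has_bochner_integral lborel K 1 \<and>
     has_bochner_integral lborel (\<lambda>x. x * K x) 0 \<and>
     has_bochner_integral lborel (\<lambda>x. x\<^sup>2 * K x) 1"

section \<open>Stochastic order symbols\<close>

definition bounded_in_prob :: "'a measure \<Rightarrow> (nat \<Rightarrow> 'a \<Rightarrow> real) \<Rightarrow> bool" where
  "bounded_in_prob M Z \<longleftrightarrow>
     (\<forall>e>0. \<exists>B. \<forall>\<^sub>F n in sequentially. measure M {\<omega> \<in> space M. \<bar>Z n \<omega>\<bar> > B} < e)"

text \<open>Extended real values, so that suprema need not be known to be finite.\<close>

definition null_in_prob :: "'a measure \<Rightarrow> (nat \<Rightarrow> 'a \<Rightarrow> ereal) \<Rightarrow> bool" where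
  "null_in_prob M Z \<longleftrightarrow>
     (\<forall>e>0. (\<lambda>n. measure M {\<omega> \<in> space M. \<bar>Z n \<omega>\<bar> > ereal e}) \<longlonglongrightarrow> 0)"

end

theory Submission
  imports Defs
begin

text \<open>
  The kernel is Lipschitz, so replacing the errors \<open>\<epsilon>\<^sub>t\<close> by the residuals changes the estimator, uniformly
  in \<open>x\<close>, by at most a constant times \<open>(n h\<^sub>n\<^sup>2)\<^sup>-\<^sup>1 \<Sum>\<^sub>t |\<epsilon>\<^sub>t - e\<^sub>t|\<close> with the
  residuals \<open>e\<^sub>t\<close>. Since \<open>\<surd>n h\<^sub>n\<^sup>2 \<rightarrow> \<infinity>\<close>, the theorem follows once this sum is shown to be of order
  \<open>\<surd>n\<close> in probability.

  Because \<open>X\<^sub>t = \<sigma>\<^sub>t \<epsilon>\<^sub>t\<close>, each summand is at most \<open>|\<epsilon>\<^sub>t|\<close> times the relative error of the estimated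
  variance. That error has two sources. The first is the truncation of the expansion of \<open>\<sigma>\<^sub>t\<^sup>2\<close> at time
  \<open>0\<close>: the truncation error satisfies the homogeneous recursion with coefficients \<open>\<beta>\<^sub>j\<close>, whose sum is
  below \<open>1\<close>, and therefore decays geometrically (\<open>garch_path_trunc_var_decay\<close>); its total contribution
  is bounded in probability. The second is the estimation of the parameter. Every \<open>c\<^sub>i\<close> with \<open>i > 0\<close> is
  a polynomial of degree at most \<open>i\<close> with nonnegative coefficients, so a relative perturbation \<open>\<eta>\<close> of
  the parameter multiplies \<open>c\<^sub>i\<close> by a factor between \<open>(1 + \<eta>)\<^sup>-\<^sup>i\<close> and \<open>(1 + \<eta>)\<^sup>i\<close>
  (\<open>garch_coeff_scale_le\<close>). The relative error of the variance is then at most \<open>\<eta>\<close> times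
  the sum of a constant and a series \<open>\<Sum>\<^sub>i i w\<^sup>i (X\<^sub>t\<^sub>-\<^sub>i\<^sup>2)\<^sup>a\<close> with \<open>w < 1\<close>, for any prescribed \<open>a > 0\<close> (\<open>trunc_var_perturb\<close>); here \<open>\<eta>\<close>
  is of order \<open>1 / \<surd>n\<close>.

  It remains to see that \<open>|\<epsilon>\<^sub>t|\<close> times this series has bounded expectation. By the inequality
  \<open>y z \<le> y\<^sup>2 + z\<^sup>2\<close> this needs \<open>E \<epsilon>\<^sub>t\<^sup>2 < \<infinity>\<close> and \<open>E |X\<^sub>t|\<^sup>2\<^sup>s < \<infinity>\<close> for some \<open>s > 0\<close>, where
  \<open>a = s / 2\<close>. The power moment is where the Bougerol--Picard conditions enter
  (\<open>stationary_garch_power_moment\<close>). A negative Lyapunov exponent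
  gives a block length for which the norm of the product of the random matrices has negative expected
  logarithm, hence a power \<open>s\<close> of this norm has expectation below \<open>1\<close>. The state vectors sampled at
  multiples of the block length satisfy a scalar recursion with independent contracting coefficients,
  and a tight sequence satisfying such a recursion has a finite moment
  (\<open>stochastic_recursion_moment\<close>).
\<close>

section \<open>The coefficients of the variance expansion\<close>

text \<open>
  The hypothesis \<open>\<Sum>\<^sub>j b\<^sub>j \<le> r\<^sup>q\<close> makes \<open>W r\<^sup>t\<close>, with \<open>W\<close> the constant below, a supersolution of the recursion: the worst case is that
  all the weight sits on the oldest term \<open>a (t - q)\<close>. The constant is a finite sum of initial values, so
  it depends measurably on them; it is used both for the coefficients \<open>c\<^sub>i\<close> and for the truncation error
  of the variance along a random path.
\<close>

lemma linear_recursion_geometric_decay: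
  fixes a b :: "nat \<Rightarrow> real"
  assumes b: "\<And>j. j \<in> {1..q} \<Longrightarrow> 0 \<le> b j" and sum_b: "(\<Sum>j=1..q. b j) \<le> r ^ q"
    and r: "0 < r" "r \<le> 1" and "q \<le> N"
    and rec: "\<And>t. N \<le> t \<Longrightarrow> a t = (\<Sum>j=1..q. b j * a (t - j))"
  shows "\<bar>a t\<bar> \<le> (\<Sum>s<N. \<bar>a s\<bar>) / r ^ N * r ^ t"
proof (induction t rule: less_induct)
  case (less t)
  define W where "W = (\<Sum>s<N. \<bar>a s\<bar>) / r ^ N"
  have W: "0 \<le> W"
    unfolding W_def using r by (intro divide_nonneg_nonneg sum_nonneg) auto
  show ?case
  proof (cases "t < N")
    case True
    have "\<bar>a t\<bar> \<le> (\<Sum>s<N. \<bar>a s\<bar>)"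
      using True by (intro member_le_sum[of t]) auto
    also have "\<dots> = W * r ^ N"
      using r by (simp add: W_def)
    also have "\<dots> \<le> W * r ^ t"
      using W r True by (intro mult_left_mono power_decreasing) auto
    finally show ?thesis unfolding W_def .
  next
    case False
    have "\<bar>a t\<bar> = \<bar>\<Sum>j=1..q. b j * a (t - j)\<bar>"
      using rec[of t] False by simp
    also have "\<dots> \<le> (\<Sum>j=1..q. b j * \<bar>a (t - j)\<bar>)"
      by (rule order_trans[OF sum_abs]) (auto intro!: sum_mono simp: abs_mult b)
    also have "\<dots> \<le> (\<Sum>j=1..q. b j * (W * r ^ (t - q)))"
    proof (intro sum_mono mult_left_mono)
      fix j assume j: "j \<in> {1..q}"
      have "\<bar>a (t - j)\<bar> \<le> W * r ^ (t - j)"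
        unfolding W_def using j False \<open>q \<le> N\<close> by (intro less.IH) auto
      also have "\<dots> \<le> W * r ^ (t - q)"
        using W r j by (intro mult_left_mono power_decreasing) auto
      finally show "\<bar>a (t - j)\<bar> \<le> W * r ^ (t - q)" .
    qed (auto simp: b)
    also have "\<dots> = (\<Sum>j=1..q. b j) * (W * r ^ (t - q))"
      by (simp add: sum_distrib_right)
    also have "\<dots> \<le> r ^ q * (W * r ^ (t - q))"
      using W r sum_b by (intro mult_right_mono) auto
    also have "\<dots> = W * r ^ t"
      using False \<open>q \<le> N\<close> by (simp add: power_add[symmetric] mult.left_commute)
    finally show ?thesis unfolding W_def .
  qed
qed

lemma garch_coeff_zero: "garch_coeff p q u 0 = u 0 / (1 - (\<Sum>j=1..q. u (p + j)))"
  by (simp add: garch_coeff.simps)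

lemma garch_coeff_pos:
  "0 < i \<Longrightarrow> garch_coeff p q u i =
     (if i \<le> p then u i else 0) + (\<Sum>j=1..min (i - 1) q. u (p + j) * garch_coeff p q u (i - j))"
  by (subst garch_coeff.simps) simp

lemma garch_coeff_nonneg:
  assumes "\<And>k. k \<le> p + q \<Longrightarrow> 0 \<le> u k" "0 < i"
  shows "0 \<le> garch_coeff p q u i"
  using \<open>0 < i\<close>
proof (induction i rule: less_induct)
  case (less i)
  show ?case
    unfolding garch_coeff_pos[OF \<open>0 < i\<close>]
    by (intro add_nonneg_nonneg sum_nonneg mult_nonneg_nonneg less.IH) (auto simp: assms(1))
qed

text \<open>
  For \<open>i > 0\<close> the coefficient \<open>c\<^sub>i\<close> is a polynomial with nonnegative coefficients in which each monomial
  has degree at most \<open>i\<close>, so scaling all parameters by \<open>\<mu> \<ge> 1\<close> costs at most \<open>\<mu>\<^sup>i\<close>. Exchanging the roles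
  of \<open>u\<close> and \<open>v\<close> gives the matching lower bound. The coefficient \<open>c\<^sub>0\<close> is a rational function and
  is treated separately.
\<close>

lemma garch_coeff_scale_le:
  assumes v: "\<And>k. k \<le> p + q \<Longrightarrow> 0 \<le> v k" and le: "\<And>k. k \<le> p + q \<Longrightarrow> v k \<le> \<mu> * u k"
    and mu: "1 \<le> \<mu>" and "0 < i"
  shows "garch_coeff p q v i \<le> \<mu> ^ i * garch_coeff p q u i"
  using \<open>0 < i\<close>
proof (induction i rule: less_induct)
  case (less i)
  have u: "0 \<le> u k" if "k \<le> p + q" for k
    using v[OF that] le[OF that] mu by (smt (verit) zero_le_mult_iff)
  have 1: "(if i \<le> p then v i else 0) \<le> \<mu> ^ i * (if i \<le> p then u i else 0)"
  proof (cases "i \<le> p")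
    case True
    have "v i \<le> \<mu> * u i" using True le by simp
    also have "\<dots> \<le> \<mu> ^ i * u i"
      using less.prems mu u True by (intro mult_right_mono self_le_power) auto
    finally show ?thesis using True by simp
  qed simp
  have 2: "v (p + j) * garch_coeff p q v (i - j) \<le> \<mu> ^ i * (u (p + j) * garch_coeff p q u (i - j))"
    if j: "j \<in> {1..min (i - 1) q}" for j
  proof -
    have c: "0 \<le> garch_coeff p q u (i - j)"
      using j u by (intro garch_coeff_nonneg) auto
    have "v (p + j) * garch_coeff p q v (i - j)
        \<le> (\<mu> * u (p + j)) * (\<mu> ^ (i - j) * garch_coeff p q u (i - j))"
      using j mu v u by (intro mult_mono le less.IH mult_nonneg_nonneg garch_coeff_nonneg) auto
    also have "\<dots> = \<mu> ^ Suc (i - j) * (u (p + j) * garch_coeff p q u (i - j))"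
      by simp
    also have "\<dots> \<le> \<mu> ^ i * (u (p + j) * garch_coeff p q u (i - j))"
      using j mu u c by (intro mult_right_mono power_increasing mult_nonneg_nonneg) auto
    finally show ?thesis .
  qed
  show ?case
    unfolding garch_coeff_pos[OF \<open>0 < i\<close>] distrib_left sum_distrib_left
    by (intro add_mono 1 sum_mono 2)
qed

text \<open>
  Beyond the index \<open>p + q\<close> the coefficients satisfy the homogeneous recursion with weights \<open>t\<^sub>j\<close>.
\<close>

lemma garch_coeff_geometric_decay:
  assumes u: "\<And>k. k \<le> p + q \<Longrightarrow> 0 \<le> u k" and "(\<Sum>j=1..q. u (p + j)) \<le> r ^ q"
    and "0 < r" "r \<le> 1"
  shows "\<exists>C>0. \<forall>i. garch_coeff p q u i \<le> C * r ^ i"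
proof (intro exI conjI allI)
  let ?W = "(\<Sum>s<p+q+1. \<bar>garch_coeff p q u s\<bar>) / r ^ (p + q + 1)"
  have W: "0 \<le> ?W"
    using assms by (intro divide_nonneg_nonneg sum_nonneg) auto
  then show "0 < ?W + 1" by simp
  fix i
  have "garch_coeff p q u t = (\<Sum>j=1..q. u (p + j) * garch_coeff p q u (t - j))"
    if "p + q + 1 \<le> t" for t
  proof -
    have "min (t - 1) q = q" using that by simp
    then show ?thesis using that garch_coeff_pos[of t p q u] by simp
  qed
  then have "\<bar>garch_coeff p q u i\<bar> \<le> ?W * r ^ i"
    by (intro linear_recursion_geometric_decay[where b = "\<lambda>j. u (p + j)" and q = q])
       (use assms in auto)
  also have "\<dots> \<le> (?W + 1) * r ^ i"
    using assms by (intro mult_right_mono) auto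
  finally show "garch_coeff p q u i \<le> (?W + 1) * r ^ i" by simp
qed

text \<open>
  The radicand of \<open>vol_hat\<close>. Unlike its square root it satisfies a linear recursion in \<open>t\<close>.
\<close>

definition trunc_var :: "nat \<Rightarrow> nat \<Rightarrow> (nat \<Rightarrow> real) \<Rightarrow> (int \<Rightarrow> real) \<Rightarrow> nat \<Rightarrow> real" where
  "trunc_var p q u x t =
     garch_coeff p q u 0 + (\<Sum>i=1..t. garch_coeff p q u i * (x (int t - int i))\<^sup>2)"

lemma vol_hat_trunc_var: "vol_hat p q u x t = sqrt (trunc_var p q u x t)"
  by (simp add: vol_hat_def trunc_var_def)

text \<open>
  Once \<open>t\<close> reaches \<open>p + q\<close>, the truncated variance obeys the same recursion as the true
  conditional variance: substituting the recursion for \<open>c\<^sub>i\<close> and exchanging the sums reproduces the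
  truncated variances at earlier times, and the constant terms match since \<open>c\<^sub>0 = s\<^sub>0 + (\<Sum>\<^sub>j t\<^sub>j) c\<^sub>0\<close>. The
  difference of the two is therefore a solution of the homogeneous recursion.
\<close>

lemma trunc_var_recursion:
  assumes t: "p + q \<le> t" and B: "(\<Sum>j=1..q. u (p + j)) \<noteq> 1"
  shows "trunc_var p q u x t = u 0 + (\<Sum>i=1..p. u i * (x (int t - int i))\<^sup>2)
           + (\<Sum>j=1..q. u (p + j) * trunc_var p q u x (t - j))"
proof -
  let ?c = "garch_coeff p q u"
  define y where "y k = (x (int k))\<^sup>2" for k :: nat
  have y: "(x (int s - int i))\<^sup>2 = y (s - i)" if "i \<le> s" for s i :: nat
    using that by (simp add: y_def of_nat_diff)
  have tv: "trunc_var p q u x s = ?c 0 + (\<Sum>i=1..s. ?c i * y (s - i))" for s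
    unfolding trunc_var_def by (simp add: y)
  have "(\<Sum>i=1..t. ?c i * y (t - i)) =
      (\<Sum>i=1..t. (if i \<le> p then u i else 0) * y (t - i))
      + (\<Sum>i=1..t. \<Sum>j=1..min (i - 1) q. u (p + j) * ?c (i - j) * y (t - i))"
    unfolding sum.distrib[symmetric]
    by (intro sum.cong refl) (subst garch_coeff_pos, auto simp: distrib_right sum_distrib_right)
  also have "(\<Sum>i=1..t. (if i \<le> p then u i else 0) * y (t - i)) = (\<Sum>i=1..p. u i * y (t - i))"
    using t by (intro sum.mono_neutral_cong_right) auto
  also have "(\<Sum>i=1..t. \<Sum>j=1..min (i - 1) q. u (p + j) * ?c (i - j) * y (t - i)) =
      (\<Sum>i=1..t. \<Sum>j=1..q. if j < i then u (p + j) * ?c (i - j) * y (t - i) else 0)"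
    by (intro sum.cong[OF refl] sum.mono_neutral_cong_left) auto
  also have "\<dots> = (\<Sum>j=1..q. \<Sum>i=1..t. if j < i then u (p + j) * ?c (i - j) * y (t - i) else 0)"
    by (rule sum.swap)
  also have "\<dots> = (\<Sum>j=1..q. u (p + j) * (\<Sum>i=1..t - j. ?c i * y (t - j - i)))"
  proof (intro sum.cong[OF refl])
    fix j assume j: "j \<in> {1..q}"
    have "(\<Sum>i=1..t. if j < i then u (p + j) * ?c (i - j) * y (t - i) else 0)
        = (\<Sum>i\<in>{1+j..t-j+j}. u (p + j) * ?c (i - j) * y (t - i))"
      using j t by (intro sum.mono_neutral_cong_right) auto
    also have "\<dots> = (\<Sum>i=1..t - j. u (p + j) * ?c i * y (t - j - i))"
      by (subst sum.shift_bounds_cl_nat_ivl) (simp add: add.commute)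
    finally show "(\<Sum>i=1..t. if j < i then u (p + j) * ?c (i - j) * y (t - i) else 0)
        = u (p + j) * (\<Sum>i=1..t - j. ?c i * y (t - j - i))"
      by (simp add: sum_distrib_left mult.assoc)
  qed
  finally have main: "(\<Sum>i=1..t. ?c i * y (t - i)) = (\<Sum>i=1..p. u i * y (t - i))
      + (\<Sum>j=1..q. u (p + j) * (\<Sum>i=1..t - j. ?c i * y (t - j - i)))" .
  have c0: "?c 0 = u 0 + (\<Sum>j=1..q. u (p + j)) * ?c 0"
    using B by (simp add: garch_coeff_zero field_simps)
  have sp: "(\<Sum>i=1..p. u i * (x (int t - int i))\<^sup>2) = (\<Sum>i=1..p. u i * y (t - i))"
    using t by (intro sum.cong refl) (simp add: y)
  show ?thesis
    unfolding sp unfolding tv main distrib_left sum.distrib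
    using c0 by (simp add: sum_distrib_right)
qed

section \<open>Sensitivity of the truncated variance to the parameter\<close>

lemma power_minus_one_le:
  fixes \<eta> :: real
  assumes "0 \<le> \<eta>"
  shows "(1 + \<eta>) ^ n - 1 \<le> \<eta> * (real n * (1 + \<eta>) ^ n)"
proof (induction n)
  case (Suc n)
  have "(1 + \<eta>) ^ Suc n - 1 = (1 + \<eta>) * ((1 + \<eta>) ^ n - 1) + \<eta>"
    by (simp add: algebra_simps)
  also have "\<dots> \<le> (1 + \<eta>) * (\<eta> * (real n * (1 + \<eta>) ^ n)) + \<eta> * (1 + \<eta>) ^ Suc n"
    using assms Suc one_le_power[of "1 + \<eta>" "Suc n"]
    by (intro add_mono mult_left_mono mult_left_le[where c = \<eta>] ) (auto intro: mult_left_mono[of 1 _ \<eta>, simplified])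
  also have "\<dots> = \<eta> * (real (Suc n) * (1 + \<eta>) ^ Suc n)"
    by (simp add: algebra_simps)
  finally show ?case .
qed simp

text \<open>
  The common bound \<open>\<rho> < 1\<close> keeps the denominators \<open>1 - \<Sum>\<^sub>j t\<^sub>j\<close> of \<open>c\<^sub>0(u)\<close> and \<open>c\<^sub>0(v)\<close> away from \<open>0\<close>; the
  numerators are compared through the relative closeness of \<open>u\<close> and \<open>v\<close>.
\<close>

lemma garch_coeff_zero_perturb:
  assumes u: "\<And>k. k \<le> p + q \<Longrightarrow> 0 \<le> u k" and eta: "0 \<le> \<eta>" "\<eta> \<le> 1" and "\<rho> < 1"
    and vu: "\<And>k. k \<le> p + q \<Longrightarrow> v k \<le> (1 + \<eta>) * u k"
    and uv: "\<And>k. k \<le> p + q \<Longrightarrow> u k \<le> (1 + \<eta>) * v k"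
    and Bu: "(\<Sum>j=1..q. u (p + j)) \<le> \<rho>" and Bv: "(\<Sum>j=1..q. v (p + j)) \<le> \<rho>"
  shows "u 0 / 2 \<le> garch_coeff p q v 0"
    and "\<bar>garch_coeff p q u 0 - garch_coeff p q v 0\<bar> \<le> \<eta> * (2 * u 0 / (1 - \<rho>)\<^sup>2)"
proof -
  have v: "0 \<le> v k" if "k \<le> p + q" for k
    using u[OF that] uv[OF that] eta by (smt (verit) zero_le_mult_iff)
  have diff: "\<bar>u k - v k\<bar> \<le> \<eta> * u k" if "k \<le> p + q" for k
  proof -
    have "v k - u k \<le> \<eta> * u k" using vu[OF that] by (simp add: algebra_simps)
    moreover have "u k - v k \<le> \<eta> * u k"
    proof (cases "v k \<le> u k")
      case True
      have "u k - v k \<le> \<eta> * v k" using uv[OF that] by (simp add: algebra_simps)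
      also have "\<dots> \<le> \<eta> * u k" using True eta by (intro mult_left_mono) auto
      finally show ?thesis .
    next
      case False
      then show ?thesis using eta u[OF that] by (smt (verit) mult_nonneg_nonneg)
    qed
    ultimately show ?thesis by linarith
  qed
  define a b where "a = (\<Sum>j=1..q. u (p + j))" and "b = (\<Sum>j=1..q. v (p + j))"
  have ab: "0 \<le> a" "0 \<le> b" "a \<le> \<rho>" "b \<le> \<rho>"
    using u v Bu Bv by (auto simp: a_def b_def intro!: sum_nonneg)
  have "\<bar>a - b\<bar> \<le> (\<Sum>j=1..q. \<eta> * u (p + j))"
    unfolding a_def b_def sum_subtractf[symmetric]
    by (rule order_trans[OF sum_abs]) (auto intro!: sum_mono diff)
  also have "\<dots> \<le> \<eta>"
    unfolding sum_distrib_left[symmetric] a_def[symmetric]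
    using ab eta \<open>\<rho> < 1\<close> by (intro mult_left_le) auto
  finally have dab: "\<bar>a - b\<bar> \<le> \<eta>" .
  have "u 0 / 2 \<le> v 0"
  proof -
    have "(1 + \<eta>) * v 0 \<le> 2 * v 0" using eta v[of 0] by (intro mult_right_mono) auto
    then show ?thesis using uv[of 0] by simp
  qed
  also have "v 0 \<le> v 0 / (1 - b)"
    using ab \<open>\<rho> < 1\<close> v[of 0] by (simp add: pos_le_divide_eq mult_left_le)
  finally show "u 0 / 2 \<le> garch_coeff p q v 0"
    by (simp add: garch_coeff_zero b_def)
  have "garch_coeff p q u 0 - garch_coeff p q v 0 = u 0 / (1 - a) - v 0 / (1 - b)"
    by (simp add: garch_coeff_zero a_def b_def)
  also have "\<dots> = ((u 0 - v 0) * (1 - a) + u 0 * (a - b)) / ((1 - a) * (1 - b))"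
    using ab \<open>\<rho> < 1\<close> by (simp add: field_simps)
  finally have "\<bar>garch_coeff p q u 0 - garch_coeff p q v 0\<bar>
      = \<bar>(u 0 - v 0) * (1 - a) + u 0 * (a - b)\<bar> / ((1 - a) * (1 - b))"
    using ab \<open>\<rho> < 1\<close> by (simp add: abs_mult)
  also have "\<dots> \<le> (2 * \<eta> * u 0) / ((1 - \<rho>) * (1 - \<rho>))"
  proof (rule frac_le)
    have "\<bar>(u 0 - v 0) * (1 - a)\<bar> \<le> \<eta> * u 0"
      using diff[of 0] ab \<open>\<rho> < 1\<close> mult_mono[of "\<bar>u 0 - v 0\<bar>" "\<eta> * u 0" "1 - a" 1] u[of 0] eta
      by (simp add: abs_mult)
    moreover have "\<bar>u 0 * (a - b)\<bar> \<le> \<eta> * u 0"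
      using dab u[of 0] mult_left_mono[of "\<bar>a - b\<bar>" \<eta> "u 0"] by (simp add: abs_mult mult.commute)
    ultimately show "\<bar>(u 0 - v 0) * (1 - a) + u 0 * (a - b)\<bar> \<le> 2 * \<eta> * u 0" by linarith
    show "(1 - \<rho>) * (1 - \<rho>) \<le> (1 - a) * (1 - b)"
      using ab \<open>\<rho> < 1\<close> by (intro mult_mono) auto
  qed (use u[of 0] eta \<open>\<rho> < 1\<close> in auto)
  finally show "\<bar>garch_coeff p q u 0 - garch_coeff p q v 0\<bar> \<le> \<eta> * (2 * u 0 / (1 - \<rho>)\<^sup>2)"
    by (simp add: power2_eq_square field_simps)
qed

lemma le_powr_of_le_one:
  fixes x s :: real
  assumes "0 \<le> x" "x \<le> 1" "s \<le> 1"
  shows "x \<le> x powr s"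
proof (cases "x = 0")
  case False
  then have "x powr 1 \<le> x powr s" using assms by (intro powr_mono') auto
  then show ?thesis using assms by simp
qed simp

text \<open>
  The key estimate for the effect of the parameter. The \<open>i\<close>-th term of the difference is at most
  \<open>((1 + \<eta>)\<^sup>i - 1) y\<close> with \<open>y = c\<^sub>i(v) x\<^sup>2\<^sub>t\<^sub>-\<^sub>i\<close>, and \<open>y\<close> is itself one of the summands of the truncated
  variance \<open>S\<close> at \<open>v\<close>. Hence \<open>y / S \<le> 1\<close>, which permits replacing \<open>y / S\<close> by its power with the small
  exponent \<open>s\<close>, and then \<open>S\<close> by its lower bound \<open>u 0 / 2\<close>. The price is a slower but still geometric
  decay in \<open>i\<close>; the gain is that only a small power of \<open>x\<^sup>2\<close> remains.
\<close>

lemma trunc_var_perturb: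
  assumes u: "\<And>k. k \<le> p + q \<Longrightarrow> 0 \<le> u k" and "0 < u 0" and eta: "0 \<le> \<eta>" "\<eta> \<le> 1" and "\<rho> < 1"
    and vu: "\<And>k. k \<le> p + q \<Longrightarrow> v k \<le> (1 + \<eta>) * u k"
    and uv: "\<And>k. k \<le> p + q \<Longrightarrow> u k \<le> (1 + \<eta>) * v k"
    and Bu: "(\<Sum>j=1..q. u (p + j)) \<le> \<rho>" and Bv: "(\<Sum>j=1..q. v (p + j)) \<le> \<rho>"
    and C: "\<And>i. garch_coeff p q u i \<le> C * r ^ i" and "0 < C" "0 < r"
    and s: "0 < s" "s \<le> 1" and mu: "1 + \<eta> \<le> \<mu>"
  shows "u 0 / 2 \<le> trunc_var p q v x t"
    and "\<bar>trunc_var p q u x t - trunc_var p q v x t\<bar> \<le> \<eta> * trunc_var p q v x t *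
           (4 / (1 - \<rho>)\<^sup>2 + (\<Sum>i=1..t. (2 * C / u 0) powr s * (real i * (\<mu>\<^sup>2 * r powr s) ^ i) *
                                       ((x (int t - int i))\<^sup>2) powr s))"
proof -
  have v: "0 \<le> v k" if "k \<le> p + q" for k
    using u[OF that] uv[OF that] eta by (smt (verit) zero_le_mult_iff)
  define y where "y i = (x (int t - int i))\<^sup>2" for i
  define S where "S = trunc_var p q v x t"
  have S: "S = garch_coeff p q v 0 + (\<Sum>i=1..t. garch_coeff p q v i * y i)"
    by (simp add: S_def trunc_var_def y_def)
  have cv: "0 \<le> garch_coeff p q v i" if "0 < i" for i
    using v that by (intro garch_coeff_nonneg) auto
  note zero = garch_coeff_zero_perturb[OF u eta \<open>\<rho> < 1\<close> vu uv Bu Bv]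
  have y0: "0 \<le> y i" for i by (simp add: y_def)
  have term0: "0 \<le> garch_coeff p q v i * y i" if "i \<in> {1..t}" for i
    using that cv[of i] y0[of i] by simp
  have "u 0 / 2 \<le> garch_coeff p q v 0" by (rule zero)
  also have "\<dots> \<le> S"
    unfolding S using sum_nonneg[OF term0, of "{1..t}"] by simp
  finally show S2: "u 0 / 2 \<le> trunc_var p q v x t" by (simp add: S_def)
  have Spos: "0 < S" using S2 \<open>0 < u 0\<close> by (simp add: S_def)
  have term_le: "garch_coeff p q v i * y i \<le> S" if "i \<in> {1..t}" for i
  proof -
    have "garch_coeff p q v i * y i \<le> (\<Sum>i=1..t. garch_coeff p q v i * y i)"
      using that by (intro member_le_sum term0) auto
    also have "\<dots> \<le> S" unfolding S using zero(1) \<open>0 < u 0\<close> by simp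
    finally show ?thesis .
  qed
  define D where "D i = (2 * C / u 0) powr s * (real i * (\<mu>\<^sup>2 * r powr s) ^ i) * y i powr s" for i
  have main: "\<bar>garch_coeff p q u i - garch_coeff p q v i\<bar> * y i \<le> \<eta> * S * D i" if i: "i \<in> {1..t}" for i
  proof -
    let ?m = "(1 + \<eta>) ^ i"
    have m1: "1 \<le> ?m" using eta by (intro one_le_power) simp
    have le1: "garch_coeff p q u i \<le> ?m * garch_coeff p q v i"
      using i eta by (intro garch_coeff_scale_le u uv) auto
    have le2: "garch_coeff p q v i \<le> ?m * garch_coeff p q u i"
      using i eta by (intro garch_coeff_scale_le v vu) auto
    have "\<bar>garch_coeff p q u i - garch_coeff p q v i\<bar> \<le> (?m - 1) * garch_coeff p q v i"
    proof -
      have "garch_coeff p q v i - garch_coeff p q u i \<le> (?m - 1) * garch_coeff p q v i"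
      proof (cases "garch_coeff p q u i \<le> garch_coeff p q v i")
        case True
        have "garch_coeff p q v i - garch_coeff p q u i \<le> (?m - 1) * garch_coeff p q u i"
          using le2 by (simp add: algebra_simps)
        also have "\<dots> \<le> (?m - 1) * garch_coeff p q v i"
          using True m1 by (intro mult_left_mono) auto
        finally show ?thesis .
      next
        case False
        then show ?thesis using m1 cv[of i] i
          by (smt (verit) atLeastAtMost_iff mult_nonneg_nonneg not_one_le_zero gr0I)
      qed
      then show ?thesis using le1 by (simp add: algebra_simps abs_le_iff)
    qed
    then have "\<bar>garch_coeff p q u i - garch_coeff p q v i\<bar> * y i \<le> (?m - 1) * (garch_coeff p q v i * y i)"
      using y0[of i] by (metis mult.assoc mult_right_mono)
    also have "\<dots> \<le> (?m - 1) * (S * ((2 * C / u 0) powr s * (1 + \<eta>) ^ i * (r powr s) ^ i * y i powr s))"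
    proof (intro mult_left_mono)
      have "garch_coeff p q v i * y i / S \<le> (garch_coeff p q v i * y i / S) powr s"
        using term0[OF i] term_le[OF i] Spos s by (intro le_powr_of_le_one) auto
      also have "\<dots> \<le> (((1 + \<eta>) ^ i * (C * r ^ i)) * y i / (u 0 / 2)) powr s"
      proof (intro powr_mono2 frac_le mult_right_mono)
        show "garch_coeff p q v i \<le> (1 + \<eta>) ^ i * (C * r ^ i)"
          by (rule order_trans[OF le2 mult_left_mono[OF C]]) (use m1 in simp)
      qed (use s term0[OF i] Spos y0 m1 \<open>0 < C\<close> \<open>0 < r\<close> \<open>0 < u 0\<close> S2 eta in \<open>auto simp: S_def\<close>)
      also have "\<dots> = ((2 * C / u 0) * ((1 + \<eta>) ^ i * r ^ i * y i)) powr s"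
        by (simp add: field_simps)
      also have "\<dots> = (2 * C / u 0) powr s * (((1 + \<eta>) ^ i) powr s * (r ^ i) powr s * y i powr s)"
        using y0[of i] eta \<open>0 < r\<close> \<open>0 < C\<close> \<open>0 < u 0\<close> by (simp only: powr_mult)
      also have "(r ^ i) powr s = (r powr s) ^ i"
        using \<open>0 < r\<close> by (simp add: powr_powr powr_realpow[symmetric] mult.commute)
      also have "(2 * C / u 0) powr s * (((1 + \<eta>) ^ i) powr s * (r powr s) ^ i * y i powr s)
          \<le> (2 * C / u 0) powr s * ((1 + \<eta>) ^ i * (r powr s) ^ i * y i powr s)"
        using m1 s powr_mono[of s 1 ?m] by (intro mult_left_mono mult_right_mono) auto
      finally show "garch_coeff p q v i * y i
          \<le> S * ((2 * C / u 0) powr s * (1 + \<eta>) ^ i * (r powr s) ^ i * y i powr s)"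
        using Spos by (simp add: pos_divide_le_eq mult_ac)
    qed (use m1 in simp)
    also have "\<dots> \<le> (\<eta> * (real i * ?m)) * (S * ((2 * C / u 0) powr s * (1 + \<eta>) ^ i * (r powr s) ^ i * y i powr s))"
      using Spos eta by (intro mult_right_mono power_minus_one_le mult_nonneg_nonneg) auto
    also have "\<dots> = \<eta> * S * ((2 * C / u 0) powr s * (real i * (((1 + \<eta>)\<^sup>2 * r powr s) ^ i)) * y i powr s)"
      by (simp add: power_mult_distrib power2_eq_square mult_ac)
    also have "\<dots> \<le> \<eta> * S * D i"
      unfolding D_def using Spos eta mu
      by (intro mult_left_mono mult_right_mono power_mono mult_nonneg_nonneg) auto
    finally show ?thesis .
  qed
  have "trunc_var p q u x t - S = (garch_coeff p q u 0 - garch_coeff p q v 0)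
      + (\<Sum>i=1..t. (garch_coeff p q u i - garch_coeff p q v i) * y i)"
    by (simp add: S trunc_var_def y_def left_diff_distrib sum_subtractf)
  then have "\<bar>trunc_var p q u x t - S\<bar> \<le> \<bar>garch_coeff p q u 0 - garch_coeff p q v 0\<bar>
      + \<bar>\<Sum>i=1..t. (garch_coeff p q u i - garch_coeff p q v i) * y i\<bar>"
    by linarith
  also have "\<dots> \<le> \<eta> * S * (4 / (1 - \<rho>)\<^sup>2) + (\<Sum>i=1..t. \<eta> * S * D i)"
  proof (intro add_mono)
    have "\<eta> * (2 * u 0 / (1 - \<rho>)\<^sup>2) = \<eta> * (u 0 / 2) * (4 / (1 - \<rho>)\<^sup>2)" by simp
    also have "\<dots> \<le> \<eta> * S * (4 / (1 - \<rho>)\<^sup>2)"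
      using S2 eta by (intro mult_right_mono mult_left_mono) (auto simp: S_def)
    finally show "\<bar>garch_coeff p q u 0 - garch_coeff p q v 0\<bar> \<le> \<eta> * S * (4 / (1 - \<rho>)\<^sup>2)"
      using zero(2) by linarith
    have "\<bar>\<Sum>i=1..t. (garch_coeff p q u i - garch_coeff p q v i) * y i\<bar>
        \<le> (\<Sum>i=1..t. \<bar>garch_coeff p q u i - garch_coeff p q v i\<bar> * y i)"
      by (rule order_trans[OF sum_abs]) (auto intro!: sum_mono simp: abs_mult y0)
    also have "\<dots> \<le> (\<Sum>i=1..t. \<eta> * S * D i)"
      by (intro sum_mono main)
    finally show "\<bar>\<Sum>i=1..t. (garch_coeff p q u i - garch_coeff p q v i) * y i\<bar>
        \<le> (\<Sum>i=1..t. \<eta> * S * D i)" .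
  qed
  finally show "\<bar>trunc_var p q u x t - trunc_var p q v x t\<bar> \<le> \<eta> * trunc_var p q v x t *
           (4 / (1 - \<rho>)\<^sup>2 + (\<Sum>i=1..t. (2 * C / u 0) powr s * (real i * (\<mu>\<^sup>2 * r powr s) ^ i) *
                                       ((x (int t - int i))\<^sup>2) powr s))"
    by (simp add: S_def D_def y_def distrib_left sum_distrib_left)
qed

section \<open>Nonnegative matrices and the Bougerol--Picard recursion\<close>

lemma max_norm_nonneg: "0 < d \<Longrightarrow> 0 \<le> max_norm d v"
  unfolding max_norm_def by (subst Max_ge_iff) (auto intro!: exI[of _ 0])

lemma abs_le_max_norm: "i < d \<Longrightarrow> \<bar>v i\<bar> \<le> max_norm d v"
  unfolding max_norm_def by (intro Max_ge) auto

lemma max_norm_le_iff: "0 < d \<Longrightarrow> max_norm d v \<le> c \<longleftrightarrow> (\<forall>i<d. \<bar>v i\<bar> \<le> c)"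
  unfolding max_norm_def by (subst Max_le_iff) auto

lemma less_max_norm_iff: "0 < d \<Longrightarrow> c < max_norm d v \<longleftrightarrow> (\<exists>i<d. c < \<bar>v i\<bar>)"
  using max_norm_le_iff[of d v c] by (meson not_le)

lemma max_norm_measurable:
  assumes "0 < d" "\<And>i. i < d \<Longrightarrow> (\<lambda>\<omega>. v \<omega> i) \<in> borel_measurable M"
  shows "(\<lambda>\<omega>. max_norm d (v \<omega>)) \<in> borel_measurable M"
proof -
  have "(\<lambda>\<omega>. Max ((\<lambda>i. \<bar>v \<omega> i\<bar>) ` {..<d})) \<in> borel_measurable M"
    using assms by (intro borel_measurable_Max) auto
  then show ?thesis unfolding max_norm_def .
qed

definition row_sum :: "real mat \<Rightarrow> nat \<Rightarrow> real" where
  "row_sum A i = (\<Sum>j<dim_col A. A $$ (i, j))"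

text \<open>
  For a nonnegative matrix the supremum over the unit ball of the maximum norm is attained at the vector
  of ones, so the operator norm is the largest row sum. This turns the norm into an explicit, measurable
  expression in the entries.
\<close>

lemma op_norm_eq_max_norm_row_sum:
  assumes A: "A \<in> carrier_mat m n" "0 < m" "0 < n"
    and nn: "\<And>i j. i < m \<Longrightarrow> j < n \<Longrightarrow> 0 \<le> A $$ (i, j)"
  shows "op_norm A = max_norm m (row_sum A)"
proof -
  have mult: "(A *\<^sub>v v) $ i = (\<Sum>j<n. A $$ (i, j) * v $ j)" if "i < m" "v \<in> carrier_vec n" for v i
    using that A by (auto simp: scalar_prod_def atLeast0LessThan intro!: sum.cong)
  have row: "row_sum A i = (\<Sum>j<n. A $$ (i, j))" for i
    using A by (simp add: row_sum_def)
  show ?thesis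
    unfolding op_norm_def
  proof (rule cSup_eq_maximum)
    let ?one = "vec n (\<lambda>_. 1) :: real vec"
    have "max_norm n (vec_index ?one) \<le> 1"
      using \<open>0 < n\<close> by (simp add: max_norm_le_iff)
    moreover have "max_norm m (vec_index (A *\<^sub>v ?one)) = max_norm m (row_sum A)"
      unfolding max_norm_def using mult[of _ ?one] by (intro arg_cong[where f = Max] image_cong) (auto simp: row)
    ultimately show "max_norm m (row_sum A) \<in> (\<lambda>v. max_norm (dim_row A) (vec_index (A *\<^sub>v v))) `
        {v \<in> carrier_vec (dim_col A). max_norm (dim_col A) (vec_index v) \<le> 1}"
      using A by (intro image_eqI[of _ _ ?one]) auto
  next
    fix y assume "y \<in> (\<lambda>v. max_norm (dim_row A) (vec_index (A *\<^sub>v v))) `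
        {v \<in> carrier_vec (dim_col A). max_norm (dim_col A) (vec_index v) \<le> 1}"
    then obtain v where v: "v \<in> carrier_vec n" "max_norm n (vec_index v) \<le> 1"
      and y: "y = max_norm m (vec_index (A *\<^sub>v v))"
      using A by auto
    have "\<bar>(A *\<^sub>v v) $ i\<bar> \<le> row_sum A i" if i: "i < m" for i
      unfolding mult[OF i v(1)] row
    proof (rule order_trans[OF sum_abs], intro sum_mono)
      fix j assume j: "j \<in> {..<n}"
      then have "\<bar>v $ j\<bar> \<le> 1" using abs_le_max_norm[of j n "vec_index v"] v by auto
      then show "\<bar>A $$ (i, j) * v $ j\<bar> \<le> A $$ (i, j)"
        using nn[of i j] i j by (simp add: abs_mult mult_left_le)
    qed
    then show "y \<le> max_norm m (row_sum A)"
      using \<open>0 < m\<close> abs_le_max_norm[of _ m "row_sum A"] unfolding y max_norm_le_iff[OF \<open>0 < m\<close>]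
      by (meson abs_ge_self order_trans)
  qed
qed

lemma BP_matrix_carrier [simp]: "BP_matrix p q u e \<in> carrier_mat (p + q - 1) (p + q - 1)"
  by (simp add: BP_matrix_def)

lemma BP_product_carrier [simp]:
  "BP_product p q u e n \<in> carrier_mat (p + q - 1) (p + q - 1)"
proof (induction n)
  case (Suc n)
  then show ?case
    unfolding BP_product.simps by (rule mult_carrier_mat[OF _ BP_matrix_carrier])
qed (simp add: BP_matrix_def)

lemma BP_product_cong:
  "(\<And>t. - int n \<le> t \<Longrightarrow> t \<le> 0 \<Longrightarrow> e t = e' t) \<Longrightarrow> BP_product p q u e n = BP_product p q u e' n"
  by (induction n) auto

lemma BP_product_Suc_entry:
  assumes "i < p + q - 1" "j < p + q - 1"
  shows "BP_product p q u e (Suc n) $$ (i, j) =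
    (\<Sum>l<p + q - 1. BP_product p q u e n $$ (i, l) * BP_matrix p q u (e (- int (Suc n))) $$ (l, j))"
proof -
  have "dim_row (BP_product p q u e n) = p + q - 1" "dim_col (BP_product p q u e n) = p + q - 1"
       "dim_row (BP_matrix p q u x) = p + q - 1" "dim_col (BP_matrix p q u x) = p + q - 1" for x
    using BP_product_carrier BP_matrix_carrier by (metis carrier_matD)+
  then show ?thesis
    using assms by (auto simp: scalar_prod_def atLeast0LessThan intro!: sum.cong)
qed

lemma BP_matrix_measurable:
  assumes "i < p + q - 1" "j < p + q - 1" "e \<in> borel_measurable S"
  shows "(\<lambda>\<omega>. BP_matrix p q u (e \<omega>) $$ (i, j)) \<in> borel_measurable S"
  using assms unfolding BP_matrix_def by simp

lemma BP_product_measurable: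
  assumes "i < p + q - 1" "j < p + q - 1"
    and "\<And>t. - int n \<le> t \<Longrightarrow> t \<le> 0 \<Longrightarrow> (\<lambda>\<omega>. e \<omega> t) \<in> borel_measurable S"
  shows "(\<lambda>\<omega>. BP_product p q u (e \<omega>) n $$ (i, j)) \<in> borel_measurable S"
  using assms
proof (induction n arbitrary: j)
  case (Suc n)
  show ?case
    unfolding BP_product_Suc_entry[OF Suc.prems(1,2)]
    using Suc.prems by (intro borel_measurable_sum borel_measurable_times Suc.IH BP_matrix_measurable) auto
qed (auto intro: BP_matrix_measurable)

text \<open>
  Coordinate \<open>j\<close> of the vector \<open>Y\<^sub>t\<close> of the Bougerol--Picard recursion, along one path.
\<close>

definition garch_state :: "nat \<Rightarrow> (int \<Rightarrow> real) \<Rightarrow> (int \<Rightarrow> real) \<Rightarrow> int \<Rightarrow> nat \<Rightarrow> real" where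
  "garch_state q x s t j = (if j < q then (s (t + 1 - int j))\<^sup>2 else (x (t - int (j - q)))\<^sup>2)"

lemma garch_state_nonneg: "0 \<le> garch_state q x s t j"
  by (simp add: garch_state_def)

locale BP_nonneg =
  fixes p q :: nat and u :: "nat \<Rightarrow> real"
  assumes p_pos: "1 \<le> p" and q_pos: "1 \<le> q" and u_nonneg: "\<And>k. k \<le> p + q \<Longrightarrow> 0 \<le> u k"
begin

abbreviation "d \<equiv> p + q - 1"

lemma d_pos: "0 < d" using p_pos q_pos by simp

lemma BP_matrix_nonneg: "i < d \<Longrightarrow> j < d \<Longrightarrow> 0 \<le> BP_matrix p q u e $$ (i, j)"
  using p_pos q_pos by (auto simp: BP_matrix_def intro!: u_nonneg add_nonneg_nonneg mult_nonneg_nonneg)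

lemma BP_product_nonneg: "i < d \<Longrightarrow> j < d \<Longrightarrow> 0 \<le> BP_product p q u e n $$ (i, j)"
proof (induction n arbitrary: j)
  case (Suc n)
  then show ?case
    unfolding BP_product_Suc_entry[OF Suc.prems]
    by (intro sum_nonneg mult_nonneg_nonneg BP_matrix_nonneg Suc.IH) auto
qed (auto intro: BP_matrix_nonneg)

lemma op_norm_BP_product: "op_norm (BP_product p q u e n) = max_norm d (row_sum (BP_product p q u e n))"
  by (intro op_norm_eq_max_norm_row_sum[OF BP_product_carrier d_pos d_pos] BP_product_nonneg)

lemma row_sum_BP_product: "row_sum (BP_product p q u e n) i = (\<Sum>j<d. BP_product p q u e n $$ (i, j))"
  using BP_product_carrier[of p q u e n] unfolding row_sum_def by (metis carrier_matD(2))

lemma row_sum_le_op_norm: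
  "i < d \<Longrightarrow> (\<Sum>j<d. BP_product p q u e n $$ (i, j)) \<le> op_norm (BP_product p q u e n)"
  unfolding op_norm_BP_product row_sum_BP_product[symmetric]
  using abs_le_max_norm abs_ge_self order_trans by blast

lemma op_norm_BP_product_le:
  assumes "\<And>i. i < d \<Longrightarrow> (\<Sum>j<d. BP_product p q u e n $$ (i, j)) \<le> c"
  shows "op_norm (BP_product p q u e n) \<le> c"
  unfolding op_norm_BP_product max_norm_le_iff[OF d_pos] row_sum_BP_product
proof (intro allI impI)
  fix i assume i: "i < d"
  then have "0 \<le> (\<Sum>j<d. BP_product p q u e n $$ (i, j))"
    by (intro sum_nonneg BP_product_nonneg) auto
  with assms[OF i] show "\<bar>\<Sum>j<d. BP_product p q u e n $$ (i, j)\<bar> \<le> c" by linarith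
qed

lemma op_norm_BP_product_nonneg: "0 \<le> op_norm (BP_product p q u e n)"
  unfolding op_norm_BP_product by (rule max_norm_nonneg[OF d_pos])

lemma op_norm_BP_product_measurable:
  assumes "\<And>t. - int n \<le> t \<Longrightarrow> t \<le> 0 \<Longrightarrow> (\<lambda>\<omega>. e \<omega> t) \<in> borel_measurable S"
  shows "(\<lambda>\<omega>. op_norm (BP_product p q u (e \<omega>) n)) \<in> borel_measurable S"
  unfolding op_norm_BP_product
  by (intro max_norm_measurable d_pos, unfold row_sum_BP_product)
     (auto intro!: borel_measurable_sum BP_product_measurable assms)

text \<open>
  Any constant dominating the row sums of the one-step matrices relative to \<open>1 + e\<^sup>2\<close> would do.
\<close>

definition "growth_const = real d * (1 + (\<Sum>k\<le>p + q. u k))"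

lemma growth_const_pos: "0 < growth_const"
  unfolding growth_const_def using d_pos
  by (intro mult_pos_pos add_pos_nonneg sum_nonneg u_nonneg) auto

lemma BP_matrix_row_sum_le:
  assumes "i < d"
  shows "(\<Sum>j<d. BP_matrix p q u e $$ (i, j)) \<le> growth_const * (1 + e\<^sup>2)"
proof -
  define C where "C = 1 + (\<Sum>k\<le>p + q. u k)"
  have C1: "1 \<le> C" unfolding C_def by (auto intro!: sum_nonneg u_nonneg)
  have uC: "u k \<le> C" if "k \<le> p + q" for k
    using member_le_sum[of k "{..p + q}" u] that unfolding C_def by (auto simp: u_nonneg)
  have C_le: "C \<le> C * (1 + e\<^sup>2)" using C1 by simp
  have "BP_matrix p q u e $$ (i, j) \<le> C * (1 + e\<^sup>2)" if j: "j < d" for j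
  proof -
    have "u 1 * e\<^sup>2 \<le> C * e\<^sup>2" using p_pos by (intro mult_right_mono uC) auto
    moreover have "u (p + 1) \<le> C" using q_pos by (intro uC) auto
    ultimately have "u (p + 1) + u 1 * e\<^sup>2 \<le> C * (1 + e\<^sup>2)" by (simp add: algebra_simps)
    moreover have "u (p + (j + 1)) \<le> C * (1 + e\<^sup>2)" if "j < q"
      using that by (intro order_trans[OF uC C_le]) auto
    moreover have "u (j - q + 2) \<le> C * (1 + e\<^sup>2)" if "\<not> j < q"
      using that j by (intro order_trans[OF uC C_le]) auto
    moreover have "e\<^sup>2 \<le> C * (1 + e\<^sup>2)"
      using C1 mult_mono[of 1 C "e\<^sup>2" "1 + e\<^sup>2"] by simp
    moreover have "1 \<le> C * (1 + e\<^sup>2)" using C1 C_le by linarith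
    moreover have "0 \<le> C * (1 + e\<^sup>2)" using C1 by simp
    ultimately show ?thesis using assms j by (auto simp: BP_matrix_def)
  qed
  then have "(\<Sum>j<d. BP_matrix p q u e $$ (i, j)) \<le> (\<Sum>j<d. C * (1 + e\<^sup>2))"
    by (intro sum_mono) auto
  then show ?thesis by (simp add: growth_const_def C_def mult.assoc)
qed

text \<open>
  This is what makes the norms integrable: the right-hand side is a product of independent integrable
  factors.
\<close>

lemma op_norm_BP_product_le_prod:
  "op_norm (BP_product p q u e n) \<le> (\<Prod>k\<le>n. growth_const * (1 + (e (- int k))\<^sup>2))"
proof (induction n)
  case 0
  show ?case using BP_matrix_row_sum_le[of _ "e 0"] by (intro op_norm_BP_product_le) simp
next
  case (Suc n)
  let ?x = "e (- int (Suc n))"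
  show ?case
  proof (rule op_norm_BP_product_le)
    fix i assume i: "i < d"
    have "(\<Sum>j<d. BP_product p q u e (Suc n) $$ (i, j))
        = (\<Sum>j<d. \<Sum>l<d. BP_product p q u e n $$ (i, l) * BP_matrix p q u ?x $$ (l, j))"
      using i by (intro sum.cong refl) (simp only: BP_product_Suc_entry lessThan_iff)
    also have "\<dots> = (\<Sum>l<d. BP_product p q u e n $$ (i, l) * (\<Sum>j<d. BP_matrix p q u ?x $$ (l, j)))"
      by (subst sum.swap) (simp add: sum_distrib_left)
    also have "\<dots> \<le> (\<Sum>l<d. BP_product p q u e n $$ (i, l) * (growth_const * (1 + ?x\<^sup>2)))"
      using i by (intro sum_mono mult_left_mono BP_matrix_row_sum_le BP_product_nonneg) auto
    also have "\<dots> = (\<Sum>l<d. BP_product p q u e n $$ (i, l)) * (growth_const * (1 + ?x\<^sup>2))"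
      by (simp add: sum_distrib_right)
    also have "\<dots> \<le> op_norm (BP_product p q u e n) * (growth_const * (1 + ?x\<^sup>2))"
      using i growth_const_pos by (intro mult_right_mono row_sum_le_op_norm) auto
    also have "\<dots> \<le> (\<Prod>k\<le>n. growth_const * (1 + (e (- int k))\<^sup>2)) * (growth_const * (1 + ?x\<^sup>2))"
      using growth_const_pos by (intro mult_right_mono Suc.IH) auto
    finally show "(\<Sum>j<d. BP_product p q u e (Suc n) $$ (i, j))
        \<le> (\<Prod>k\<le>Suc n. growth_const * (1 + (e (- int k))\<^sup>2))"
      by simp
  qed
qed

text \<open>
  The lower bound, coming from the \<open>(0, 0)\<close> entry, keeps the logarithm of the norm bounded
  below, so that its expectation is a genuine integral.
\<close>

lemma op_norm_BP_product_ge: "u (p + 1) ^ Suc n \<le> op_norm (BP_product p q u e n)"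
proof -
  have "u (p + 1) ^ Suc n \<le> BP_product p q u e n $$ (0, 0)"
  proof (induction n)
    case 0
    show ?case using d_pos p_pos u_nonneg[of 1] by (simp add: BP_matrix_def)
  next
    case (Suc n)
    let ?x = "e (- int (Suc n))"
    have b: "0 \<le> u (p + 1)" using q_pos by (intro u_nonneg) auto
    have "u (p + 1) ^ Suc (Suc n) = u (p + 1) ^ Suc n * u (p + 1)" by simp
    also have "\<dots> \<le> BP_product p q u e n $$ (0, 0) * BP_matrix p q u ?x $$ (0, 0)"
      using d_pos p_pos u_nonneg[of 1] b
      by (intro mult_mono Suc.IH BP_product_nonneg) (auto simp: BP_matrix_def)
    also have "\<dots> \<le> (\<Sum>l<d. BP_product p q u e n $$ (0, l) * BP_matrix p q u ?x $$ (l, 0))"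
      using d_pos by (intro member_le_sum[of 0]) (auto intro!: mult_nonneg_nonneg BP_product_nonneg BP_matrix_nonneg)
    also have "\<dots> = BP_product p q u e (Suc n) $$ (0, 0)"
      using d_pos by (simp only: BP_product_Suc_entry)
    finally show ?case .
  qed
  also have "\<dots> \<le> (\<Sum>j<d. BP_product p q u e n $$ (0, j))"
    using d_pos by (intro member_le_sum[of 0]) (auto intro!: BP_product_nonneg)
  also have "\<dots> \<le> op_norm (BP_product p q u e n)"
    by (intro row_sum_le_op_norm d_pos)
  finally show ?thesis .
qed

lemma garch_state_step:
  assumes x: "\<And>t. x t = s t * e t"
    and s: "\<And>t. (s t)\<^sup>2 = u 0 + (\<Sum>i=1..p. u i * (x (t - int i))\<^sup>2)
                        + (\<Sum>j=1..q. u (p + j) * (s (t - int j))\<^sup>2)"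
    and i: "i < d"
  shows "garch_state q x s t i = (\<Sum>j<d. BP_matrix p q u (e t) $$ (i, j) * garch_state q x s (t - 1) j)
           + (if i = 0 then u 0 else 0)"
proof -
  let ?Y = "garch_state q x s (t - 1)"
  consider "i = 0" | "i = q" "i \<noteq> 0" | "i \<noteq> 0" "i \<noteq> q" by blast
  then show ?thesis
  proof cases
    case 1
    have x2: "(x t)\<^sup>2 = (e t)\<^sup>2 * (s t)\<^sup>2"
      unfolding x[of t] by (simp add: power_mult_distrib)
    have "(\<Sum>j<d. BP_matrix p q u (e t) $$ (0, j) * ?Y j)
        = (\<Sum>j\<in>{..<q} \<union> {q..<d}. BP_matrix p q u (e t) $$ (0, j) * ?Y j)"
      using p_pos q_pos by (intro sum.cong) auto
    also have "\<dots> = (\<Sum>j<q. BP_matrix p q u (e t) $$ (0, j) * ?Y j)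
        + (\<Sum>j\<in>{q..<d}. BP_matrix p q u (e t) $$ (0, j) * ?Y j)"
      by (rule sum.union_disjoint) auto
    also have "(\<Sum>j<q. BP_matrix p q u (e t) $$ (0, j) * ?Y j)
        = (\<Sum>j<q. u (p + (j + 1)) * (s (t - int j))\<^sup>2 + (if j = 0 then u 1 * (x t)\<^sup>2 else 0))"
      using p_pos q_pos d_pos
      by (intro sum.cong refl) (auto simp: BP_matrix_def garch_state_def algebra_simps x2)
    also have "\<dots> = (\<Sum>j<q. u (p + (j + 1)) * (s (t - int j))\<^sup>2) + u 1 * (x t)\<^sup>2"
      using q_pos by (simp add: sum.distrib)
    also have "(\<Sum>j<q. u (p + (j + 1)) * (s (t - int j))\<^sup>2) = (\<Sum>j=1..q. u (p + j) * (s (t + 1 - int j))\<^sup>2)"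
      by (rule sum.reindex_bij_witness[of _ "\<lambda>j. j - 1" Suc]) (auto simp: of_nat_diff)
    also have "(\<Sum>j\<in>{q..<d}. BP_matrix p q u (e t) $$ (0, j) * ?Y j)
        = (\<Sum>i\<in>{1<..p}. u i * (x (t + 1 - int i))\<^sup>2)"
      using q_pos d_pos
      by (intro sum.reindex_bij_witness[of _ "\<lambda>i. i + q - 2" "\<lambda>j. j - q + 2"])
         (auto simp: BP_matrix_def garch_state_def of_nat_diff algebra_simps)
    also have "(\<Sum>j=1..q. u (p + j) * (s (t + 1 - int j))\<^sup>2) + u 1 * (x t)\<^sup>2
          + (\<Sum>i\<in>{1<..p}. u i * (x (t + 1 - int i))\<^sup>2)
        = (\<Sum>i=1..p. u i * (x (t + 1 - int i))\<^sup>2) + (\<Sum>j=1..q. u (p + j) * (s (t + 1 - int j))\<^sup>2)"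
      using sum.head[of 1 p "\<lambda>i. u i * (x (t + 1 - int i))\<^sup>2"] p_pos by simp
    also have "\<dots> = (s (t + 1))\<^sup>2 - u 0"
      using s[of "t + 1"] by simp
    finally show ?thesis
      using 1 q_pos by (simp add: garch_state_def)
  next
    case 2
    have "(\<Sum>j<d. BP_matrix p q u (e t) $$ (i, j) * ?Y j) = (\<Sum>j<d. if j = 0 then (e t)\<^sup>2 * ?Y j else 0)"
      using 2 i by (intro sum.cong refl) (auto simp: BP_matrix_def)
    also have "\<dots> = (e t)\<^sup>2 * (s t)\<^sup>2"
      using d_pos q_pos by (simp add: garch_state_def)
    finally show ?thesis
      using 2 by (simp add: garch_state_def x power_mult_distrib)
  next
    case 3
    have "(\<Sum>j<d. BP_matrix p q u (e t) $$ (i, j) * ?Y j) = (\<Sum>j<d. if j = i - 1 then ?Y j else 0)"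
      using 3 i by (intro sum.cong refl) (auto simp: BP_matrix_def)
    also have "\<dots> = ?Y (i - 1)"
      using i by simp
    also have "\<dots> = garch_state q x s t i"
      using 3 by (auto simp: garch_state_def of_nat_diff algebra_simps)
    finally show ?thesis
      using 3 by simp
  qed
qed

text \<open>
  Iterating the one-step recursion backwards; all quantities are nonnegative, so the accumulated constant
  terms may be bounded by row sums.
\<close>

lemma garch_state_iterate:
  assumes x: "\<And>t. x t = s t * e t"
    and s: "\<And>t. (s t)\<^sup>2 = u 0 + (\<Sum>i=1..p. u i * (x (t - int i))\<^sup>2)
                        + (\<Sum>j=1..q. u (p + j) * (s (t - int j))\<^sup>2)"
    and i: "i < d"
  defines "P \<equiv> \<lambda>t n. BP_product p q u (\<lambda>k. e (t + k)) n"
  shows "garch_state q x s t i \<le> (\<Sum>j<d. P t n $$ (i, j) * garch_state q x s (t - int (Suc n)) j)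
           + u 0 * (1 + (\<Sum>k<n. op_norm (P t k)))"
proof (induction n)
  case 0
  show ?case
    using garch_state_step[OF x s i, of t] u_nonneg[of 0] by (simp add: P_def)
next
  case (Suc n)
  let ?A = "BP_matrix p q u (e (t - int (Suc n)))" and ?Y = "garch_state q x s (t - int (Suc (Suc n)))"
  have t': "t - int (Suc n) - 1 = t - int (Suc (Suc n))" by simp
  have "(\<Sum>j<d. P t n $$ (i, j) * garch_state q x s (t - int (Suc n)) j)
      = (\<Sum>j<d. P t n $$ (i, j) * ((\<Sum>l<d. ?A $$ (j, l) * ?Y l) + (if j = 0 then u 0 else 0)))"
    using garch_state_step[OF x s, of _ "t - int (Suc n)"] unfolding t'
    by (intro sum.cong refl) simp
  also have "\<dots> = (\<Sum>j<d. \<Sum>l<d. P t n $$ (i, j) * ?A $$ (j, l) * ?Y l)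
      + (\<Sum>j<d. if j = 0 then P t n $$ (i, j) * u 0 else 0)"
    unfolding distrib_left sum.distrib
    by (simp add: sum_distrib_left mult.assoc if_distrib cong: if_cong)
  also have "(\<Sum>j<d. if j = 0 then P t n $$ (i, j) * u 0 else 0) = P t n $$ (i, 0) * u 0"
    using d_pos by simp
  also have "\<dots> \<le> op_norm (P t n) * u 0"
  proof (intro mult_right_mono)
    have "P t n $$ (i, 0) \<le> (\<Sum>j<d. P t n $$ (i, j))"
      using d_pos i by (intro member_le_sum[of 0]) (auto simp: P_def intro!: BP_product_nonneg)
    also have "\<dots> \<le> op_norm (P t n)" unfolding P_def by (rule row_sum_le_op_norm[OF i])
    finally show "P t n $$ (i, 0) \<le> op_norm (P t n)" .
  qed (simp add: u_nonneg)
  also have "(\<Sum>j<d. \<Sum>l<d. P t n $$ (i, j) * ?A $$ (j, l) * ?Y l) = (\<Sum>l<d. P t (Suc n) $$ (i, l) * ?Y l)"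
  proof (subst sum.swap, intro sum.cong refl)
    fix l assume "l \<in> {..<d}"
    then have "P t (Suc n) $$ (i, l) = (\<Sum>j<d. P t n $$ (i, j) * ?A $$ (j, l))"
      unfolding P_def using i
      by (subst BP_product_Suc_entry) (simp_all only: lessThan_iff add_uminus_conv_diff)
    then show "(\<Sum>j<d. P t n $$ (i, j) * ?A $$ (j, l) * ?Y l) = P t (Suc n) $$ (i, l) * ?Y l"
      by (simp add: sum_distrib_right)
  qed
  finally show ?case using Suc.IH by (simp add: algebra_simps)
qed

lemma max_norm_garch_state_iterate:
  assumes x: "\<And>t. x t = s t * e t"
    and s: "\<And>t. (s t)\<^sup>2 = u 0 + (\<Sum>i=1..p. u i * (x (t - int i))\<^sup>2)
                        + (\<Sum>j=1..q. u (p + j) * (s (t - int j))\<^sup>2)"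
  defines "P \<equiv> \<lambda>t n. BP_product p q u (\<lambda>k. e (t + k)) n"
  shows "max_norm d (garch_state q x s t)
    \<le> op_norm (P t n) * max_norm d (garch_state q x s (t - int (Suc n))) + u 0 * (1 + (\<Sum>k<n. op_norm (P t k)))"
  unfolding max_norm_le_iff[OF d_pos]
proof (intro allI impI)
  fix i assume i: "i < d"
  let ?Y = "garch_state q x s (t - int (Suc n))"
  have "\<bar>garch_state q x s t i\<bar> \<le> (\<Sum>j<d. P t n $$ (i, j) * ?Y j) + u 0 * (1 + (\<Sum>k<n. op_norm (P t k)))"
    using garch_state_iterate[OF x s i, of t n] by (simp add: P_def garch_state_nonneg)
  also have "(\<Sum>j<d. P t n $$ (i, j) * ?Y j) \<le> (\<Sum>j<d. P t n $$ (i, j) * max_norm d ?Y)"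
    using i abs_le_max_norm[of _ d ?Y]
    by (intro sum_mono mult_left_mono) (auto simp: P_def abs_le_iff intro!: BP_product_nonneg)
  also have "\<dots> = (\<Sum>j<d. P t n $$ (i, j)) * max_norm d ?Y"
    by (simp add: sum_distrib_right)
  also have "\<dots> \<le> op_norm (P t n) * max_norm d ?Y"
    unfolding P_def by (intro mult_right_mono row_sum_le_op_norm i max_norm_nonneg d_pos)
  finally show "\<bar>garch_state q x s t i\<bar> \<le> op_norm (P t n) * max_norm d ?Y + u 0 * (1 + (\<Sum>k<n. op_norm (P t k)))"
    by simp
qed

end

section \<open>Moments of stochastic recursions\<close>

text \<open>
  Subadditivity of small powers: it follows by normalizing \<open>a + b\<close> to \<open>1\<close>, where each summand is at most
  its power.
\<close>

lemma powr_add_le: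
  fixes a b s :: real
  assumes "0 \<le> a" "0 \<le> b" "0 \<le> s" "s \<le> 1"
  shows "(a + b) powr s \<le> a powr s + b powr s"
proof (cases "a + b = 0")
  case True
  then show ?thesis by simp
next
  case False
  then have pos: "0 < a + b" using assms by linarith
  have frac: "x / (a + b) \<le> (x / (a + b)) powr s" if "0 \<le> x" "x \<le> a + b" for x
    using that assms pos by (intro le_powr_of_le_one) auto
  have "(a + b) powr s = (a + b) powr s * (a / (a + b) + b / (a + b))"
    using pos by (simp add: add_divide_distrib[symmetric])
  also have "\<dots> \<le> (a + b) powr s * ((a / (a + b)) powr s + (b / (a + b)) powr s)"
    using assms by (intro mult_left_mono add_mono frac) auto
  also have "\<dots> = a powr s + b powr s"
    using assms pos by (simp add: distrib_left powr_mult[symmetric])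
  finally show ?thesis .
qed

lemma powr_le_one_plus:
  fixes a s :: real
  assumes "0 \<le> a" "0 \<le> s" "s \<le> 1"
  shows "a powr s \<le> 1 + a"
proof (cases "a \<le> 1")
  case True
  then have "a powr s \<le> 1" using assms by (simp add: powr_le1)
  then show ?thesis using assms by simp
next
  case False
  then have "a powr s \<le> a powr 1" using assms by (intro powr_mono) auto
  then show ?thesis using False by simp
qed

text \<open>
  The quotients \<open>(Z\<^sup>s - 1) / s\<close> converge to \<open>ln Z\<close> as \<open>s \<rightarrow> 0\<close> and lie between \<open>ln Z\<close> and \<open>Z - 1\<close> for
  \<open>0 < s \<le> 1\<close>. Dominated convergence transfers the negative sign of \<open>E (ln Z)\<close> to \<open>E (Z\<^sup>s) - 1\<close> for some
  small \<open>s\<close>.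
\<close>

lemma (in prob_space) exists_powr_expectation_less_one:
  fixes Z :: "'a \<Rightarrow> real"
  assumes Z: "Z \<in> borel_measurable M" "integrable M Z" and "0 < c" and lower: "\<And>\<omega>. \<omega> \<in> space M \<Longrightarrow> c \<le> Z \<omega>"
    and neg: "expectation (\<lambda>\<omega>. ln (Z \<omega>)) < 0"
  shows "\<exists>s>0. s \<le> 1 \<and> expectation (\<lambda>\<omega>. Z \<omega> powr s) < 1"
proof -
  \<comment> \<open>the difference quotient of \<open>s \<mapsto> Z\<^sup>s\<close> at \<open>0\<close> along \<open>s = 1 / (k + 1)\<close>\<close>
  define g where "g k \<omega> = real (Suc k) * (Z \<omega> powr (1 / real (Suc k)) - 1)" for k \<omega>
  have pos: "0 < Z \<omega>" if "\<omega> \<in> space M" for \<omega> using lower[OF that] \<open>0 < c\<close> by simp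
  have lim: "(\<lambda>k. g k \<omega>) \<longlonglongrightarrow> ln (Z \<omega>)" if "\<omega> \<in> space M" for \<omega>
  proof -
    have "((\<lambda>s. (Z \<omega> powr s - 1) / s) \<longlongrightarrow> ln (Z \<omega>)) (at 0)"
    proof -
      have "((\<lambda>s. Z \<omega> powr s) has_real_derivative ln (Z \<omega>)) (at 0)"
        using pos[OF that] by (auto intro!: derivative_eq_intros)
      then show ?thesis using pos[OF that] by (simp add: has_field_derivative_iff)
    qed
    moreover have "filterlim (\<lambda>k. 1 / real (Suc k)) (at 0) sequentially"
      using LIMSEQ_inverse_real_of_nat by (auto simp: filterlim_at inverse_eq_divide intro!: always_eventually)
    ultimately have "(\<lambda>k. (Z \<omega> powr (1 / real (Suc k)) - 1) / (1 / real (Suc k))) \<longlonglongrightarrow> ln (Z \<omega>)"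
      by (rule filterlim_compose)
    then show ?thesis by (simp add: g_def field_simps)
  qed
  have upper: "g k \<omega> \<le> Z \<omega> - 1" if "\<omega> \<in> space M" for k \<omega>
  proof -
    have "1 + real (Suc k) * (Z \<omega> powr (1 / real (Suc k)) - 1)
        \<le> (1 + (Z \<omega> powr (1 / real (Suc k)) - 1)) ^ Suc k"
      by (rule Bernoulli_inequality) simp
    also have "\<dots> = Z \<omega>"
      using pos[OF that] by (simp add: powr_powr powr_realpow[symmetric] del: power_Suc of_nat_Suc)
    finally show ?thesis by (simp add: g_def)
  qed
  have low: "ln (Z \<omega>) \<le> g k \<omega>" if "\<omega> \<in> space M" for k \<omega>
  proof -
    have "ln (Z \<omega>) = real (Suc k) * ln (Z \<omega> powr (1 / real (Suc k)))"
      using pos[OF that] by (simp add: ln_powr del: of_nat_Suc)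
    also have "\<dots> \<le> g k \<omega>"
      unfolding g_def using pos[OF that] by (intro mult_left_mono ln_le_minus_one) auto
    finally show ?thesis .
  qed
  have bound: "\<bar>g k \<omega>\<bar> \<le> \<bar>ln c\<bar> + \<bar>Z \<omega>\<bar> + 1" if "\<omega> \<in> space M" for k \<omega>
  proof -
    have "ln c \<le> ln (Z \<omega>)" using lower[OF that] pos[OF that] \<open>0 < c\<close> by simp
    then show ?thesis using upper[OF that, of k] low[OF that, of k] by linarith
  qed
  have g_meas: "g k \<in> borel_measurable M" for k
    unfolding g_def using Z by measurable
  have "(\<lambda>k. expectation (g k)) \<longlonglongrightarrow> expectation (\<lambda>\<omega>. ln (Z \<omega>))"
    by (rule integral_dominated_convergence[where w = "\<lambda>\<omega>. \<bar>ln c\<bar> + \<bar>Z \<omega>\<bar> + 1"])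
       (use Z g_meas lim bound in \<open>auto\<close>)
  from order_tendstoD(2)[OF this neg] obtain k where k: "expectation (g k) < 0"
    by (auto simp: eventually_sequentially)
  let ?s = "1 / real (Suc k)"
  have "integrable M (g k)"
    by (rule Bochner_Integration.integrable_bound[of _ "\<lambda>\<omega>. \<bar>ln c\<bar> + \<bar>Z \<omega>\<bar> + 1"])
       (use Z bound g_meas in \<open>auto\<close>)
  moreover have eq: "Z \<omega> powr ?s = g k \<omega> * ?s + 1" for \<omega>
    by (simp add: g_def)
  ultimately have "expectation (\<lambda>\<omega>. Z \<omega> powr ?s) = expectation (g k) * ?s + 1"
    by (simp add: prob_space del: of_nat_Suc)
  then have "expectation (\<lambda>\<omega>. Z \<omega> powr ?s) < 1"
    using k by (simp add: divide_neg_pos del: of_nat_Suc)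
  then show ?thesis by (intro exI[of _ ?s]) auto
qed

lemma (in prob_space) ext_expectation_eq_expectation:
  assumes "integrable M g"
  shows "ext_expectation M (\<lambda>\<omega>. ereal (g \<omega>)) = ereal (expectation g)"
proof -
  have fin: "(\<integral>\<^sup>+ \<omega>. ennreal (g \<omega>) \<partial>M) < \<infinity>" "(\<integral>\<^sup>+ \<omega>. ennreal (- g \<omega>) \<partial>M) < \<infinity>"
    using assms by (auto simp: real_integrable_def less_top)
  have "enn2ereal a = ereal (enn2real a)" if "a < \<infinity>" for a
    using that by (cases a) auto
  with fin show ?thesis
    unfolding ext_expectation_def real_lebesgue_integral_def[OF assms]
    by simp
qed

lemma (in finite_measure) prob_ge_le_nn_integral:
  assumes [measurable]: "f \<in> borel_measurable M"
    and le: "(\<integral>\<^sup>+ \<omega>. ennreal (f \<omega>) \<partial>M) \<le> ennreal C" and "0 < a" "0 \<le> C"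
  shows "measure M {\<omega> \<in> space M. a \<le> f \<omega>} \<le> C / a"
proof -
  have "emeasure M {\<omega> \<in> space M. a \<le> f \<omega>} \<le> emeasure M {\<omega> \<in> space M. 1 \<le> ennreal (1 / a) * ennreal (f \<omega>)}"
  proof (intro emeasure_mono)
    show "{\<omega> \<in> space M. a \<le> f \<omega>} \<subseteq> {\<omega> \<in> space M. 1 \<le> ennreal (1 / a) * ennreal (f \<omega>)}"
      using \<open>0 < a\<close> by (auto simp: ennreal_mult[symmetric] ennreal_1[symmetric] simp del: ennreal_1)
  qed measurable
  also have "\<dots> \<le> ennreal (1 / a) * (\<integral>\<^sup>+ \<omega>. ennreal (f \<omega>) * indicator (space M) \<omega> \<partial>M)"
    using nn_integral_Markov_inequality[of "\<lambda>\<omega>. ennreal (f \<omega>)" "space M" M "ennreal (1 / a)"] by simp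
  also have "\<dots> = ennreal (1 / a) * (\<integral>\<^sup>+ \<omega>. ennreal (f \<omega>) \<partial>M)"
    by (intro arg_cong2[where f = "(*)"] nn_integral_cong refl) simp
  also have "\<dots> \<le> ennreal (1 / a) * ennreal C"
    by (intro mult_left_mono le) simp
  also have "\<dots> = ennreal (C / a)"
    using \<open>0 < a\<close> \<open>0 \<le> C\<close> by (simp add: ennreal_mult[symmetric])
  finally show ?thesis
    using \<open>0 < a\<close> \<open>0 \<le> C\<close> by (simp add: emeasure_eq_measure)
qed

text \<open>
  Unrolling the recursion gives \<open>z\<^sub>0 \<le> G\<^sub>0 \<cdots> G\<^sub>m\<^sub>-\<^sub>1 z\<^sub>m + \<Sum>\<^sub>k G\<^sub>0 \<cdots> G\<^sub>k\<^sub>-\<^sub>1 H\<^sub>k\<close>. By independence the products have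
  expectation at most \<open>\<kappa>\<^sup>m\<close>, so the series \<open>T\<close> has finite expectation, while tightness of the \<open>z\<^sub>m\<close> forces
  the first term to \<open>0\<close> in probability. Consequently \<open>z\<^sub>0 \<le> 1 + T\<close> almost surely. The remainder is
  handled by a union bound, which copes with an arbitrary dependence between \<open>z\<^sub>m\<close> and the products.
\<close>

lemma (in prob_space) stochastic_recursion_moment:
  fixes z :: "nat \<Rightarrow> 'a \<Rightarrow> real" and G H :: "nat \<Rightarrow> 'a \<Rightarrow> real"
  assumes meas: "\<And>m. z m \<in> borel_measurable M"
    and indep: "indep_vars (\<lambda>_. borel \<Otimes>\<^sub>M borel) (\<lambda>m \<omega>. (G m \<omega>, H m \<omega>)) UNIV"
    and z0: "\<And>m \<omega>. \<omega> \<in> space M \<Longrightarrow> 0 \<le> z m \<omega>"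
    and G0: "\<And>m \<omega>. \<omega> \<in> space M \<Longrightarrow> 0 \<le> G m \<omega>"
    and H0: "\<And>m \<omega>. \<omega> \<in> space M \<Longrightarrow> 0 \<le> H m \<omega>"
    and rec: "\<And>m. AE \<omega> in M. z m \<omega> \<le> G m \<omega> * z (Suc m) \<omega> + H m \<omega>"
    and EG: "\<And>m. (\<integral>\<^sup>+ \<omega>. ennreal (G m \<omega>) \<partial>M) \<le> ennreal \<kappa>" and kappa: "0 \<le> \<kappa>" "\<kappa> < 1"
    and EH: "\<And>m. (\<integral>\<^sup>+ \<omega>. ennreal (H m \<omega>) \<partial>M) \<le> ennreal C" and "0 \<le> C"
    and tight: "\<And>e. 0 < e \<Longrightarrow> \<exists>B. \<forall>m. prob {\<omega> \<in> space M. B < z m \<omega>} < e"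
  shows "(\<integral>\<^sup>+ \<omega>. ennreal (z 0 \<omega>) \<partial>M) < \<infinity>"
proof -
  have pair_meas: "(\<lambda>\<omega>. (G m \<omega>, H m \<omega>)) \<in> M \<rightarrow>\<^sub>M borel \<Otimes>\<^sub>M borel" for m
    using indep by (simp add: indep_vars_def)
  have G_meas[measurable]: "G m \<in> borel_measurable M" for m
    using measurable_compose[OF pair_meas[of m] measurable_fst] by simp
  have H_meas[measurable]: "H m \<in> borel_measurable M" for m
    using measurable_compose[OF pair_meas[of m] measurable_snd] by simp
  note [measurable] = meas
  define P where "P m \<omega> = (\<Prod>i<m. G i \<omega>)" for m \<omega>
  define S where "S m \<omega> = (\<Sum>k<m. P k \<omega> * H k \<omega>)" for m \<omega>
  have P_meas[measurable]: "P m \<in> borel_measurable M" for m unfolding P_def by measurable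
  have S_meas[measurable]: "S m \<in> borel_measurable M" for m unfolding S_def by measurable
  have P0: "0 \<le> P m \<omega>" if "\<omega> \<in> space M" for m \<omega>
    unfolding P_def using G0[OF that] by (intro prod_nonneg) auto
  have iter: "AE \<omega> in M. \<forall>m. z 0 \<omega> \<le> P m \<omega> * z m \<omega> + S m \<omega>"
  proof -
    have "AE \<omega> in M. \<forall>m. z m \<omega> \<le> G m \<omega> * z (Suc m) \<omega> + H m \<omega>"
      using rec by (simp add: AE_all_countable)
    with AE_space show ?thesis
    proof eventually_elim
      case (elim \<omega>)
      have "z 0 \<omega> \<le> P m \<omega> * z m \<omega> + S m \<omega>" for m
      proof (induction m)
        case (Suc m)
        have "P m \<omega> * z m \<omega> \<le> P m \<omega> * (G m \<omega> * z (Suc m) \<omega> + H m \<omega>)"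
          using elim P0 by (intro mult_left_mono) auto
        then show ?case using Suc by (simp add: P_def S_def algebra_simps)
      qed (simp add: P_def S_def)
      then show ?case by blast
    qed
  qed
  have EP: "(\<integral>\<^sup>+ \<omega>. ennreal (P m \<omega>) \<partial>M) \<le> ennreal (\<kappa> ^ m)" for m
  proof -
    have "indep_vars (\<lambda>_. borel) (\<lambda>m \<omega>. (ennreal \<circ> fst) (G m \<omega>, H m \<omega>)) {..<m}"
      by (intro indep_vars_compose2[OF indep_vars_subset[OF indep]]) auto
    then have "(\<integral>\<^sup>+ \<omega>. (\<Prod>i<m. ennreal (G i \<omega>)) \<partial>M) = (\<Prod>i<m. \<integral>\<^sup>+ \<omega>. ennreal (G i \<omega>) \<partial>M)"
      by (intro indep_vars_nn_integral) auto
    also have "\<dots> \<le> (\<Prod>i<m. ennreal \<kappa>)"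
      by (intro prod_mono_ennreal EG)
    also have "\<dots> = ennreal (\<kappa> ^ m)" using kappa by (simp add: ennreal_power)
    also have "(\<integral>\<^sup>+ \<omega>. (\<Prod>i<m. ennreal (G i \<omega>)) \<partial>M) = (\<integral>\<^sup>+ \<omega>. ennreal (P m \<omega>) \<partial>M)"
      by (intro nn_integral_cong) (auto simp: P_def prod_ennreal G0)
    finally show ?thesis .
  qed
  have EPH: "(\<integral>\<^sup>+ \<omega>. ennreal (P k \<omega> * H k \<omega>) \<partial>M) \<le> ennreal (\<kappa> ^ k * C)" for k
  proof -
    let ?X = "\<lambda>i \<omega>. ennreal ((if i < k then fst else snd) (G i \<omega>, H i \<omega>))"
    have "indep_vars (\<lambda>_. borel)
        (\<lambda>i \<omega>. (\<lambda>x. ennreal ((if i < k then fst else snd) x)) (G i \<omega>, H i \<omega>)) {..k}"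
      by (intro indep_vars_compose2[OF indep_vars_subset[OF indep]]) auto
    then have "(\<integral>\<^sup>+ \<omega>. (\<Prod>i\<le>k. ?X i \<omega>) \<partial>M) = (\<Prod>i\<le>k. \<integral>\<^sup>+ \<omega>. ?X i \<omega> \<partial>M)"
      by (intro indep_vars_nn_integral) auto
    also have "\<dots> = (\<Prod>i<k. \<integral>\<^sup>+ \<omega>. ennreal (G i \<omega>) \<partial>M) * (\<integral>\<^sup>+ \<omega>. ennreal (H k \<omega>) \<partial>M)"
      by (simp add: lessThan_Suc_atMost[symmetric])
    also have "\<dots> \<le> (\<Prod>i<k. ennreal \<kappa>) * ennreal C"
      by (intro mult_mono prod_mono_ennreal EG EH) auto
    also have "\<dots> = ennreal (\<kappa> ^ k * C)"
      using kappa \<open>0 \<le> C\<close> by (simp add: ennreal_power ennreal_mult)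
    also have "(\<integral>\<^sup>+ \<omega>. (\<Prod>i\<le>k. ?X i \<omega>) \<partial>M) = (\<integral>\<^sup>+ \<omega>. ennreal (P k \<omega> * H k \<omega>) \<partial>M)"
      using P0 H0 by (intro nn_integral_cong)
        (auto simp: lessThan_Suc_atMost[symmetric] P_def prod_ennreal G0 ennreal_mult prod_nonneg)
    finally show ?thesis .
  qed
  define T where "T \<omega> = (\<Sum>k. ennreal (P k \<omega> * H k \<omega>))" for \<omega>
  have ET: "(\<integral>\<^sup>+ \<omega>. T \<omega> \<partial>M) < \<infinity>"
  proof -
    have "(\<integral>\<^sup>+ \<omega>. T \<omega> \<partial>M) = (\<Sum>k. \<integral>\<^sup>+ \<omega>. ennreal (P k \<omega> * H k \<omega>) \<partial>M)"
      unfolding T_def by (intro nn_integral_suminf) measurable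
    also have "\<dots> \<le> (\<Sum>k. ennreal (\<kappa> ^ k * C))"
      by (intro suminf_le EPH) auto
    also have "\<dots> = ennreal (\<Sum>k. \<kappa> ^ k * C)"
      using kappa \<open>0 \<le> C\<close> by (intro suminf_ennreal2) (auto intro!: summable_mult2 summable_geometric)
    finally show ?thesis by (simp add: le_less_trans)
  qed
  have S_le_T: "ennreal (S m \<omega>) \<le> T \<omega>" if "\<omega> \<in> space M" for m \<omega>
  proof -
    have "ennreal (S m \<omega>) = (\<Sum>k<m. ennreal (P k \<omega> * H k \<omega>))"
      unfolding S_def using P0[OF that] H0[OF that] by (intro sum_ennreal[symmetric]) auto
    also have "\<dots> \<le> T \<omega>" unfolding T_def by (intro sum_le_suminf) auto
    finally show ?thesis .
  qed
  have rem: "prob {\<omega> \<in> space M. 1 < P m \<omega> * z m \<omega>} < e + B * \<kappa> ^ m"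
    if "\<And>m. prob {\<omega> \<in> space M. B < z m \<omega>} < e" "0 < B" for e B m
  proof -
    have "prob {\<omega> \<in> space M. 1 < P m \<omega> * z m \<omega>}
        \<le> prob ({\<omega> \<in> space M. B < z m \<omega>} \<union> {\<omega> \<in> space M. 1 / B \<le> P m \<omega>})"
    proof (intro finite_measure_mono)
      show "{\<omega> \<in> space M. 1 < P m \<omega> * z m \<omega>}
          \<subseteq> {\<omega> \<in> space M. B < z m \<omega>} \<union> {\<omega> \<in> space M. 1 / B \<le> P m \<omega>}"
      proof
        fix \<omega> assume w: "\<omega> \<in> {\<omega> \<in> space M. 1 < P m \<omega> * z m \<omega>}"
        have "1 / B \<le> P m \<omega>" if "z m \<omega> \<le> B"
        proof -
          have "P m \<omega> * z m \<omega> \<le> P m \<omega> * B" using w that P0 by (intro mult_left_mono) auto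
          then show ?thesis using w \<open>0 < B\<close> by (simp add: field_simps)
        qed
        then show "\<omega> \<in> {\<omega> \<in> space M. B < z m \<omega>} \<union> {\<omega> \<in> space M. 1 / B \<le> P m \<omega>}"
          using w by force
      qed
    qed measurable
    also have "\<dots> \<le> prob {\<omega> \<in> space M. B < z m \<omega>} + prob {\<omega> \<in> space M. 1 / B \<le> P m \<omega>}"
      by (intro measure_Un_le) measurable
    also have "prob {\<omega> \<in> space M. 1 / B \<le> P m \<omega>} \<le> B * \<kappa> ^ m"
    proof -
      have "prob {\<omega> \<in> space M. 1 / B \<le> P m \<omega>} \<le> \<kappa> ^ m / (1 / B)"
        using \<open>0 < B\<close> kappa by (intro prob_ge_le_nn_integral EP) auto
      then show ?thesis by (simp add: mult.commute)
    qed
    finally show ?thesis using that(1)[of m] by linarith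
  qed
  have T_meas[measurable]: "T \<in> borel_measurable M" unfolding T_def by measurable
  have "AE \<omega> in M. ennreal (z 0 \<omega>) \<le> 1 + T \<omega>"
  proof -
    let ?N = "{\<omega> \<in> space M. \<not> ennreal (z 0 \<omega>) \<le> 1 + T \<omega>}"
    have N_le: "prob ?N \<le> prob {\<omega> \<in> space M. 1 < P m \<omega> * z m \<omega>}" for m
    proof (rule finite_measure_mono_AE)
      show "AE \<omega> in M. \<omega> \<in> ?N \<longrightarrow> \<omega> \<in> {\<omega> \<in> space M. 1 < P m \<omega> * z m \<omega>}"
        using iter AE_space
      proof eventually_elim
        case (elim \<omega>)
        have "ennreal (z 0 \<omega>) \<le> 1 + T \<omega>" if "P m \<omega> * z m \<omega> \<le> 1"
        proof -
          have "ennreal (z 0 \<omega>) \<le> ennreal (1 + S m \<omega>)"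
            using elim that by (intro ennreal_leI) (smt (verit))
          also have "\<dots> = 1 + ennreal (S m \<omega>)"
            using elim P0 H0 by (simp add: S_def sum_nonneg)
          also have "\<dots> \<le> 1 + T \<omega>" using S_le_T elim by (intro add_left_mono) auto
          finally show ?thesis .
        qed
        then show ?case using elim by force
      qed
    qed measurable
    have "prob ?N \<le> e" if e: "0 < e" for e :: real
    proof -
      obtain B where B: "\<And>m. prob {\<omega> \<in> space M. B < z m \<omega>} < e" using tight[OF e] by blast
      define B' where "B' = max B 1"
      have B': "prob {\<omega> \<in> space M. B' < z m \<omega>} < e" for m
        by (rule le_less_trans[OF finite_measure_mono B[of m]]) (auto simp: B'_def)
      have "0 < B'" by (simp add: B'_def)
      have "prob ?N \<le> e + B' * \<kappa> ^ m" for m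
        using N_le[of m] rem[OF B' \<open>0 < B'\<close>, of m] by linarith
      moreover have "(\<lambda>m. e + B' * \<kappa> ^ m) \<longlonglongrightarrow> e + B' * 0"
        using kappa by (intro tendsto_intros LIMSEQ_power_zero) auto
      ultimately show ?thesis by (intro LIMSEQ_le_const[of _ "e"]) auto
    qed
    then have "prob ?N \<le> 0"
      by (rule field_le_epsilon) simp
    then have "prob ?N = 0"
      using measure_nonneg[of M ?N] by linarith
    then show ?thesis
      by (subst AE_iff_measurable[of ?N]) (auto simp: emeasure_eq_measure)
  qed
  then have le: "(\<integral>\<^sup>+ \<omega>. ennreal (z 0 \<omega>) \<partial>M) \<le> (\<integral>\<^sup>+ \<omega>. 1 + T \<omega> \<partial>M)"
    by (rule nn_integral_mono_AE)
  have eq: "(\<integral>\<^sup>+ \<omega>. 1 + T \<omega> \<partial>M) = 1 + (\<integral>\<^sup>+ \<omega>. T \<omega> \<partial>M)"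
    by (subst nn_integral_add) (auto simp: emeasure_space_1)
  show ?thesis
    by (rule le_less_trans[OF le]) (use ET in \<open>simp add: eq\<close>)
qed

section \<open>Independent blocks, stationarity and tightness\<close>

text \<open>
  Disjoint blocks of a sequence of independent identically distributed variables, read backwards in time,
  are again independent and identically distributed. Indexing each block by \<open>{..N}\<close> rather than by its
  own set of times is what makes the distributions comparable.
\<close>

lemma (in prob_space) iid_blocks:
  fixes eps :: "int \<Rightarrow> 'a \<Rightarrow> real" and N :: nat
  assumes indep: "indep_vars (\<lambda>_. borel) eps UNIV"
    and ident: "\<And>t. distr M borel (eps t) = distr M borel (eps 0)"
  defines "block \<equiv> \<lambda>(k :: nat) \<omega>. \<lambda>j\<in>{..N}. eps (- int (k * Suc N) - int j) \<omega>"
  shows "indep_vars (\<lambda>_. PiM {..N} (\<lambda>_. borel)) block UNIV"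
    and "distr M (PiM {..N} (\<lambda>_. borel)) (block k) = distr M (PiM {..N} (\<lambda>_. borel)) (block 0)"
proof -
  define ix where "ix k j = - int (k * Suc N) - int j" for k j
  define K where "K k = ix k ` {..N}" for k
  have rv: "eps t \<in> borel_measurable M" for t
    using indep by (auto simp: indep_vars_def)
  have ix_inj: "k = k' \<and> j = j'" if "j \<le> N" "j' \<le> N" "ix k j = ix k' j'" for k k' j j'
  proof -
    from that(3) have "int (j + Suc N * k) = int (j' + Suc N * k')"
      by (simp add: ix_def algebra_simps)
    then have eq: "j + Suc N * k = j' + Suc N * k'" by (simp only: of_nat_eq_iff)
    have "(j + Suc N * k) div Suc N = k" "(j' + Suc N * k') div Suc N = k'"
      using that(1,2) by (simp_all only: div_mult_self2 nat.distinct less_Suc_eq_le div_less not_False_eq_True add_0)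
    with eq show ?thesis by simp
  qed
  have "disjoint_family_on K UNIV"
    unfolding disjoint_family_on_def K_def using ix_inj by blast
  from indep_vars_restrict[OF indep _ this]
  have "indep_vars (\<lambda>k. PiM (K k) (\<lambda>_. borel)) (\<lambda>k \<omega>. restrict (\<lambda>t. eps t \<omega>) (K k)) UNIV"
    by simp
  then have "indep_vars (\<lambda>_. PiM {..N} (\<lambda>_. borel))
      (\<lambda>k \<omega>. (\<lambda>y. \<lambda>j\<in>{..N}. y (ix k j)) (restrict (\<lambda>t. eps t \<omega>) (K k))) UNIV"
  proof (rule indep_vars_compose2)
    show "(\<lambda>y. \<lambda>j\<in>{..N}. y (ix k j)) \<in> PiM (K k) (\<lambda>_. borel) \<rightarrow>\<^sub>M PiM {..N} (\<lambda>_. borel)" for k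
      by (intro measurable_restrict measurable_component_singleton) (simp add: K_def)
  qed
  also have "(\<lambda>k \<omega>. (\<lambda>y. \<lambda>j\<in>{..N}. y (ix k j)) (restrict (\<lambda>t. eps t \<omega>) (K k))) = block"
    by (auto simp: block_def ix_def K_def fun_eq_iff)
  finally show "indep_vars (\<lambda>_. PiM {..N} (\<lambda>_. borel)) block UNIV" .
  have distr_block: "distr M (PiM {..N} (\<lambda>_. borel)) (block k) = PiM {..N} (\<lambda>_. distr M borel (eps 0))" for k
  proof -
    have "disjoint_family_on (\<lambda>j. {ix k j}) {..N}"
      unfolding disjoint_family_on_def using ix_inj by blast
    from indep_vars_restrict[OF indep _ this]
    have "indep_vars (\<lambda>j. PiM {ix k j} (\<lambda>_. borel)) (\<lambda>j \<omega>. restrict (\<lambda>t. eps t \<omega>) {ix k j}) {..N}"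
      by simp
    then have "indep_vars (\<lambda>_. borel)
        (\<lambda>j \<omega>. (\<lambda>y. y (ix k j)) (restrict (\<lambda>t. eps t \<omega>) {ix k j})) {..N}"
      by (rule indep_vars_compose2) (auto intro!: measurable_component_singleton)
    then have "indep_vars (\<lambda>_. borel) (\<lambda>j. eps (ix k j)) {..N}"
      by (simp add: restrict_def)
    then have "distr M (PiM {..N} (\<lambda>_. borel)) (\<lambda>\<omega>. \<lambda>j\<in>{..N}. eps (ix k j) \<omega>)
        = PiM {..N} (\<lambda>j. distr M borel (eps (ix k j)))"
      by (subst (asm) indep_vars_iff_distr_eq_PiM') (auto simp: rv)
    also have "\<dots> = PiM {..N} (\<lambda>_. distr M borel (eps 0))"
      by (intro PiM_cong refl ident)
    finally show ?thesis by (simp add: block_def ix_def)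
  qed
  show "distr M (PiM {..N} (\<lambda>_. borel)) (block k) = distr M (PiM {..N} (\<lambda>_. borel)) (block 0)"
    unfolding distr_block ..
qed

lemma strictly_stationary_distr:
  assumes "strictly_stationary M Z"
  shows "distr M borel (Z t) = distr M borel (Z 0)"
proof -
  have [measurable]: "Z t \<in> borel_measurable M" for t
    using assms by (auto simp: strictly_stationary_def)
  have ev: "(\<lambda>y. y 0) \<in> PiM {0::int} (\<lambda>_. borel) \<rightarrow>\<^sub>M borel"
    by (intro measurable_component_singleton) simp
  have proj: "distr M borel (Z t) = distr (distr M (PiM {0} (\<lambda>_. borel)) (\<lambda>\<omega>. \<lambda>s\<in>{0}. Z (s + t) \<omega>)) borel (\<lambda>y. y 0)" for t
  proof -
    have "(\<lambda>\<omega>. \<lambda>s\<in>{0}. Z (s + t) \<omega>) \<in> M \<rightarrow>\<^sub>M PiM {0} (\<lambda>_. borel)"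
      by (intro measurable_restrict) simp
    from distr_distr[OF ev this] show ?thesis by (simp add: comp_def)
  qed
  have "distr M (PiM {0} (\<lambda>_. borel)) (\<lambda>\<omega>. \<lambda>s\<in>{0}. Z (s + t) \<omega>) =
      distr M (PiM {0} (\<lambda>_. borel)) (\<lambda>\<omega>. \<lambda>s\<in>{0}. Z s \<omega>)"
    using assms by (simp add: strictly_stationary_def)
  then show ?thesis
    using proj[of t] proj[of 0] by simp
qed

text \<open>
  The model equations along one path, so that deterministic estimates for such a path can be applied
  outside a single null set.
\<close>

definition garch_path :: "nat \<Rightarrow> nat \<Rightarrow> (nat \<Rightarrow> real) \<Rightarrow> (int \<Rightarrow> real) \<Rightarrow> (int \<Rightarrow> real) \<Rightarrow> (int \<Rightarrow> real) \<Rightarrow> bool" where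
  "garch_path p q u e x s \<longleftrightarrow>
     (\<forall>t. 0 \<le> s t \<and> x t = s t * e t \<and>
        (s t)\<^sup>2 = u 0 + (\<Sum>i=1..p. u i * (x (t - int i))\<^sup>2) + (\<Sum>j=1..q. u (p + j) * (s (t - int j))\<^sup>2))"

lemma garch_pathD:
  assumes "garch_path p q u e x s"
  shows "0 \<le> s t" "x t = s t * e t"
    "(s t)\<^sup>2 = u 0 + (\<Sum>i=1..p. u i * (x (t - int i))\<^sup>2) + (\<Sum>j=1..q. u (p + j) * (s (t - int j))\<^sup>2)"
  using assms unfolding garch_path_def by blast+

text \<open>
  There are only countably many times, so the exceptional null sets can be merged.
\<close>

lemma stationary_garch_AE_path:
  "stationary_garch p q u M eps X sig \<Longrightarrow>
     AE \<omega> in M. garch_path p q u (\<lambda>t. eps t \<omega>) (\<lambda>t. X t \<omega>) (\<lambda>t. sig t \<omega>)"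
  unfolding garch_path_def stationary_garch_def by (simp add: AE_all_countable)

lemma stationary_garch_measurable:
  assumes "stationary_garch p q u M eps X sig"
  shows "X t \<in> borel_measurable M" "sig t \<in> borel_measurable M"
proof -
  have "(\<lambda>\<omega>. (X t \<omega>, sig t \<omega>)) \<in> borel_measurable M"
    using assms by (auto simp: stationary_garch_def strictly_stationary_def)
  from measurable_compose[OF this, of fst borel] measurable_compose[OF this, of snd borel]
  show "X t \<in> borel_measurable M" "sig t \<in> borel_measurable M"
    by (auto simp: borel_measurable_continuous_onI continuous_on_fst continuous_on_snd)
qed

lemma stationary_garch_distr:
  fixes g :: "real \<Rightarrow> real"
  assumes garch: "stationary_garch p q u M eps X sig" and g: "g \<in> borel_measurable borel"
  shows "distr M borel (\<lambda>\<omega>. g (X t \<omega>)) = distr M borel (\<lambda>\<omega>. g (X 0 \<omega>))"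
    and "distr M borel (\<lambda>\<omega>. g (sig t \<omega>)) = distr M borel (\<lambda>\<omega>. g (sig 0 \<omega>))"
proof -
  have Z: "(\<lambda>\<omega>. (X t \<omega>, sig t \<omega>)) \<in> borel_measurable M" for t
    using garch by (auto simp: stationary_garch_def strictly_stationary_def)
  have "distr M borel (\<lambda>\<omega>. (X t \<omega>, sig t \<omega>)) = distr M borel (\<lambda>\<omega>. (X 0 \<omega>, sig 0 \<omega>))"
    using garch by (intro strictly_stationary_distr[of M "\<lambda>t \<omega>. (X t \<omega>, sig t \<omega>)"]) (simp add: stationary_garch_def)
  then have eq: "distr M borel (\<lambda>\<omega>. \<phi> (X t \<omega>, sig t \<omega>)) = distr M borel (\<lambda>\<omega>. \<phi> (X 0 \<omega>, sig 0 \<omega>))"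
    if "\<phi> \<in> borel_measurable borel" for \<phi> :: "real \<times> real \<Rightarrow> real"
    using distr_distr[OF that Z, of t] distr_distr[OF that Z, of 0] by (simp add: comp_def)
  have "(\<lambda>z. g (fst z :: real)) \<in> borel_measurable (borel :: (real \<times> real) measure)"
       "(\<lambda>z. g (snd z :: real)) \<in> borel_measurable (borel :: (real \<times> real) measure)"
    by (intro measurable_compose[OF _ g] borel_measurable_continuous_onI continuous_intros)+
  from eq[OF this(1)] eq[OF this(2)]
  show "distr M borel (\<lambda>\<omega>. g (X t \<omega>)) = distr M borel (\<lambda>\<omega>. g (X 0 \<omega>))"
    and "distr M borel (\<lambda>\<omega>. g (sig t \<omega>)) = distr M borel (\<lambda>\<omega>. g (sig 0 \<omega>))"
    by simp_all
qed

lemma nn_integral_cong_distr: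
  assumes "distr M N Y = distr M N Z" "Y \<in> M \<rightarrow>\<^sub>M N" "Z \<in> M \<rightarrow>\<^sub>M N" "f \<in> borel_measurable N"
  shows "(\<integral>\<^sup>+ \<omega>. f (Y \<omega>) \<partial>M) = (\<integral>\<^sup>+ \<omega>. f (Z \<omega>) \<partial>M)"
  using nn_integral_distr[OF assms(2), of f] nn_integral_distr[OF assms(3), of f] assms(1,4) by simp

lemma (in prob_space) tail_prob_small:
  fixes Z :: "'a \<Rightarrow> real"
  assumes [measurable]: "Z \<in> borel_measurable M" and "0 < e"
  shows "\<exists>B\<ge>0. prob {\<omega> \<in> space M. B < Z \<omega>} < e"
proof -
  have "(\<lambda>n. prob {\<omega> \<in> space M. real n < Z \<omega>}) \<longlonglongrightarrow> prob (\<Inter>n. {\<omega> \<in> space M. real n < Z \<omega>})"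
    by (intro finite_Lim_measure_decseq) (auto simp: decseq_def)
  also have "(\<Inter>n. {\<omega> \<in> space M. real n < Z \<omega>}) = {}"
  proof (rule equals0I)
    fix \<omega> assume w: "\<omega> \<in> (\<Inter>n. {\<omega> \<in> space M. real n < Z \<omega>})"
    obtain n where "Z \<omega> < real n" using reals_Archimedean2 by blast
    moreover have "real n < Z \<omega>" using w by blast
    ultimately show False by simp
  qed
  finally have lim: "(\<lambda>n. prob {\<omega> \<in> space M. real n < Z \<omega>}) \<longlonglongrightarrow> 0"
    by simp
  obtain n where n: "prob {\<omega> \<in> space M. real n < Z \<omega>} < e"
    using eventually_happens'[OF sequentially_bot order_tendstoD(2)[OF lim \<open>0 < e\<close>]] by blast
  show ?thesis
    by (rule exI[of _ "real n"]) (use n in simp)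
qed

text \<open>
  All coordinates are squares of \<open>X\<close> or \<open>\<sigma>\<close> at some time and thus have one of two fixed distributions; a
  union bound over the coordinates gives tightness uniformly in time.
\<close>

lemma (in prob_space) stationary_garch_state_tight:
  assumes garch: "stationary_garch p q u M eps X sig" and "BP_nonneg p q u" and "0 < e"
  shows "\<exists>B\<ge>0. \<forall>t. prob {\<omega> \<in> space M.
           B < max_norm (p + q - 1) (garch_state q (\<lambda>t. X t \<omega>) (\<lambda>t. sig t \<omega>) t)} < e"
proof -
  interpret BP_nonneg p q u by fact
  note [measurable] = stationary_garch_measurable[OF garch]
  have "0 < e / real d" using \<open>0 < e\<close> d_pos by simp
  have X2: "(\<lambda>\<omega>. (X 0 \<omega>)\<^sup>2) \<in> borel_measurable M" and sig2: "(\<lambda>\<omega>. (sig 0 \<omega>)\<^sup>2) \<in> borel_measurable M"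
    by measurable
  obtain B1 where B1: "0 \<le> B1" "prob {\<omega> \<in> space M. B1 < (X 0 \<omega>)\<^sup>2} < e / real d"
    using tail_prob_small[OF X2 \<open>0 < e / real d\<close>] by blast
  obtain B2 where B2: "0 \<le> B2" "prob {\<omega> \<in> space M. B2 < (sig 0 \<omega>)\<^sup>2} < e / real d"
    using tail_prob_small[OF sig2 \<open>0 < e / real d\<close>] by blast
  define B where "B = max B1 B2"
  have shift: "prob {\<omega> \<in> space M. B < Y \<omega>} = prob {\<omega> \<in> space M. B < Z \<omega>}"
    if "distr M borel Y = distr M borel Z" "Y \<in> borel_measurable M" "Z \<in> borel_measurable M"
    for Y Z :: "'a \<Rightarrow> real"
  proof -
    have "prob {\<omega> \<in> space M. B < W \<omega>} = measure (distr M borel W) {B<..}"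
      if "W \<in> borel_measurable M" for W
      using that by (subst measure_distr) (auto intro!: arg_cong[where f = prob])
    with that show ?thesis by (simp only:)
  qed
  have coord: "prob {\<omega> \<in> space M. B < garch_state q (\<lambda>t. X t \<omega>) (\<lambda>t. sig t \<omega>) t j} < e / real d" for t j
  proof (cases "j < q")
    case True
    have "prob {\<omega> \<in> space M. B < (sig (t + 1 - int j) \<omega>)\<^sup>2} = prob {\<omega> \<in> space M. B < (sig 0 \<omega>)\<^sup>2}"
      by (intro shift stationary_garch_distr(2)[OF garch, of "\<lambda>z. z\<^sup>2"]) measurable
    also have "\<dots> \<le> prob {\<omega> \<in> space M. B2 < (sig 0 \<omega>)\<^sup>2}"
      by (intro finite_measure_mono) (auto simp: B_def)
    finally show ?thesis using B2 True by (simp add: garch_state_def)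
  next
    case False
    have "prob {\<omega> \<in> space M. B < (X (t - int (j - q)) \<omega>)\<^sup>2} = prob {\<omega> \<in> space M. B < (X 0 \<omega>)\<^sup>2}"
      by (intro shift stationary_garch_distr(1)[OF garch, of "\<lambda>z. z\<^sup>2"]) measurable
    also have "\<dots> \<le> prob {\<omega> \<in> space M. B1 < (X 0 \<omega>)\<^sup>2}"
      by (intro finite_measure_mono) (auto simp: B_def)
    finally show ?thesis using B1 False by (simp add: garch_state_def)
  qed
  have gm[measurable]: "(\<lambda>\<omega>. garch_state q (\<lambda>t. X t \<omega>) (\<lambda>t. sig t \<omega>) t j) \<in> borel_measurable M" for t j
    unfolding garch_state_def by measurable
  have coord_set: "{\<omega> \<in> space M. B < garch_state q (\<lambda>t. X t \<omega>) (\<lambda>t. sig t \<omega>) t j} \<in> events" for t j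
    using gm[of t j] by simp
  have "prob {\<omega> \<in> space M. B < max_norm d (garch_state q (\<lambda>t. X t \<omega>) (\<lambda>t. sig t \<omega>) t)} < e" for t
  proof -
    have "prob {\<omega> \<in> space M. B < max_norm d (garch_state q (\<lambda>t. X t \<omega>) (\<lambda>t. sig t \<omega>) t)}
        \<le> prob (\<Union>j\<in>{..<d}. {\<omega> \<in> space M. B < garch_state q (\<lambda>t. X t \<omega>) (\<lambda>t. sig t \<omega>) t j})"
    proof (intro finite_measure_mono subsetI)
      fix \<omega> assume w: "\<omega> \<in> {\<omega> \<in> space M. B < max_norm d (garch_state q (\<lambda>t. X t \<omega>) (\<lambda>t. sig t \<omega>) t)}"
      from w have "B < max_norm d (garch_state q (\<lambda>t. X t \<omega>) (\<lambda>t. sig t \<omega>) t)"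
        by blast
      from less_max_norm_iff[OF d_pos, THEN iffD1, OF this]
      obtain j where "j < d" "B < \<bar>garch_state q (\<lambda>t. X t \<omega>) (\<lambda>t. sig t \<omega>) t j\<bar>"
        by (elim exE conjE)
      then show "\<omega> \<in> (\<Union>j\<in>{..<d}. {\<omega> \<in> space M. B < garch_state q (\<lambda>t. X t \<omega>) (\<lambda>t. sig t \<omega>) t j})"
        using w by (auto simp: garch_state_nonneg)
    qed (intro sets.finite_UN finite_lessThan coord_set)
    also have "\<dots> \<le> (\<Sum>j<d. prob {\<omega> \<in> space M. B < garch_state q (\<lambda>t. X t \<omega>) (\<lambda>t. sig t \<omega>) t j})"
      by (intro finite_measure_subadditive_finite) (use coord_set in auto)
    also have "\<dots> < (\<Sum>j<d. e / real d)"
      by (intro sum_strict_mono coord finite_lessThan) (use d_pos in \<open>simp_all add: lessThan_empty_iff\<close>)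
    also have "\<dots> = e" using d_pos by simp
    finally show ?thesis .
  qed
  moreover have "0 \<le> B" using B1 by (simp add: B_def)
  ultimately show ?thesis by blast
qed

section \<open>A power moment of the stationary GARCH process\<close>

lemma (in prob_space) iid_standardized_moments:
  assumes iid: "iid_standardized M eps"
  shows "indep_vars (\<lambda>_. borel) eps UNIV" "eps t \<in> borel_measurable M"
    "distr M borel (eps t) = distr M borel (eps 0)"
    "integrable M (\<lambda>\<omega>. (eps t \<omega>)\<^sup>2)" "expectation (\<lambda>\<omega>. (eps t \<omega>)\<^sup>2) = 1"
proof -
  show indep: "indep_vars (\<lambda>_. borel) eps UNIV" and distr: "distr M borel (eps t) = distr M borel (eps 0)"
    using iid by (auto simp: iid_standardized_def)
  have meas[measurable]: "eps t \<in> borel_measurable M" for t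
    using indep by (simp add: indep_vars_def)
  then show "eps t \<in> borel_measurable M" .
  have int0: "integrable M (eps 0)" "integrable M (\<lambda>\<omega>. (eps 0 \<omega>)\<^sup>2)"
    and m0: "expectation (eps 0) = 0" and v0: "variance (eps 0) = 1"
    using iid by (auto simp: iid_standardized_def)
  have "expectation (\<lambda>\<omega>. (eps 0 \<omega>)\<^sup>2) = 1" using v0 by (simp add: m0)
  moreover have "integrable M (\<lambda>\<omega>. (eps t \<omega>)\<^sup>2) \<longleftrightarrow> integrable M (\<lambda>\<omega>. (eps 0 \<omega>)\<^sup>2)"
    using integrable_distr_eq[of "eps t" M borel "\<lambda>z. z\<^sup>2"] integrable_distr_eq[of "eps 0" M borel "\<lambda>z. z\<^sup>2"] distr
    by (simp add: meas)
  moreover have "expectation (\<lambda>\<omega>. (eps t \<omega>)\<^sup>2) = expectation (\<lambda>\<omega>. (eps 0 \<omega>)\<^sup>2)"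
    using integral_distr[of "eps t" M borel "\<lambda>z. z\<^sup>2"] integral_distr[of "eps 0" M borel "\<lambda>z. z\<^sup>2"] distr
    by (simp add: meas)
  ultimately show "integrable M (\<lambda>\<omega>. (eps t \<omega>)\<^sup>2)" "expectation (\<lambda>\<omega>. (eps t \<omega>)\<^sup>2) = 1"
    using int0 by simp_all
qed

text \<open>
  The top Lyapunov exponent is an infimum, so if it is negative then already some finite product has
  negative expected logarithm.
\<close>

lemma (in prob_space) BP_product_contracts_in_mean:
  assumes iid: "iid_standardized M eps" and "BP_nonneg p q u" and "0 < u (p + 1)"
    and lyap: "top_lyapunov p q u M eps < 0"
  defines "P \<equiv> \<lambda>n \<omega>. op_norm (BP_product p q u (\<lambda>t. eps t \<omega>) n)"
  shows "\<And>n. integrable M (P n)"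
    and "\<exists>N s. 0 < s \<and> s \<le> 1 \<and> expectation (\<lambda>\<omega>. P N \<omega> powr s) < 1"
proof -
  interpret BP_nonneg p q u by fact
  note iid_standardized_moments[OF iid]
  note [measurable] = this(2)
  have P_meas[measurable]: "P n \<in> borel_measurable M" for n
    unfolding P_def by (intro op_norm_BP_product_measurable) measurable
  show P_int: "integrable M (P n)" for n
  proof (rule Bochner_Integration.integrable_bound)
    have "disjoint_family_on (\<lambda>k. {- int k}) {..n}"
      by (auto simp: disjoint_family_on_def)
    from indep_vars_restrict[OF \<open>indep_vars (\<lambda>_. borel) eps UNIV\<close> _ this]
    have "indep_vars (\<lambda>j. PiM {- int j} (\<lambda>_. borel)) (\<lambda>j \<omega>. restrict (\<lambda>t. eps t \<omega>) {- int j}) {..n}"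
      by simp
    then have "indep_vars (\<lambda>_. borel)
        (\<lambda>j \<omega>. (\<lambda>y. growth_const * (1 + (y (- int j))\<^sup>2)) (restrict (\<lambda>t. eps t \<omega>) {- int j})) {..n}"
    proof (rule indep_vars_compose2)
      fix j
      have [measurable]: "(\<lambda>y. y (- int j)) \<in> PiM {- int j} (\<lambda>_. borel) \<rightarrow>\<^sub>M (borel :: real measure)"
        by (intro measurable_component_singleton) simp
      show "(\<lambda>y. growth_const * (1 + (y (- int j))\<^sup>2)) \<in> PiM {- int j} (\<lambda>_. borel) \<rightarrow>\<^sub>M borel"
        by measurable
    qed
    then show "integrable M (\<lambda>\<omega>. \<Prod>k\<le>n. growth_const * (1 + (eps (- int k) \<omega>)\<^sup>2))"
      by (intro indep_vars_integrable) (auto intro: iid_standardized_moments[OF iid])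
    show "AE \<omega> in M. norm (P n \<omega>) \<le> norm (\<Prod>k\<le>n. growth_const * (1 + (eps (- int k) \<omega>)\<^sup>2))"
    proof (rule AE_I2)
      fix \<omega>
      have "P n \<omega> \<le> (\<Prod>k\<le>n. growth_const * (1 + (eps (- int k) \<omega>)\<^sup>2))"
        unfolding P_def by (rule op_norm_BP_product_le_prod)
      then show "norm (P n \<omega>) \<le> norm (\<Prod>k\<le>n. growth_const * (1 + (eps (- int k) \<omega>)\<^sup>2))"
        using op_norm_BP_product_nonneg[of "\<lambda>t. eps t \<omega>" n] by (simp add: P_def)
    qed
  qed simp
  obtain N where N: "ereal (1 / real (N + 1)) * ext_expectation M (\<lambda>\<omega>. ext_log (P N \<omega>)) < 0"
    using lyap unfolding top_lyapunov_def P_def by (auto simp: INF_less_iff)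
  define c where "c = u (p + 1) ^ Suc N"
  have c: "0 < c" "\<And>\<omega>. c \<le> P N \<omega>"
    unfolding c_def P_def using \<open>0 < u (p + 1)\<close> op_norm_BP_product_ge by (simp, blast)
  have P_pos: "0 < P N \<omega>" for \<omega> using c less_le_trans by blast
  have ln_int: "integrable M (\<lambda>\<omega>. ln (P N \<omega>))"
  proof (rule Bochner_Integration.integrable_bound)
    show "integrable M (\<lambda>\<omega>. \<bar>ln c\<bar> + P N \<omega>)" using P_int by simp
    show "AE \<omega> in M. norm (ln (P N \<omega>)) \<le> norm (\<bar>ln c\<bar> + P N \<omega>)"
    proof (rule AE_I2)
      fix \<omega>
      have "ln c \<le> ln (P N \<omega>)" using c P_pos by simp
      moreover have "ln (P N \<omega>) \<le> P N \<omega> - 1" by (intro ln_le_minus_one P_pos)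
      ultimately show "norm (ln (P N \<omega>)) \<le> norm (\<bar>ln c\<bar> + P N \<omega>)"
        using P_pos[of \<omega>] unfolding real_norm_def by linarith
    qed
  qed measurable
  have "ext_log (P N \<omega>) = ereal (ln (P N \<omega>))" for \<omega>
    using P_pos[of \<omega>] by (simp add: ext_log_def)
  with N have "ereal (1 / real (N + 1) * expectation (\<lambda>\<omega>. ln (P N \<omega>))) < 0"
    by (simp add: ext_expectation_eq_expectation[OF ln_int])
  then have "expectation (\<lambda>\<omega>. ln (P N \<omega>)) < 0"
    by (simp add: mult_less_0_iff divide_less_0_iff)
  from exists_powr_expectation_less_one[OF P_meas P_int c(1) c(2) this]
  show "\<exists>N s. 0 < s \<and> s \<le> 1 \<and> expectation (\<lambda>\<omega>. P N \<omega> powr s) < 1" by blast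
qed

text \<open>
  The recursion is applied to the \<open>s\<close>-th powers of the norms of the states at times \<open>0, -L, -2 L, \<dots>\<close>,
  where \<open>L = N + 1\<close> is the length of a block whose matrix product contracts in \<open>s\<close>-th mean. The moment of
  the state passes to \<open>X\<^sub>0\<close> through \<open>\<alpha>\<^sub>1 X\<^sub>0\<^sup>2 \<le> \<sigma>\<^sub>1\<^sup>2\<close>: for \<open>p = 1\<close> the squares of \<open>X\<close> are not part of
  the state.
\<close>

lemma (in prob_space) stationary_garch_power_moment:
  assumes iid: "iid_standardized M eps" and pq: "1 \<le> p" "1 \<le> q"
    and u: "\<And>k. k \<le> p + q \<Longrightarrow> 0 \<le> u k" "0 < u 1" "0 < u (p + 1)"
    and lyap: "top_lyapunov p q u M eps < 0"
    and garch: "stationary_garch p q u M eps X sig"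
  shows "\<exists>s C. 0 < s \<and> s \<le> 1 \<and> 0 \<le> C \<and> (\<forall>t. (\<integral>\<^sup>+ \<omega>. ennreal (((X t \<omega>)\<^sup>2) powr s) \<partial>M) \<le> ennreal C)"
proof -
  interpret BP_nonneg p q u using pq u by unfold_locales
  note eps = iid_standardized_moments[OF iid]
  note [measurable] = eps(2) stationary_garch_measurable[OF garch]
  note contract = BP_product_contracts_in_mean[OF iid BP_nonneg_axioms u(3) lyap]
  obtain N s where s: "0 < s" "s \<le> 1"
    and less1: "expectation (\<lambda>\<omega>. op_norm (BP_product p q u (\<lambda>t. eps t \<omega>) N) powr s) < 1"
    using contract(2) by blast
  define block where "block = (\<lambda>(k :: nat) \<omega>. \<lambda>j\<in>{..N}. eps (- int (k * Suc N) - int j) \<omega>)"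
  let ?Pi = "PiM {..N} (\<lambda>_. borel) :: (nat \<Rightarrow> real) measure"
  have blocks: "indep_vars (\<lambda>_. ?Pi) block UNIV" "distr M ?Pi (block k) = distr M ?Pi (block 0)" for k
    unfolding block_def by (rule iid_blocks[OF eps(1) eps(3)])+
  have block_meas: "block k \<in> M \<rightarrow>\<^sub>M ?Pi" for k
    using blocks(1) by (simp add: indep_vars_def)
  define P where "P n y = op_norm (BP_product p q u (\<lambda>t. y (nat (- t))) n)" for n and y :: "nat \<Rightarrow> real"
  have P_meas: "P n \<in> borel_measurable ?Pi" if "n \<le> N" for n
    unfolding P_def by (intro op_norm_BP_product_measurable measurable_component_singleton) (use that in auto)
  have P_block: "P n (block k \<omega>) = op_norm (BP_product p q u (\<lambda>t. eps (- int (k * Suc N) + t) \<omega>) n)"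
    if "n \<le> N" for n k \<omega>
    unfolding P_def using that by (intro arg_cong[where f = op_norm] BP_product_cong) (auto simp: block_def)
  have P0: "0 \<le> P n y" for n y unfolding P_def by (rule op_norm_BP_product_nonneg)
  define h where "h y = u 0 * (1 + (\<Sum>n<N. P n y))" for y
  have h0: "0 \<le> h y" for y unfolding h_def using u(1)[of 0] P0 by (auto intro!: mult_nonneg_nonneg add_nonneg_nonneg sum_nonneg)
  have h_meas: "h \<in> borel_measurable ?Pi"
    unfolding h_def using P_meas by (intro borel_measurable_times borel_measurable_add borel_measurable_sum) auto
  define G where "G k \<omega> = P N (block k \<omega>) powr s" for k \<omega>
  define H where "H k \<omega> = h (block k \<omega>) powr s" for k \<omega>
  define z where "z k \<omega> = max_norm d (garch_state q (\<lambda>t. X t \<omega>) (\<lambda>t. sig t \<omega>) (- int (k * Suc N))) powr s" for k \<omega>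
  have PN_meas: "P N \<in> borel_measurable ?Pi" by (rule P_meas) simp
  have "(\<integral>\<^sup>+ \<omega>. ennreal (z 0 \<omega>) \<partial>M) < \<infinity>"
  proof (rule stochastic_recursion_moment[where G = G and H = H])
    show "z m \<in> borel_measurable M" for m
    proof -
      have "(\<lambda>\<omega>. max_norm d (garch_state q (\<lambda>t. X t \<omega>) (\<lambda>t. sig t \<omega>) (- int (m * Suc N)))) \<in> borel_measurable M"
        by (intro max_norm_measurable d_pos) (simp add: garch_state_def)
      then show ?thesis unfolding z_def by measurable
    qed
    have "(\<lambda>y. (P N y powr s, h y powr s)) \<in> ?Pi \<rightarrow>\<^sub>M borel \<Otimes>\<^sub>M borel"
      using PN_meas h_meas by measurable
    then have "indep_vars (\<lambda>_. borel \<Otimes>\<^sub>M borel) (\<lambda>m \<omega>. (\<lambda>y. (P N y powr s, h y powr s)) (block m \<omega>)) UNIV"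
      by (intro indep_vars_compose2[OF blocks(1)])
    then show "indep_vars (\<lambda>_. borel \<Otimes>\<^sub>M borel) (\<lambda>m \<omega>. (G m \<omega>, H m \<omega>)) UNIV"
      by (simp add: G_def H_def)
    show "AE \<omega> in M. z m \<omega> \<le> G m \<omega> * z (Suc m) \<omega> + H m \<omega>" for m
      using stationary_garch_AE_path[OF garch]
    proof eventually_elim
      case (elim \<omega>)
      let ?t = "- int (m * Suc N)" and ?Y = "\<lambda>t. max_norm d (garch_state q (\<lambda>t. X t \<omega>) (\<lambda>t. sig t \<omega>) t)"
      have "?Y ?t \<le> P N (block m \<omega>) * ?Y (?t - int (Suc N)) + h (block m \<omega>)"
        using max_norm_garch_state_iterate[OF garch_pathD(2,3)[OF elim], of ?t N]
        unfolding h_def by (simp add: P_block)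
      moreover have "?t - int (Suc N) = - int (Suc m * Suc N)" by simp
      ultimately have "?Y ?t \<le> P N (block m \<omega>) * ?Y (- int (Suc m * Suc N)) + h (block m \<omega>)" by metis
      then have "z m \<omega> \<le> (P N (block m \<omega>) * ?Y (- int (Suc m * Suc N)) + h (block m \<omega>)) powr s"
        unfolding z_def using s by (intro powr_mono2 max_norm_nonneg d_pos) auto
      also have "\<dots> \<le> (P N (block m \<omega>) * ?Y (- int (Suc m * Suc N))) powr s + h (block m \<omega>) powr s"
        using s by (intro powr_add_le mult_nonneg_nonneg P0 h0 max_norm_nonneg d_pos) auto
      also have "\<dots> = G m \<omega> * z (Suc m) \<omega> + H m \<omega>"
        unfolding G_def H_def z_def by (simp only: powr_mult)
      finally show ?case .
    qed
    show "(\<integral>\<^sup>+ \<omega>. ennreal (G m \<omega>) \<partial>M) \<le> ennreal (expectation (G 0))" for m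
    proof -
      have "integrable M (G 0)"
      proof (rule Bochner_Integration.integrable_bound)
        show "integrable M (\<lambda>\<omega>. 1 + P N (block 0 \<omega>))" using contract(1)[of N] by (simp add: P_block)
        show "G 0 \<in> borel_measurable M"
          unfolding G_def using measurable_compose[OF block_meas PN_meas] by measurable
        show "AE \<omega> in M. norm (G 0 \<omega>) \<le> norm (1 + P N (block 0 \<omega>))"
          using s P0 by (auto simp: G_def intro!: powr_le_one_plus AE_I2)
      qed
      have "(\<integral>\<^sup>+ \<omega>. ennreal (G m \<omega>) \<partial>M) = (\<integral>\<^sup>+ \<omega>. ennreal (G 0 \<omega>) \<partial>M)"
        unfolding G_def
        by (rule nn_integral_cong_distr[OF blocks(2) block_meas block_meas, where f = "\<lambda>y. ennreal (P N y powr s)"]) (use PN_meas in measurable)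
      also have "\<dots> = ennreal (expectation (G 0))"
        using \<open>integrable M (G 0)\<close> by (intro nn_integral_eq_integral) (auto simp: G_def[abs_def])
      finally show ?thesis by simp
    qed
    show "expectation (G 0) < 1" using less1 by (simp add: G_def[abs_def] P_block)
    show "(\<integral>\<^sup>+ \<omega>. ennreal (H m \<omega>) \<partial>M) \<le> ennreal (expectation (\<lambda>\<omega>. 1 + h (block 0 \<omega>)))" for m
    proof -
      have "integrable M (\<lambda>\<omega>. h (block 0 \<omega>))"
        unfolding h_def using contract(1) by (simp add: P_block)
      have "(\<integral>\<^sup>+ \<omega>. ennreal (H m \<omega>) \<partial>M) = (\<integral>\<^sup>+ \<omega>. ennreal (H 0 \<omega>) \<partial>M)"
        unfolding H_def
        by (rule nn_integral_cong_distr[OF blocks(2) block_meas block_meas, where f = "\<lambda>y. ennreal (h y powr s)"]) (use h_meas in measurable)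
      also have "\<dots> \<le> (\<integral>\<^sup>+ \<omega>. ennreal (1 + h (block 0 \<omega>)) \<partial>M)"
        unfolding H_def using h0 s by (intro nn_integral_mono ennreal_leI powr_le_one_plus) auto
      also have "\<dots> = ennreal (expectation (\<lambda>\<omega>. 1 + h (block 0 \<omega>)))"
        using \<open>integrable M (\<lambda>\<omega>. h (block 0 \<omega>))\<close> h0 by (intro nn_integral_eq_integral) auto
      finally show ?thesis .
    qed
    show "0 \<le> expectation (\<lambda>\<omega>. 1 + h (block 0 \<omega>))"
      using h0 by (intro integral_nonneg_AE) auto
    show "\<exists>B. \<forall>m. prob {\<omega> \<in> space M. B < z m \<omega>} < e" if e: "0 < e" for e
    proof -
      obtain B where B: "0 \<le> B" "\<And>t. prob {\<omega> \<in> space M.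
          B < max_norm d (garch_state q (\<lambda>t. X t \<omega>) (\<lambda>t. sig t \<omega>) t)} < e"
        using stationary_garch_state_tight[OF garch BP_nonneg_axioms e] by blast
      have "prob {\<omega> \<in> space M. B powr s < z m \<omega>} < e" for m
      proof (rule le_less_trans[OF finite_measure_mono B(2)[of "- int (m * Suc N)"]])
        show "{\<omega> \<in> space M. B powr s < z m \<omega>} \<subseteq> {\<omega> \<in> space M.
            B < max_norm d (garch_state q (\<lambda>t. X t \<omega>) (\<lambda>t. sig t \<omega>) (- int (m * Suc N)))}"
          unfolding z_def using B(1) s max_norm_nonneg[OF d_pos] powr_mono2[of s _ B]
          by (auto simp: not_le[symmetric] simp del: of_nat_mult of_nat_Suc)
        have "(\<lambda>\<omega>. max_norm d (garch_state q (\<lambda>t. X t \<omega>) (\<lambda>t. sig t \<omega>) (- int (m * Suc N)))) \<in> borel_measurable M"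
          by (intro max_norm_measurable d_pos) (simp add: garch_state_def)
        then show "{\<omega> \<in> space M.
            B < max_norm d (garch_state q (\<lambda>t. X t \<omega>) (\<lambda>t. sig t \<omega>) (- int (m * Suc N)))} \<in> events"
          by measurable
      qed
      then show ?thesis by blast
    qed
    show "0 \<le> expectation (G 0)"
      by (intro integral_nonneg_AE) (simp add: G_def)
  qed (simp_all add: z_def G_def H_def)
  then obtain C0 where C0: "(\<integral>\<^sup>+ \<omega>. ennreal (z 0 \<omega>) \<partial>M) = ennreal C0" "0 \<le> C0"
    by (cases "\<integral>\<^sup>+ \<omega>. ennreal (z 0 \<omega>) \<partial>M") auto
  have X_le: "AE \<omega> in M. ennreal (((X 0 \<omega>)\<^sup>2) powr s) \<le> ennreal ((1 / u 1) powr s) * ennreal (z 0 \<omega>)"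
    using stationary_garch_AE_path[OF garch]
  proof eventually_elim
    case (elim \<omega>)
    define Y where "Y = max_norm d (garch_state q (\<lambda>t. X t \<omega>) (\<lambda>t. sig t \<omega>) 0)"
    have "u 1 * (X 0 \<omega>)\<^sup>2 = u 1 * (X (1 - int 1) \<omega>)\<^sup>2" by simp
    also have "\<dots> \<le> (\<Sum>i=1..p. u i * (X (1 - int i) \<omega>)\<^sup>2)"
      using pq u(1) by (intro member_le_sum[of 1]) auto
    also have "\<dots> \<le> u 0 + (\<Sum>i=1..p. u i * (X (1 - int i) \<omega>)\<^sup>2) + (\<Sum>j=1..q. u (p + j) * (sig (1 - int j) \<omega>)\<^sup>2)"
      using sum_nonneg[of "{1..q}" "\<lambda>j. u (p + j) * (sig (1 - int j) \<omega>)\<^sup>2"] u(1)[of 0] u(1)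
      by (simp add: u(1))
    also have "\<dots> = (sig 1 \<omega>)\<^sup>2"
      using garch_pathD(3)[OF elim, of 1] by (rule sym)
    also have "\<dots> \<le> max_norm d (garch_state q (\<lambda>t. X t \<omega>) (\<lambda>t. sig t \<omega>) 0)"
      using abs_le_max_norm[OF d_pos, of "garch_state q (\<lambda>t. X t \<omega>) (\<lambda>t. sig t \<omega>) 0"] pq
      by (simp add: garch_state_def)
    finally have "u 1 * (X 0 \<omega>)\<^sup>2 \<le> Y" unfolding Y_def .
    then have le: "(X 0 \<omega>)\<^sup>2 \<le> 1 / u 1 * Y"
      using u(2) by (simp add: pos_le_divide_eq mult.commute)
    have "((X 0 \<omega>)\<^sup>2) powr s \<le> (1 / u 1 * Y) powr s"
      by (rule powr_mono2[OF _ _ le]) (use s in simp_all)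
    moreover have "(1 / u 1 * Y) powr s = (1 / u 1) powr s * z 0 \<omega>"
      unfolding z_def Y_def by (simp only: powr_mult of_nat_0 mult_zero_left minus_zero)
    ultimately have "((X 0 \<omega>)\<^sup>2) powr s \<le> (1 / u 1) powr s * z 0 \<omega>"
      by (simp only:)
    then have "ennreal (((X 0 \<omega>)\<^sup>2) powr s) \<le> ennreal ((1 / u 1) powr s * z 0 \<omega>)"
      by (rule ennreal_leI)
    then show ?case by (simp only: ennreal_mult'[OF powr_ge_zero])
  qed
  have z0_meas: "z 0 \<in> borel_measurable M"
  proof -
    have "(\<lambda>\<omega>. max_norm d (garch_state q (\<lambda>t. X t \<omega>) (\<lambda>t. sig t \<omega>) 0)) \<in> borel_measurable M"
      by (intro max_norm_measurable d_pos) (simp add: garch_state_def)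
    then show ?thesis unfolding z_def by simp
  qed
  have "(\<integral>\<^sup>+ \<omega>. ennreal (((X t \<omega>)\<^sup>2) powr s) \<partial>M) \<le> ennreal ((1 / u 1) powr s * C0)" for t
  proof -
    have m: "(\<lambda>z :: real. z\<^sup>2 powr s) \<in> borel_measurable borel" by measurable
    have X_meas: "(\<lambda>\<omega>. (X t \<omega>)\<^sup>2 powr s) \<in> borel_measurable M" for t
      by (rule measurable_compose[OF stationary_garch_measurable(1)[OF garch] m])
    have "(\<integral>\<^sup>+ \<omega>. ennreal (((X t \<omega>)\<^sup>2) powr s) \<partial>M) = (\<integral>\<^sup>+ \<omega>. ennreal (((X 0 \<omega>)\<^sup>2) powr s) \<partial>M)"
      by (rule nn_integral_cong_distr[OF stationary_garch_distr(1)[OF garch m] X_meas X_meas measurable_ennreal])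
    also have "\<dots> \<le> (\<integral>\<^sup>+ \<omega>. ennreal ((1 / u 1) powr s) * ennreal (z 0 \<omega>) \<partial>M)"
      by (rule nn_integral_mono_AE[OF X_le])
    also have "\<dots> = ennreal ((1 / u 1) powr s * C0)"
      using z0_meas C0 by (subst nn_integral_cmult) (simp_all add: ennreal_mult)
    finally show ?thesis .
  qed
  then show ?thesis using s C0(2) by (intro exI[of _ s] exI[of _ "(1 / u 1) powr s * C0"]) auto
qed

section \<open>The error of the residuals\<close>

lemma kernel_estimator_lipschitz:
  assumes lip: "\<And>x y. \<bar>K x - K y\<bar> \<le> C * \<bar>x - y\<bar>" and "0 < h"
  shows "\<bar>kernel_estimator K h n y x - kernel_estimator K h n z x\<bar> \<le> C / (real n * h\<^sup>2) * (\<Sum>t=1..n. \<bar>y t - z t\<bar>)"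
proof -
  have "\<bar>kernel_estimator K h n y x - kernel_estimator K h n z x\<bar>
      = 1 / (real n * h) * \<bar>\<Sum>t=1..n. K ((x - y t) / h) - K ((x - z t) / h)\<bar>"
    using \<open>0 < h\<close> by (simp add: kernel_estimator_def right_diff_distrib[symmetric] sum_subtractf abs_mult diff_divide_distrib[symmetric])
  also have "\<dots> \<le> 1 / (real n * h) * (\<Sum>t=1..n. C / h * \<bar>y t - z t\<bar>)"
  proof (intro mult_left_mono order_trans[OF sum_abs] sum_mono)
    fix t
    have "\<bar>(x - y t) / h - (x - z t) / h\<bar> = \<bar>y t - z t\<bar> / h"
      using \<open>0 < h\<close> by (simp add: diff_divide_distrib[symmetric] abs_minus_commute)
    then show "\<bar>K ((x - y t) / h) - K ((x - z t) / h)\<bar> \<le> C / h * \<bar>y t - z t\<bar>"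
      using lip[of "(x - y t) / h" "(x - z t) / h"] by simp
  qed (use \<open>0 < h\<close> in simp)
  also have "\<dots> = C / (real n * h\<^sup>2) * (\<Sum>t=1..n. \<bar>y t - z t\<bar>)"
    unfolding sum_distrib_left[symmetric] by (simp add: power2_eq_square)
  finally show ?thesis .
qed

text \<open>
  Truncating the expansion amounts to prescribing wrong starting values for the recursion of the
  variance; their effect solves the homogeneous recursion and fades at a geometric rate.
\<close>

lemma garch_path_trunc_var_decay:
  assumes path: "garch_path p q u e x s"
    and u: "\<And>k. k \<le> p + q \<Longrightarrow> 0 \<le> u k" and B: "(\<Sum>j=1..q. u (p + j)) \<le> r ^ q" "(\<Sum>j=1..q. u (p + j)) < 1"
    and r: "0 < r" "r \<le> 1"
  shows "\<bar>(s (int t))\<^sup>2 - trunc_var p q u x t\<bar>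
    \<le> (\<Sum>k<p + q. \<bar>(s (int k))\<^sup>2 - trunc_var p q u x k\<bar>) / r ^ (p + q) * r ^ t"
proof (rule linear_recursion_geometric_decay[where b = "\<lambda>j. u (p + j)" and q = q])
  fix t assume t: "p + q \<le> t"
  have "(s (int t))\<^sup>2 - trunc_var p q u x t
      = (\<Sum>j=1..q. u (p + j) * (s (int t - int j))\<^sup>2) - (\<Sum>j=1..q. u (p + j) * trunc_var p q u x (t - j))"
    using garch_pathD(3)[OF path, of "int t"] trunc_var_recursion[OF t, of u x] B by simp
  also have "\<dots> = (\<Sum>j=1..q. u (p + j) * ((s (int (t - j)))\<^sup>2 - trunc_var p q u x (t - j)))"
    unfolding sum_subtractf[symmetric] right_diff_distrib
    using t by (intro sum.cong refl) (simp add: of_nat_diff)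
  finally show "(s (int t))\<^sup>2 - trunc_var p q u x t
      = (\<Sum>j=1..q. u (p + j) * ((s (int (t - j)))\<^sup>2 - trunc_var p q u x (t - j)))" .
qed (use u B r in auto)

text \<open>
  With \<open>S\<^sup>2\<close> the estimated variance, \<open>|\<sigma> - S| / S \<le> |\<sigma>\<^sup>2 - S\<^sup>2| / S\<^sup>2\<close> because \<open>\<sigma> + S \<ge> S\<close>.
\<close>

lemma abs_residual_diff_le:
  assumes path: "garch_path p q u e x s" and pos: "0 < trunc_var p q v x t"
  shows "\<bar>residual p q v x t - e (int t)\<bar>
    \<le> \<bar>e (int t)\<bar> * (\<bar>(s (int t))\<^sup>2 - trunc_var p q v x t\<bar> / trunc_var p q v x t)"
proof -
  define S where "S = sqrt (trunc_var p q v x t)"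
  have S: "0 < S" "trunc_var p q v x t = S\<^sup>2" using pos by (simp_all add: S_def)
  have s0: "0 \<le> s (int t)" by (rule garch_pathD(1)[OF path])
  have "residual p q v x t - e (int t) = e (int t) * ((s (int t) - S) / S)"
    using S garch_pathD(2)[OF path, of "int t"]
    by (simp add: residual_def vol_hat_trunc_var S_def[symmetric] field_simps)
  moreover have "\<bar>(s (int t) - S) / S\<bar> \<le> \<bar>(s (int t))\<^sup>2 - S\<^sup>2\<bar> / S\<^sup>2"
  proof -
    have "\<bar>s (int t) - S\<bar> * S \<le> \<bar>s (int t) - S\<bar> * (s (int t) + S)"
      using s0 by (intro mult_left_mono) auto
    also have "\<dots> = \<bar>(s (int t))\<^sup>2 - S\<^sup>2\<bar>"
    proof -
      have "(s (int t))\<^sup>2 - S\<^sup>2 = (s (int t) - S) * (s (int t) + S)"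
        by (simp add: power2_eq_square algebra_simps)
      then show ?thesis using s0 S(1) by (simp add: abs_mult)
    qed
    finally show ?thesis using S(1) by (simp add: abs_divide divide_simps power2_eq_square)
  qed
  ultimately show ?thesis
    unfolding S(2) by (simp only: abs_mult) (intro mult_left_mono, auto)
qed

lemma sum_abs_residual_diff_le:
  assumes path: "garch_path p q u e x s"
    and u: "\<And>k. k \<le> p + q \<Longrightarrow> 0 \<le> u k" "0 < u 0" and eta: "0 \<le> \<eta>" "\<eta> \<le> 1" and "\<rho> < 1"
    and vu: "\<And>k. k \<le> p + q \<Longrightarrow> v k \<le> (1 + \<eta>) * u k"
    and uv: "\<And>k. k \<le> p + q \<Longrightarrow> u k \<le> (1 + \<eta>) * v k"
    and Bu: "(\<Sum>j=1..q. u (p + j)) \<le> \<rho>" and Bv: "(\<Sum>j=1..q. v (p + j)) \<le> \<rho>"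
    and C: "\<And>i. garch_coeff p q u i \<le> C * r ^ i" and "0 < C" "0 < r"
    and a: "0 < a" "a \<le> 1" and mu: "1 + \<eta> \<le> \<mu>"
    and W: "\<And>t. \<bar>(s (int t))\<^sup>2 - trunc_var p q u x t\<bar> \<le> W * r ^ t" and "0 \<le> W"
  shows "(\<Sum>t=1..n. \<bar>residual p q v x t - e (int t)\<bar>)
    \<le> 2 * W / u 0 * (\<Sum>t=1..n. r ^ t * \<bar>e (int t)\<bar>)
      + \<eta> * (\<Sum>t=1..n. \<bar>e (int t)\<bar> * (4 / (1 - \<rho>)\<^sup>2 + (\<Sum>i=1..t. (2 * C / u 0) powr a *
             (real i * (\<mu>\<^sup>2 * r powr a) ^ i) * ((x (int t - int i))\<^sup>2) powr a)))"
proof -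
  define R where "R t = 4 / (1 - \<rho>)\<^sup>2 + (\<Sum>i=1..t. (2 * C / u 0) powr a *
             (real i * (\<mu>\<^sup>2 * r powr a) ^ i) * ((x (int t - int i))\<^sup>2) powr a)" for t
  have "\<bar>residual p q v x t - e (int t)\<bar> \<le> 2 * W / u 0 * (r ^ t * \<bar>e (int t)\<bar>) + \<eta> * (\<bar>e (int t)\<bar> * R t)" for t
  proof -
    define S where "S = trunc_var p q v x t"
    note pert = trunc_var_perturb[OF u eta \<open>\<rho> < 1\<close> vu uv Bu Bv C \<open>0 < C\<close> \<open>0 < r\<close> a mu, of x t, folded R_def S_def]
    have S: "u 0 / 2 \<le> S" "0 < S" using pert(1) u(2) by auto
    have "\<bar>(s (int t))\<^sup>2 - S\<bar> \<le> W * r ^ t + \<eta> * S * R t"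
      using W[of t] pert(2) by linarith
    then have "\<bar>(s (int t))\<^sup>2 - S\<bar> / S \<le> (W * r ^ t + \<eta> * S * R t) / S"
      using S by (intro divide_right_mono) auto
    also have "\<dots> = W * r ^ t / S + \<eta> * R t"
      using S by (simp add: add_divide_distrib)
    also have "W * r ^ t / S \<le> W * r ^ t / (u 0 / 2)"
      using S u(2) \<open>0 \<le> W\<close> \<open>0 < r\<close> by (intro divide_left_mono mult_nonneg_nonneg) auto
    finally have "\<bar>(s (int t))\<^sup>2 - S\<bar> / S \<le> W * r ^ t / (u 0 / 2) + \<eta> * R t" by simp
    then have "\<bar>e (int t)\<bar> * (\<bar>(s (int t))\<^sup>2 - S\<bar> / S) \<le> \<bar>e (int t)\<bar> * (W * r ^ t / (u 0 / 2) + \<eta> * R t)"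
      by (intro mult_left_mono) auto
    also have "\<dots> = 2 * W / u 0 * (r ^ t * \<bar>e (int t)\<bar>) + \<eta> * (\<bar>e (int t)\<bar> * R t)"
      by (simp add: algebra_simps)
    finally show ?thesis
      using abs_residual_diff_le[OF path, of v t] S(2) unfolding S_def by linarith
  qed
  then have "(\<Sum>t=1..n. \<bar>residual p q v x t - e (int t)\<bar>)
      \<le> (\<Sum>t=1..n. 2 * W / u 0 * (r ^ t * \<bar>e (int t)\<bar>) + \<eta> * (\<bar>e (int t)\<bar> * R t))"
    by (intro sum_mono)
  then show ?thesis
    unfolding R_def[symmetric] by (simp add: sum.distrib sum_distrib_left)
qed

text \<open>
  A deviation that is small compared with a lower bound of the parameter is a small relative deviation in
  both directions; the factor \<open>1 / 2\<close> pays for the second direction.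
\<close>

lemma relative_closeness:
  assumes "l \<le> u" "\<bar>v - u\<bar> \<le> \<eta> * l / 2" "0 \<le> \<eta>" "\<eta> \<le> 1" "0 < (l :: real)"
  shows "v \<le> (1 + \<eta>) * u" "u \<le> (1 + \<eta>) * v"
proof -
  have le: "\<eta> * l / 2 \<le> \<eta> * u / 2" using assms by (intro divide_right_mono mult_left_mono) auto
  have "0 \<le> \<eta> * u" using assms by simp
  then show "v \<le> (1 + \<eta>) * u" using assms(2) le unfolding distrib_right mult_1 by linarith
  have "u * (1 - \<eta> / 2) = u - \<eta> * u / 2" by (simp add: algebra_simps)
  then have "u * (1 - \<eta> / 2) \<le> v" using assms(2) le by linarith
  then have "(1 + \<eta>) * (u * (1 - \<eta> / 2)) \<le> (1 + \<eta>) * v"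
    using assms by (intro mult_left_mono) auto
  moreover have "u \<le> (1 + \<eta>) * (u * (1 - \<eta> / 2))"
  proof -
    have "(1 + \<eta>) * (u * (1 - \<eta> / 2)) - u = u * (\<eta> * (1 - \<eta>) / 2)" by (simp add: algebra_simps)
    also have "\<dots> \<ge> 0" using assms by (intro mult_nonneg_nonneg divide_nonneg_pos) auto
    finally show ?thesis by simp
  qed
  ultimately show "u \<le> (1 + \<eta>) * v" by linarith
qed

lemma sum_nat_mult_power_le:
  fixes w :: real
  assumes "0 \<le> w" "w < 1"
  shows "(\<Sum>i=1..t. real i * w ^ i) \<le> 1 / (1 - w)\<^sup>2"
proof -
  have "(\<Sum>i=1..t. real i * w ^ i) \<le> (\<Sum>i=1..t. real i * w ^ (i - 1))"
    using assms by (intro sum_mono mult_left_mono power_decreasing) auto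
  also have "\<dots> = (\<Sum>k<t. of_nat (Suc k) * w ^ k)"
    by (rule sum.reindex_bij_witness[of _ Suc "\<lambda>i. i - 1"]) auto
  also have "\<dots> \<le> (\<Sum>k. of_nat (Suc k) * w ^ k)"
    using assms geometric_deriv_sums[of w] by (intro sum_le_suminf) (auto simp: sums_iff simp del: of_nat_Suc)
  also have "\<dots> = 1 / (1 - w)\<^sup>2"
    using assms geometric_deriv_sums[of w] by (simp add: sums_iff)
  finally show ?thesis .
qed

lemma two_mult_le_sum_squares: "a * b \<le> a\<^sup>2 + (b :: real)\<^sup>2"
  using sum_squares_bound[of a b] zero_le_power2[of a] zero_le_power2[of b]
  unfolding mult.assoc by linarith

text \<open>
  The deterministic bound along one path. The first term collects the effect of the starting values and
  has a bounded sum in \<open>t\<close>; the second is the effect of the parameter, of the order of the estimation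
  error \<open>\<Delta>\<close> times \<open>n\<close>. The factor \<open>2 / l\<close> converts \<open>\<Delta>\<close> into the relative deviation \<open>\<eta>\<close>.
\<close>

lemma kernel_estimator_error_le:
  fixes u v :: "nat \<Rightarrow> real"
  assumes path: "garch_path p q u e x s"
    and u: "\<And>k. k \<le> p + q \<Longrightarrow> l \<le> u k" "0 < l" and B: "(\<Sum>j=1..q. u (p + j)) \<le> r ^ q" "r ^ q < 1"
    and eta0: "\<eta>0 \<le> 1" and rho: "\<rho> < 1" "(1 + \<eta>0) * r ^ q \<le> \<rho>" "r ^ q \<le> \<rho>"
    and C: "\<And>i. garch_coeff p q u i \<le> C * r ^ i" "0 < C" and r: "0 < r" "r \<le> 1"
    and a: "0 < a" "a \<le> 1"
    and K: "\<And>y z. \<bar>K y - K z\<bar> \<le> CK * \<bar>y - z\<bar>" "0 \<le> CK" and h: "0 < h"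
  defines "\<Delta> \<equiv> max_norm (p + q + 1) (\<lambda>i. v i - u i)"
  assumes close: "\<Delta> \<le> \<eta>0 * l / 2"
  shows "\<bar>kernel_estimator K h n (residual p q v x) y - kernel_estimator K h n (\<lambda>t. e (int t)) y\<bar>
    \<le> CK / (real n * h\<^sup>2) *
        (2 * ((\<Sum>k<p + q. \<bar>(s (int k))\<^sup>2 - trunc_var p q u x k\<bar>) / r ^ (p + q)) / u 0
           * (\<Sum>t=1..n. r ^ t * \<bar>e (int t)\<bar>)
         + 2 / l * \<Delta> * (\<Sum>t=1..n. \<bar>e (int t)\<bar> * (4 / (1 - \<rho>)\<^sup>2 + (\<Sum>i=1..t. (2 * C / u 0) powr a *
             (real i * ((1 + \<eta>0)\<^sup>2 * r powr a) ^ i) * ((x (int t - int i))\<^sup>2) powr a))))"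
proof -
  define \<eta> where "\<eta> = 2 / l * \<Delta>"
  have D0: "0 \<le> \<Delta>" unfolding \<Delta>_def by (rule max_norm_nonneg) simp
  have eta: "0 \<le> \<eta>" unfolding \<eta>_def using D0 u(2) by (intro mult_nonneg_nonneg divide_nonneg_pos) auto
  have "\<eta> \<le> 2 / l * (\<eta>0 * l / 2)"
    unfolding \<eta>_def using u(2) by (intro mult_left_mono close) simp
  also have "2 / l * (\<eta>0 * l / 2) = \<eta>0" using u(2) by simp
  finally have eta_le: "\<eta> \<le> \<eta>0" .
  then have eta1: "\<eta> \<le> 1" using eta0 by (rule order_trans)
  have half: "\<eta> * l / 2 = \<Delta>" using u(2) by (simp add: \<eta>_def)
  have dev: "\<bar>v k - u k\<bar> \<le> \<eta> * l / 2" if "k \<le> p + q" for k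
    unfolding half \<Delta>_def using that by (intro abs_le_max_norm[of k _ "\<lambda>i. v i - u i"]) simp
  note rel = relative_closeness[OF u(1) dev eta eta1 u(2)]
  have pos: "0 < u k" if "k \<le> p + q" for k using u(2) u(1)[OF that] by (rule less_le_trans)
  have nn: "0 \<le> u k" if "k \<le> p + q" for k using pos[OF that] by (rule less_imp_le)
  have "(\<Sum>j=1..q. v (p + j)) \<le> (\<Sum>j=1..q. (1 + \<eta>) * u (p + j))"
    by (intro sum_mono rel(1)) auto
  also have "\<dots> = (1 + \<eta>) * (\<Sum>j=1..q. u (p + j))" by (simp only: sum_distrib_left)
  also have "\<dots> \<le> (1 + \<eta>0) * r ^ q"
    using eta eta_le B(1) by (intro mult_mono sum_nonneg nn) auto
  finally have Bv: "(\<Sum>j=1..q. v (p + j)) \<le> \<rho>" using rho(2) by (rule order_trans)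
  define W where "W = (\<Sum>k<p + q. \<bar>(s (int k))\<^sup>2 - trunc_var p q u x k\<bar>) / r ^ (p + q)"
  have W: "\<bar>(s (int t))\<^sup>2 - trunc_var p q u x t\<bar> \<le> W * r ^ t" for t
    unfolding W_def by (rule garch_path_trunc_var_decay[OF path nn B(1) le_less_trans[OF B] r])
  have W0: "0 \<le> W" unfolding W_def using r by (intro divide_nonneg_nonneg sum_nonneg) auto
  have mu: "1 + \<eta> \<le> 1 + \<eta>0" using eta_le by simp
  note sum_le = sum_abs_residual_diff_le[OF path nn pos[of 0, simplified] eta eta1 rho(1) rel(1) rel(2) order_trans[OF B(1) rho(3)]
      Bv C r(1) a mu W W0, of n]
  have K0: "0 \<le> CK / (real n * h\<^sup>2)"
    using K(2) by (intro divide_nonneg_nonneg mult_nonneg_nonneg) simp_all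
  have "CK / (real n * h\<^sup>2) * (\<Sum>t=1..n. \<bar>residual p q v x t - e (int t)\<bar>)
     \<le> CK / (real n * h\<^sup>2) *
        (2 * W / u 0 * (\<Sum>t=1..n. r ^ t * \<bar>e (int t)\<bar>)
         + \<eta> * (\<Sum>t=1..n. \<bar>e (int t)\<bar> * (4 / (1 - \<rho>)\<^sup>2 + (\<Sum>i=1..t. (2 * C / u 0) powr a *
             (real i * ((1 + \<eta>0)\<^sup>2 * r powr a) ^ i) * ((x (int t - int i))\<^sup>2) powr a))))"
    by (rule mult_left_mono[OF sum_le]) (simp_all only: K0)
  from order_trans[OF kernel_estimator_lipschitz[OF K(1) h] this]
  show ?thesis unfolding W_def \<eta>_def .
qed

text \<open>
  Here \<open>r'\<close> stands for the decay rate of the terms of the variance and \<open>\<rho>\<close> for a bound on the sum of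
  the \<open>t\<^sub>j\<close>; both must stay below \<open>1\<close> after a relative perturbation \<open>\<eta>\<close> of the parameter. The constants come from \<open>(1 + \<eta>)\<^sup>2 \<le> 1 + 3 \<eta>\<close> for \<open>\<eta> \<le> 1\<close>.
\<close>

lemma exists_damping_margin:
  fixes r' \<rho> :: real
  assumes "0 < r'" "r' < 1" "0 < \<rho>" "\<rho> < 1"
  shows "\<exists>\<eta>>0. \<eta> \<le> 1 \<and> (1 + \<eta>)\<^sup>2 * r' < 1 \<and> (1 + \<eta>) * \<rho> \<le> (1 + \<rho>) / 2"
proof -
  define \<eta> where "\<eta> = min ((1 - \<rho>) / 2) ((1 - r') / 6)"
  have "0 < \<eta>" using assms by (simp add: \<eta>_def)
  have le: "\<eta> \<le> (1 - \<rho>) / 2" "\<eta> \<le> (1 - r') / 6"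
    unfolding \<eta>_def by (rule min.cobounded1, rule min.cobounded2)
  have eta: "0 < \<eta>" "\<eta> \<le> 1" "2 * \<eta> \<le> 1 - \<rho>" "6 * \<eta> \<le> 1 - r'"
    using le assms \<open>0 < \<eta>\<close> by simp_all
  have "\<eta> * \<eta> \<le> \<eta>" using eta by (simp add: mult_left_le)
  then have "(1 + \<eta>)\<^sup>2 \<le> 1 + 3 * \<eta>" by (simp add: power2_eq_square algebra_simps)
  then have "(1 + \<eta>)\<^sup>2 * r' \<le> (1 + 3 * \<eta>) * r'"
    using assms(1) by (intro mult_right_mono) simp_all
  also have "\<dots> = r' + 3 * (\<eta> * r')" by (simp add: algebra_simps)
  also have "\<dots> \<le> r' + 3 * \<eta>" using assms(2) eta(1) by (simp add: mult_left_le)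
  also have "\<dots> < 1" using eta(4) assms(2) by linarith
  finally have "(1 + \<eta>)\<^sup>2 * r' < 1" .
  moreover have "\<eta> * \<rho> \<le> \<eta>" using assms(4) eta(1) by (simp add: mult_left_le)
  then have "(1 + \<eta>) * \<rho> \<le> (1 + \<rho>) / 2" using eta(3) by (simp add: distrib_right)
  ultimately show ?thesis using eta by blast
qed

section \<open>Convergence in probability\<close>

text \<open>
  The probabilistic bookkeeping. Outside four events of probability at most \<open>\<delta> / 4\<close> each, the deviation
  is \<open>\<Delta>\<^sub>n \<le> B' / \<surd>n\<close>, the sum \<open>U\<^sub>n\<close> is of order \<open>n\<close>, and \<open>V\<^sub>n\<close> and \<open>Z\<close> are bounded. The bound on
  \<open>D\<^sub>n\<close> is then at most a constant divided by \<open>\<surd>n h\<^sub>n\<^sup>2\<close>, which tends to \<open>0\<close>. The set on which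
  the supremum is large enters only through this inclusion in a measurable set of small measure.
\<close>

lemma (in prob_space) null_in_prob_sup_of_bound:
  fixes D :: "nat \<Rightarrow> 'a \<Rightarrow> 'b \<Rightarrow> real" and U V :: "nat \<Rightarrow> 'a \<Rightarrow> real" and \<Delta> :: "nat \<Rightarrow> 'a \<Rightarrow> real"
    and Z :: "'a \<Rightarrow> real"
  assumes D: "\<And>n. AE \<omega> in M. \<Delta> n \<omega> \<le> thr \<longrightarrow>
       (\<forall>x. \<bar>D n \<omega> x\<bar> \<le> C / (real n * (h n)\<^sup>2) * (Z \<omega> * V n \<omega> + k * \<Delta> n \<omega> * U n \<omega>))"
    and "0 < thr" "0 \<le> C" "0 \<le> k"
    and delta: "bounded_in_prob M (\<lambda>n \<omega>. sqrt (real n) * \<Delta> n \<omega>)"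
    and nonneg: "\<And>n \<omega>. 0 \<le> \<Delta> n \<omega>" "\<And>n \<omega>. 0 \<le> V n \<omega>" "\<And>n \<omega>. 0 \<le> U n \<omega>"
    and [measurable]: "\<And>n. \<Delta> n \<in> borel_measurable M" "\<And>n. V n \<in> borel_measurable M"
      "\<And>n. U n \<in> borel_measurable M" "Z \<in> borel_measurable M"
    and EU: "\<And>n. (\<integral>\<^sup>+ \<omega>. ennreal (U n \<omega>) \<partial>M) \<le> ennreal (real n * cU)" and "0 < cU"
    and EV: "\<And>n. (\<integral>\<^sup>+ \<omega>. ennreal (V n \<omega>) \<partial>M) \<le> ennreal cV" and "0 < cV"
    and h: "\<And>n. h n > 0" "filterlim (\<lambda>n. sqrt (real n) * (h n)\<^sup>2) at_top sequentially"
  shows "null_in_prob M (\<lambda>n \<omega>. SUP x. ereal \<bar>D n \<omega> x\<bar>)"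
  unfolding null_in_prob_def
proof (intro allI impI)
  fix e :: real assume e: "0 < e"
  let ?E = "\<lambda>n. {\<omega> \<in> space M. \<bar>SUP x. ereal \<bar>D n \<omega> x\<bar>\<bar> > ereal e}"
  have small: "\<forall>\<^sub>F n in sequentially. prob (?E n) < \<delta>" if d: "0 < \<delta>" for \<delta>
  proof -
    obtain B where B: "\<forall>\<^sub>F n in sequentially. prob {\<omega> \<in> space M. B < \<bar>sqrt (real n) * \<Delta> n \<omega>\<bar>} < \<delta> / 4"
      using delta d unfolding bounded_in_prob_def by (meson divide_pos_pos zero_less_numeral)
    \<comment> \<open>\<open>B\<close> itself may be negative\<close>
    define B' where "B' = max B 1"
    obtain b where b: "0 \<le> b" "prob {\<omega> \<in> space M. b < Z \<omega>} < \<delta> / 4"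
      using tail_prob_small[of Z "\<delta> / 4"] d by auto
    \<comment> \<open>thresholds for which the Markov inequality gives the probability \<open>\<delta> / 4\<close>\<close>
    define LU where "LU = 4 * cU / \<delta>"
    define LV where "LV = 4 * cV / \<delta>"
    have L: "0 < LU" "0 < LV" using d \<open>0 < cU\<close> \<open>0 < cV\<close> by (simp_all add: LU_def LV_def)
    define A where "A = C * (b * LV + k * B' * LU)"
    have A: "0 \<le> A" using L b \<open>0 \<le> C\<close> \<open>0 \<le> k\<close> by (simp add: A_def B'_def)
    have "\<forall>\<^sub>F n in sequentially. A / e \<le> sqrt (real n) * (h n)\<^sup>2"
      using h(2) by (simp add: filterlim_at_top)
    moreover have "\<forall>\<^sub>F n in sequentially. (B' / thr)\<^sup>2 \<le> real n"
      using filterlim_real_sequentially by (simp add: filterlim_at_top)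
    ultimately show ?thesis
      using B eventually_ge_at_top[of 1]
    proof eventually_elim
      case (elim n)
      have n: "0 < real n" "0 < sqrt (real n)" using elim(4) by simp_all
      let ?G1 = "{\<omega> \<in> space M. B < \<bar>sqrt (real n) * \<Delta> n \<omega>\<bar>}" and ?G2 = "{\<omega> \<in> space M. b < Z \<omega>}"
        and ?G3 = "{\<omega> \<in> space M. real n * LU \<le> U n \<omega>}" and ?G4 = "{\<omega> \<in> space M. LV \<le> V n \<omega>}"
      have G3: "prob ?G3 \<le> \<delta> / 4"
      proof -
        have "prob ?G3 \<le> real n * cU / (real n * LU)"
          using n L \<open>0 < cU\<close> by (intro prob_ge_le_nn_integral EU) auto
        also have "\<dots> = \<delta> / 4" using n d \<open>0 < cU\<close> by (simp add: LU_def)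
        finally show ?thesis .
      qed
      have G4: "prob ?G4 \<le> \<delta> / 4"
      proof -
        have "prob ?G4 \<le> cV / LV"
          using L \<open>0 < cV\<close> by (intro prob_ge_le_nn_integral EV) auto
        also have "\<dots> = \<delta> / 4" using d \<open>0 < cV\<close> by (simp add: LV_def)
        finally show ?thesis .
      qed
      have "prob (?E n) \<le> prob (((?G1 \<union> ?G2) \<union> ?G3) \<union> ?G4)"
      proof (rule finite_measure_mono_AE)
        show "AE \<omega> in M. \<omega> \<in> ?E n \<longrightarrow> \<omega> \<in> ((?G1 \<union> ?G2) \<union> ?G3) \<union> ?G4"
          using D[of n]
        proof eventually_elim
          case D: (elim \<omega>)
          show ?case
          proof (rule impI, rule ccontr)
            assume w: "\<omega> \<in> ?E n" and "\<omega> \<notin> ((?G1 \<union> ?G2) \<union> ?G3) \<union> ?G4"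
            then have "\<bar>sqrt (real n) * \<Delta> n \<omega>\<bar> \<le> B" and Z: "Z \<omega> \<le> b"
              and U: "U n \<omega> \<le> real n * LU" and V: "V n \<omega> \<le> LV"
              by (auto simp: not_le not_less)
            then have dB: "\<Delta> n \<omega> \<le> B' / sqrt (real n)"
              using n nonneg(1)[of n \<omega>] by (simp add: B'_def pos_le_divide_eq mult.commute)
            have "B' / thr \<le> sqrt (real n)" by (rule real_le_rsqrt) (use elim(2) in simp)
            then have "B' / sqrt (real n) \<le> thr"
              using n \<open>0 < thr\<close> by (simp add: pos_divide_le_eq mult.commute)
            with dB have d0: "\<Delta> n \<omega> \<le> thr" by linarith
            have bound: "\<bar>D n \<omega> x\<bar> \<le> e" for x
            proof -
              have "Z \<omega> * V n \<omega> \<le> b * V n \<omega>"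
                using Z nonneg(2) by (intro mult_right_mono) auto
              also have "\<dots> \<le> b * LV" using V b by (intro mult_left_mono) auto
              also have "\<dots> \<le> sqrt (real n) * (b * LV)"
                using b L elim(4) mult_right_mono[of 1 "sqrt (real n)" "b * LV"] by simp
              finally have ZV: "Z \<omega> * V n \<omega> \<le> sqrt (real n) * (b * LV)" .
              have "k * \<Delta> n \<omega> * U n \<omega> \<le> k * (B' / sqrt (real n)) * (real n * LU)"
                using dB U nonneg \<open>0 \<le> k\<close> n L
                by (intro mult_mono mult_left_mono mult_nonneg_nonneg) (auto simp: B'_def)
              also have "\<dots> = sqrt (real n) * (k * B' * LU)"
                using n real_sqrt_mult_self[of "real n"] by (simp add: field_simps)
              finally have "Z \<omega> * V n \<omega> + k * \<Delta> n \<omega> * U n \<omega> \<le> sqrt (real n) * (b * LV + k * B' * LU)"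
                using ZV by (simp add: distrib_left)
              then have "C / (real n * (h n)\<^sup>2) * (Z \<omega> * V n \<omega> + k * \<Delta> n \<omega> * U n \<omega>)
                  \<le> C / (real n * (h n)\<^sup>2) * (sqrt (real n) * (b * LV + k * B' * LU))"
                using \<open>0 \<le> C\<close> by (intro mult_left_mono) auto
              also have "\<dots> = A / (sqrt (real n) * (h n)\<^sup>2)"
              proof -
                have "C / (y * y * H) * (y * Q) = C * Q / (y * H)" if "0 < y" for y H Q :: real
                  using that by (simp add: field_simps)
                from this[OF n(2)] show ?thesis by (simp add: A_def)
              qed
              also have "\<dots> \<le> e"
                using elim(1) e n h(1)[of n] by (simp add: pos_divide_le_eq mult.commute)
              finally show ?thesis using D d0 by (meson order_trans)
            qed
            have "(SUP x. ereal \<bar>D n \<omega> x\<bar>) \<le> ereal e"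
              by (intro SUP_least) (simp add: bound)
            moreover have "0 \<le> (SUP x. ereal \<bar>D n \<omega> x\<bar>)"
              by (rule SUP_upper2[of undefined]) auto
            ultimately have "\<not> ereal e < \<bar>SUP x. ereal \<bar>D n \<omega> x\<bar>\<bar>"
              by (simp only: abs_ereal_ge0 not_less)
            then show False using w by blast
          qed
        qed
      qed measurable
      also have "\<dots> \<le> prob ((?G1 \<union> ?G2) \<union> ?G3) + prob ?G4"
        by (rule measure_Un_le) measurable
      also have "prob ((?G1 \<union> ?G2) \<union> ?G3) \<le> prob (?G1 \<union> ?G2) + prob ?G3"
        by (rule measure_Un_le) measurable
      also have "prob (?G1 \<union> ?G2) \<le> prob ?G1 + prob ?G2"
        by (rule measure_Un_le) measurable
      finally have "prob (?E n) \<le> prob ?G1 + prob ?G2 + prob ?G3 + prob ?G4" by linarith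
      then show ?case using elim(3) b(2) G3 G4 by linarith
    qed
  qed
  show "(\<lambda>n. prob (?E n)) \<longlonglongrightarrow> 0"
  proof (rule order_tendstoI)
    fix a :: real assume "0 < a"
    then show "\<forall>\<^sub>F n in sequentially. prob (?E n) < a" by (rule small)
  next
    fix a :: real assume "a < 0"
    then show "\<forall>\<^sub>F n in sequentially. a < prob (?E n)"
      by (intro always_eventually allI) (rule less_le_trans[OF _ measure_nonneg])
  qed
qed

lemma estimator_deviation_measurable:
  assumes est: "estimator_seq p q M X est" and X: "\<And>t. X t \<in> borel_measurable M"
  shows "(\<lambda>\<omega>. max_norm (p + q + 1) (\<lambda>i. est n \<omega> i - u i)) \<in> borel_measurable M"
proof (rule max_norm_measurable)
  fix i assume i: "i < p + q + 1"
  obtain g where g: "g \<in> PiM {0..int n} (\<lambda>_. borel) \<rightarrow>\<^sub>M PiM {..p + q} (\<lambda>_. borel :: real measure)"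
    and eq: "\<And>\<omega>. \<omega> \<in> space M \<Longrightarrow> est n \<omega> = g (\<lambda>t\<in>{0..int n}. X t \<omega>)"
    using est unfolding estimator_seq_def by blast
  have "(\<lambda>\<omega>. \<lambda>t\<in>{0..int n}. X t \<omega>) \<in> M \<rightarrow>\<^sub>M PiM {0..int n} (\<lambda>_. borel)"
    by (intro measurable_restrict X)
  from measurable_compose[OF measurable_compose[OF this g] measurable_component_singleton[of i]]
  have "(\<lambda>\<omega>. g (\<lambda>t\<in>{0..int n}. X t \<omega>) i) \<in> borel_measurable M"
    using i by simp
  then have "(\<lambda>\<omega>. est n \<omega> i) \<in> borel_measurable M"
    by (subst measurable_cong[OF arg_cong[where f = "\<lambda>z. z i", OF eq]])
  then show "(\<lambda>\<omega>. est n \<omega> i - u i) \<in> borel_measurable M" by simp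
qed simp

lemma nn_integral_le_expectation_bound:
  fixes f g :: "'a \<Rightarrow> real"
  assumes "integrable M g" "\<And>\<omega>. \<omega> \<in> space M \<Longrightarrow> f \<omega> \<le> g \<omega>" "\<And>\<omega>. 0 \<le> g \<omega>" "(\<integral>\<omega>. g \<omega> \<partial>M) \<le> c"
  shows "(\<integral>\<^sup>+ \<omega>. ennreal (f \<omega>) \<partial>M) \<le> ennreal c"
proof -
  have "(\<integral>\<^sup>+ \<omega>. ennreal (f \<omega>) \<partial>M) \<le> (\<integral>\<^sup>+ \<omega>. ennreal (g \<omega>) \<partial>M)"
    using assms(2) by (intro nn_integral_mono ennreal_leI)
  also have "\<dots> = ennreal (\<integral>\<omega>. g \<omega> \<partial>M)"
    using assms by (intro nn_integral_eq_integral) auto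
  also have "\<dots> \<le> ennreal c" using assms(4) by (rule ennreal_leI)
  finally show ?thesis .
qed

lemma abs_le_one_plus_square: "\<bar>x\<bar> \<le> 1 + x\<^sup>2" for x :: real
  using two_mult_le_sum_squares[of 1 "\<bar>x\<bar>"] by simp

lemma (in prob_space) nn_integral_geometric_abs_sum_le:
  fixes e :: "int \<Rightarrow> 'a \<Rightarrow> real"
  assumes e: "\<And>t. integrable M (\<lambda>\<omega>. (e t \<omega>)\<^sup>2)" "\<And>t. expectation (\<lambda>\<omega>. (e t \<omega>)\<^sup>2) = 1"
    and r: "0 < r" "r < 1"
  shows "(\<integral>\<^sup>+ \<omega>. ennreal (\<Sum>t=1..n. r ^ t * \<bar>e (int t) \<omega>\<bar>) \<partial>M) \<le> ennreal (2 / (1 - r))"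
proof (rule nn_integral_le_expectation_bound)
  let ?g = "\<lambda>\<omega>. \<Sum>t=1..n. r ^ t * (1 + (e (int t) \<omega>)\<^sup>2)"
  show "integrable M ?g" using e(1) by auto
  show "0 \<le> ?g \<omega>" for \<omega> using r by (intro sum_nonneg) auto
  show "(\<Sum>t=1..n. r ^ t * \<bar>e (int t) \<omega>\<bar>) \<le> ?g \<omega>" for \<omega>
    using r by (intro sum_mono mult_left_mono abs_le_one_plus_square) auto
  have mean: "expectation (\<lambda>\<omega>. r ^ t * (1 + (e (int t) \<omega>)\<^sup>2)) = r ^ t * 2" for t
    using e by (simp add: prob_space)
  have "expectation ?g = (\<Sum>t=1..n. expectation (\<lambda>\<omega>. r ^ t * (1 + (e (int t) \<omega>)\<^sup>2)))"
    using e(1) by (intro Bochner_Integration.integral_sum) auto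
  also have "\<dots> = (\<Sum>t=1..n. r ^ t * 2)" by (simp only: mean)
  also have "\<dots> = (\<Sum>t=1..n. r ^ t) * 2" by (simp only: sum_distrib_right)
  also have "\<dots> \<le> 1 / (1 - r) * 2"
  proof (rule mult_right_mono)
    have "(\<Sum>t=1..n. r ^ t) \<le> (\<Sum>t. r ^ t)"
      using r by (intro sum_le_suminf summable_geometric) auto
    also have "\<dots> = 1 / (1 - r)" using r by (intro suminf_geometric) auto
    finally show "(\<Sum>t=1..n. r ^ t) \<le> 1 / (1 - r)" .
  qed simp
  finally show "expectation ?g \<le> 2 / (1 - r)" by simp
qed

text \<open>
  The inequality \<open>y z \<le> y\<^sup>2 + z\<^sup>2\<close> decouples \<open>|e\<^sub>t|\<close> from the past values of \<open>x\<close>; this is why \<open>x\<close> appears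
  with the exponent \<open>s / 2\<close> on the left while a moment of order \<open>s\<close> is assumed.
\<close>

lemma (in prob_space) nn_integral_weighted_abs_sum_le:
  fixes e x :: "int \<Rightarrow> 'a \<Rightarrow> real"
  assumes e: "\<And>t. integrable M (\<lambda>\<omega>. (e t \<omega>)\<^sup>2)" "\<And>t. expectation (\<lambda>\<omega>. (e t \<omega>)\<^sup>2) = 1"
    and x: "\<And>t. integrable M (\<lambda>\<omega>. ((x t \<omega>)\<^sup>2) powr s)" "\<And>t. expectation (\<lambda>\<omega>. ((x t \<omega>)\<^sup>2) powr s) \<le> D"
    and nonneg: "0 \<le> c" "0 \<le> A" "0 \<le> D" and w: "0 \<le> w" "w < 1"
  shows "(\<integral>\<^sup>+ \<omega>. ennreal (\<Sum>t=1..n. \<bar>e (int t) \<omega>\<bar> * (c + (\<Sum>i=1..t. A * (real i * w ^ i) *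
             ((x (int t - int i) \<omega>)\<^sup>2) powr (s / 2)))) \<partial>M)
    \<le> ennreal (real n * (c * 2 + A * (1 / (1 - w)\<^sup>2) * (1 + D)))"
proof (rule nn_integral_le_expectation_bound)
  define b where "b i = A * (real i * w ^ i)" for i
  have b0: "0 \<le> b i" for i using nonneg w by (simp add: b_def)
  define g where "g t \<omega> = c * (1 + (e (int t) \<omega>)\<^sup>2)
      + (\<Sum>i=1..t. b i * ((e (int t) \<omega>)\<^sup>2 + ((x (int t - int i) \<omega>)\<^sup>2) powr s))" for t \<omega>
  have g_int: "integrable M (g t)" for t unfolding g_def[abs_def] using e(1) x(1) by auto
  have g0: "0 \<le> g t \<omega>" for t \<omega>
    unfolding g_def using nonneg b0 by (intro sum_nonneg add_nonneg_nonneg mult_nonneg_nonneg) auto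
  show "integrable M (\<lambda>\<omega>. \<Sum>t=1..n. g t \<omega>)" using g_int by auto
  show "0 \<le> (\<Sum>t=1..n. g t \<omega>)" for \<omega> using g0 by (intro sum_nonneg) auto
  show "(\<Sum>t=1..n. \<bar>e (int t) \<omega>\<bar> * (c + (\<Sum>i=1..t. A * (real i * w ^ i) *
             ((x (int t - int i) \<omega>)\<^sup>2) powr (s / 2)))) \<le> (\<Sum>t=1..n. g t \<omega>)" for \<omega>
    unfolding b_def[symmetric]
  proof (rule sum_mono)
    fix t :: nat
    have "\<bar>e (int t) \<omega>\<bar> * (b i * y powr (s / 2)) \<le> b i * ((e (int t) \<omega>)\<^sup>2 + y powr s)" for i y
    proof -
      have "(y powr (s / 2))\<^sup>2 = y powr s" by (simp add: power2_eq_square powr_add[symmetric])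
      then have "\<bar>e (int t) \<omega>\<bar> * y powr (s / 2) \<le> (e (int t) \<omega>)\<^sup>2 + y powr s"
        using two_mult_le_sum_squares[of "\<bar>e (int t) \<omega>\<bar>" "y powr (s / 2)"] by simp
      then have "b i * (\<bar>e (int t) \<omega>\<bar> * y powr (s / 2)) \<le> b i * ((e (int t) \<omega>)\<^sup>2 + y powr s)"
        by (rule mult_left_mono) (rule b0)
      then show ?thesis by (simp only: mult.left_commute)
    qed
    moreover have "\<bar>e (int t) \<omega>\<bar> * c \<le> c * (1 + (e (int t) \<omega>)\<^sup>2)"
      using mult_left_mono[OF abs_le_one_plus_square[of "e (int t) \<omega>"] nonneg(1)] by (simp only: mult.commute)
    ultimately show "\<bar>e (int t) \<omega>\<bar> * (c + (\<Sum>i=1..t. b i * ((x (int t - int i) \<omega>)\<^sup>2) powr (s / 2))) \<le> g t \<omega>"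
      unfolding g_def distrib_left[of "\<bar>e (int t) \<omega>\<bar>"] sum_distrib_left by (intro add_mono sum_mono)
  qed
  have "expectation (g t) \<le> c * 2 + A * (1 / (1 - w)\<^sup>2) * (1 + D)" for t
  proof -
    have "expectation (g t) = c * 2 + (\<Sum>i=1..t. b i * (1 + expectation (\<lambda>\<omega>. ((x (int t - int i) \<omega>)\<^sup>2) powr s)))"
      unfolding g_def[abs_def] using e x(1) by (simp add: prob_space)
    also have "\<dots> \<le> c * 2 + (\<Sum>i=1..t. b i * (1 + D))"
      using b0 x(2) by (intro add_left_mono sum_mono mult_left_mono) auto
    also have "(\<Sum>i=1..t. b i * (1 + D)) = A * (\<Sum>i=1..t. real i * w ^ i) * (1 + D)"
      unfolding b_def by (simp only: sum_distrib_left sum_distrib_right)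
    also have "\<dots> \<le> A * (1 / (1 - w)\<^sup>2) * (1 + D)"
      using nonneg w by (intro mult_right_mono mult_left_mono sum_nat_mult_power_le) auto
    finally show ?thesis by simp
  qed
  then have "(\<Sum>t=1..n. expectation (g t)) \<le> (\<Sum>t=1..n. c * 2 + A * (1 / (1 - w)\<^sup>2) * (1 + D))"
    by (intro sum_mono)
  then show "expectation (\<lambda>\<omega>. \<Sum>t=1..n. g t \<omega>) \<le> real n * (c * 2 + A * (1 / (1 - w)\<^sup>2) * (1 + D))"
    using g_int by (subst Bochner_Integration.integral_sum) auto
qed

theorem theorem2p1:
  fixes M :: "'a measure"
    and p q :: nat
    and theta :: "nat \<Rightarrow> real"
    and ulow uup rho0 :: real
    and eps X sig :: "int \<Rightarrow> 'a \<Rightarrow> real"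
    and theta_hat :: "nat \<Rightarrow> 'a \<Rightarrow> nat \<Rightarrow> real"
    and f K :: "real \<Rightarrow> real"
    and h :: "nat \<Rightarrow> real"
  assumes "prob_space M"
    and "p \<ge> 1" and "q \<ge> 1"
    and "0 < ulow" and "ulow < uup" and "0 < rho0" and "rho0 < 1" and "real q * ulow < rho0"
    and "garch_params p q theta"
    and "iid_standardized M eps"
    and "bougerol_picard p q theta M eps"
    and "stationary_garch p q theta M eps X sig"
    and "theta \<in> interior_Theta p q ulow uup rho0"
    and "estimator_seq p q M X theta_hat"
    and "bounded_in_prob M
           (\<lambda>n \<omega>. sqrt (real n) * max_norm (p + q + 1) (\<lambda>i. theta_hat n \<omega> i - theta i))"
    and "\<exists>zeta>0. ((\<lambda>x. x powr (- zeta) * measure M {\<omega> \<in> space M. \<bar>eps 0 \<omega>\<bar> \<le> x})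
                    \<longlongrightarrow> 0) (at_right 0)"
    and "\<And>x. 0 \<le> f x"
    and "distributed M lborel (eps 0) (\<lambda>x. ennreal (f x))"
    and "uniformly_continuous_on UNIV f"
    and "standardized_kernel K"
    and "\<And>n. h n > 0"
    and "h \<longlonglongrightarrow> 0"
    and "filterlim (\<lambda>n. sqrt (real n) * (h n)\<^sup>2) at_top sequentially"
    and "((\<lambda>b. SUP x\<in>{x. \<bar>x\<bar> > b}. ereal (\<bar>x\<bar> * K x)) \<longlongrightarrow> 0) at_top"
    and "\<exists>C. \<forall>x y. \<bar>K x - K y\<bar> \<le> C * \<bar>x - y\<bar>"
    and "integrable M (\<lambda>\<omega>. \<bar>eps 0 \<omega>\<bar>)"
  shows "null_in_prob M
           (\<lambda>n \<omega>. SUP x. ereal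
              \<bar>kernel_estimator K (h n) n (residual p q (theta_hat n \<omega>) (\<lambda>t. X t \<omega>)) x
               - kernel_estimator K (h n) n (\<lambda>t. eps (int t) \<omega>) x\<bar>)"
proof -
  interpret prob_space M by fact
  note pq = assms(2,3) and l = assms(4) and rho0 = assms(6,7) and iid = assms(10) and garch = assms(12)
  note eps = iid_standardized_moments[OF iid]
  note [measurable] = eps(2) stationary_garch_measurable[OF garch]
  have "theta \<in> Theta p q ulow uup rho0"
    by (rule subsetD[OF interior_of_subset assms(13)[unfolded interior_Theta_def]])
  then have ulow: "\<And>k. k \<le> p + q \<Longrightarrow> ulow \<le> theta k" and B: "(\<Sum>j=1..q. theta (p + j)) \<le> rho0"
    by (auto simp: Theta_def)
  have pos: "0 < theta k" if "k \<le> p + q" for k using l ulow[OF that] by (rule less_le_trans)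
  have nn: "0 \<le> theta k" if "k \<le> p + q" for k using pos[OF that] by (rule less_imp_le)
  have lyap: "top_lyapunov p q theta M eps < 0" using assms(11) unfolding bougerol_picard_def by (rule conjunct2)
  have pos1: "0 < theta 1" "0 < theta (p + 1)" by (rule pos; use pq in simp)+
  obtain s C0 where moment: "0 < s \<and> s \<le> 1 \<and> 0 \<le> C0 \<and>
      (\<forall>t. (\<integral>\<^sup>+ \<omega>. ennreal (((X t \<omega>)\<^sup>2) powr s) \<partial>M) \<le> ennreal C0)"
    using stationary_garch_power_moment[OF iid pq _ pos1 lyap garch] nn by auto
  have s: "0 < s" "s \<le> 1" "0 \<le> C0" using moment by simp_all
  have C0: "(\<integral>\<^sup>+ \<omega>. ennreal (((X t \<omega>)\<^sup>2) powr s) \<partial>M) \<le> ennreal C0" for t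
    using moment by (elim conjE) (erule spec)
  \<comment> \<open>the rate at which every solution of the homogeneous recursion decays\<close>
  define r where "r = root q rho0"
  have r: "0 < r" "r < 1" "r ^ q = rho0"
    using pq rho0 by (auto simp: r_def)
  have Br: "(\<Sum>j=1..q. theta (p + j)) \<le> r ^ q" using B by (simp only: r(3))
  obtain C where C: "0 < C" "\<And>i. garch_coeff p q theta i \<le> C * r ^ i"
    using garch_coeff_geometric_decay[OF nn Br r(1) less_imp_le[OF r(2)]] by blast
  \<comment> \<open>half of the exponent of the moment, to leave room for decoupling \<open>\<epsilon>\<^sub>t\<close> from the past of \<open>X\<close>\<close>
  define a where "a = s / 2"
  have a: "0 < a" "a \<le> 1" using s by (simp_all add: a_def)
  have ra: "0 < r powr a" "r powr a < 1"
    using r(1) powr_less_mono2[OF a(1) _ r(2)] by simp_all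
  obtain \<eta>0 where eta0: "0 < \<eta>0" "\<eta>0 \<le> 1" and w1: "(1 + \<eta>0)\<^sup>2 * r powr a < 1"
    and rho: "(1 + \<eta>0) * rho0 \<le> (1 + rho0) / 2"
    using exists_damping_margin[OF ra rho0] by blast
  define w where "w = (1 + \<eta>0)\<^sup>2 * r powr a"
  define \<rho> where "\<rho> = (1 + rho0) / 2"
  have w: "0 \<le> w" "w < 1" using w1 by (simp_all add: w_def)
  have rho: "\<rho> < 1" "(1 + \<eta>0) * r ^ q \<le> \<rho>" "r ^ q \<le> \<rho>"
    using rho rho0 unfolding r(3) \<rho>_def by simp_all
  obtain CK0 where CK0: "\<And>x y. \<bar>K x - K y\<bar> \<le> CK0 * \<bar>x - y\<bar>" using assms(25) by blast
  have CK: "\<bar>K x - K y\<bar> \<le> \<bar>CK0\<bar> * \<bar>x - y\<bar>" for x y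
    by (rule order_trans[OF CK0 mult_right_mono]) simp_all
  define A where "A = (2 * C / theta 0) powr a"
  define c where "c = 4 / (1 - \<rho>)\<^sup>2"
  have Ac: "0 \<le> A" "0 < c" using rho(1) by (simp_all add: A_def c_def)
  define \<Delta> where "\<Delta> = (\<lambda>n \<omega>. max_norm (p + q + 1) (\<lambda>i. theta_hat n \<omega> i - theta i))"
  define Z where "Z = (\<lambda>\<omega>. 2 * ((\<Sum>k<p + q. \<bar>(sig (int k) \<omega>)\<^sup>2 - trunc_var p q theta (\<lambda>t. X t \<omega>) k\<bar>) / r ^ (p + q)) / theta 0)"
  define V where "V = (\<lambda>n \<omega>. \<Sum>t=1..n. r ^ t * \<bar>eps (int t) \<omega>\<bar>)"
  define U where "U = (\<lambda>n \<omega>. \<Sum>t=1..n. \<bar>eps (int t) \<omega>\<bar> * (c + (\<Sum>i=1..t. A * (real i * w ^ i) *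
             ((X (int t - int i) \<omega>)\<^sup>2) powr a)))"
  have X_int: "integrable M (\<lambda>\<omega>. ((X t \<omega>)\<^sup>2) powr s)"
    and X_le: "expectation (\<lambda>\<omega>. ((X t \<omega>)\<^sup>2) powr s) \<le> C0" for t
  proof -
    show int: "integrable M (\<lambda>\<omega>. ((X t \<omega>)\<^sup>2) powr s)"
      using le_less_trans[OF C0[of t] ennreal_less_top] by (intro integrableI_nonneg) auto
    have "ennreal (expectation (\<lambda>\<omega>. ((X t \<omega>)\<^sup>2) powr s)) \<le> ennreal C0"
      using C0[of t] by (subst nn_integral_eq_integral[symmetric, OF int]) auto
    then show "expectation (\<lambda>\<omega>. ((X t \<omega>)\<^sup>2) powr s) \<le> C0" using s(3) by simp
  qed
  show ?thesis
  proof (rule null_in_prob_sup_of_bound[where C = "\<bar>CK0\<bar>" and k = "2 / ulow" and \<Delta> = \<Delta> and U = U and V = V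
      and Z = Z and h = h and thr = "\<eta>0 * ulow / 2"])
    show "AE \<omega> in M. \<Delta> n \<omega> \<le> \<eta>0 * ulow / 2 \<longrightarrow>
      (\<forall>x. \<bar>kernel_estimator K (h n) n (residual p q (theta_hat n \<omega>) (\<lambda>t. X t \<omega>)) x
               - kernel_estimator K (h n) n (\<lambda>t. eps (int t) \<omega>) x\<bar>
         \<le> \<bar>CK0\<bar> / (real n * (h n)\<^sup>2) * (Z \<omega> * V n \<omega> + 2 / ulow * \<Delta> n \<omega> * U n \<omega>))" for n
      using stationary_garch_AE_path[OF garch]
    proof (rule AE_mp, intro AE_I2 impI allI)
      fix \<omega> x
      assume path: "garch_path p q theta (\<lambda>t. eps t \<omega>) (\<lambda>t. X t \<omega>) (\<lambda>t. sig t \<omega>)"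
        and close: "\<Delta> n \<omega> \<le> \<eta>0 * ulow / 2"
      have rq: "r ^ q < 1" using rho0(2) by (simp only: r(3))
      show "\<bar>kernel_estimator K (h n) n (residual p q (theta_hat n \<omega>) (\<lambda>t. X t \<omega>)) x
               - kernel_estimator K (h n) n (\<lambda>t. eps (int t) \<omega>) x\<bar>
         \<le> \<bar>CK0\<bar> / (real n * (h n)\<^sup>2) * (Z \<omega> * V n \<omega> + 2 / ulow * \<Delta> n \<omega> * U n \<omega>)"
        using kernel_estimator_error_le[OF path ulow l Br rq eta0(2) rho C(2,1) r(1) less_imp_le[OF r(2)] a
            CK abs_ge_zero assms(21) close[unfolded \<Delta>_def], of n n x]
        unfolding Z_def V_def U_def \<Delta>_def A_def c_def w_def .
    qed
    show "bounded_in_prob M (\<lambda>n \<omega>. sqrt (real n) * \<Delta> n \<omega>)" unfolding \<Delta>_def by fact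
    show "0 \<le> \<Delta> n \<omega>" for n \<omega> unfolding \<Delta>_def by (rule max_norm_nonneg) simp
    show "0 \<le> V n \<omega>" for n \<omega> unfolding V_def using r by (intro sum_nonneg) auto
    show "0 \<le> U n \<omega>" for n \<omega>
      unfolding U_def using Ac w by (intro sum_nonneg mult_nonneg_nonneg add_nonneg_nonneg) auto
    show "\<Delta> n \<in> borel_measurable M" for n
      unfolding \<Delta>_def by (rule estimator_deviation_measurable[OF assms(14) stationary_garch_measurable(1)[OF garch]])
    show "V n \<in> borel_measurable M" for n unfolding V_def by measurable
    show "U n \<in> borel_measurable M" for n unfolding U_def by measurable
    show "Z \<in> borel_measurable M" unfolding Z_def trunc_var_def by measurable
    show "(\<integral>\<^sup>+ \<omega>. ennreal (U n \<omega>) \<partial>M) \<le> ennreal (real n * (c * 2 + A * (1 / (1 - w)\<^sup>2) * (1 + C0)))" for n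
      unfolding U_def a_def
      by (rule nn_integral_weighted_abs_sum_le[OF eps(4,5) X_int X_le less_imp_le[OF Ac(2)] Ac(1) s(3) w])
    show "0 < c * 2 + A * (1 / (1 - w)\<^sup>2) * (1 + C0)"
      using Ac s(3) by (intro add_pos_nonneg mult_nonneg_nonneg) auto
    show "(\<integral>\<^sup>+ \<omega>. ennreal (V n \<omega>) \<partial>M) \<le> ennreal (2 / (1 - r))" for n
      unfolding V_def by (rule nn_integral_geometric_abs_sum_le[OF eps(4,5) r(1,2)])
    show "0 < 2 / (1 - r)" using r by simp
    show "0 < \<eta>0 * ulow / 2" using eta0 l by simp
    show "0 \<le> \<bar>CK0\<bar>" by simp
    show "0 \<le> 2 / ulow" using l by simp
  qed (fact assms)+
qed

end
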